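(* Let $\rho$ be a state such that for every $\epsilon>0$ there is $c$ with $QK^{\epsilon}(\rho_n)>n-c$ for all $n$. Then for every rational $s\in(0,1)$, $\rho$ passes every $s$-strong Solovay test.
   Context: Let $\mathbb{U}$ be a fixed universal prefix-free Turing machine. Finite sets of vectors with complex algebraic entries are coded by natural numbers via a fixed canonical effective indexing; $\mathbb{U}(\sigma)\downarrow=F$ means that $\mathbb{U}$ on input $\sigma$ halts and outputs the code of $F$. $\mathbb{C}^{2^n}_{alg}$ denotes the vectors in $\mathbb{C}^{2^n}$ with complex algebraic entries. Logarithms are base 2. For a density matrix $\tau$ on $\mathbb{C}^{2^{n}}$ write $|\tau|=n$, and for $\epsilon>0$ define $QK^{\epsilon}(\tau)=\inf\{|\sigma|+\log|F| : \mathbb{U}(\sigma)\downarrow=F,\ F \text{ an orthonormal subset of } \mathbb{C}^{2^{|\tau|}}_{alg},\ \sum_{v\in F}\langle v|\tau|v\rangle>\epsilon\}$, with $\inf\emptyset=\infty$. A state is a sequence $\rho=(\rho_n)_{n\in\mathbb{N}}$ of density matrices $\rho_n$ on $\mathbb{C}^{2^n}$ such that the partial trace of $\rho_n$ over the last qubit equals $\rho_{n-1}$. A special projection is a Hermitian projection matrix with complex algebraic entries. For a special projection $S$ on $\mathbb{C}^{2^n}$ put $\tau(S)=2^{-n}\operatorname{Tr}(S)$ and $\rho(S)=\operatorname{Tr}(\rho_nS)$. A strong Solovay test is a computable sequence $(S^m)_m$ of special projections with $\sum_m\tau(S^m)<\infty$; $\rho$ fails it at level $\epsilon>0$ if $\rho(S^m)>\epsilon$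 for infinitely many $m$, and passes it if it fails it at no level $\epsilon>0$. For rational $s\in(0,1)$, an $s$-strong Solovay test is a strong Solovay test $(S^r)_r$ such that $\sum_r\tau(S^r)^s<\infty$ and $\sum_r\tau(S^r)$ is a computable real number. *)

theory Defs
  imports "HOL-Computational_Algebra.Polynomial" "HOL-Library.Nat_Bijection"
    "HOL-Library.Sublist" "HOL-Library.Extended_Real" "Jordan_Normal_Form.Matrix"
begin

datatype recf = RZero | RSucc | RProj nat | RComp recf "recf list" | RPrim recf recf | RMini recf

inductive reval :: "recf \<Rightarrow> nat list \<Rightarrow> nat \<Rightarrow> bool" where
  "reval RZero xs 0"
| "reval RSucc (x # xs) (Suc x)"
| "j < length xs \<Longrightarrow> reval (RProj j) xs (xs ! j)"
| "list_all2 (\<lambda>g y. reval g xs y) gs ys \<Longrightarrow> reval f ys z \<Longrightarrow> reval (RComp f gs) xs z"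
| "reval f xs z \<Longrightarrow> reval (RPrim f g) (0 # xs) z"
| "reval (RPrim f g) (n # xs) r \<Longrightarrow> reval g (n # r # xs) z \<Longrightarrow> reval (RPrim f g) (Suc n # xs) z"
| "reval f (n # xs) 0 \<Longrightarrow> (\<forall>m<n. \<exists>y. y \<noteq> 0 \<and> reval f (m # xs) y) \<Longrightarrow> reval (RMini f) xs n"

definition partial_recursive :: "(nat \<Rightarrow> nat option) \<Rightarrow> bool" where
  "partial_recursive f \<longleftrightarrow> (\<exists>r. \<forall>x y. reval r [x] y \<longleftrightarrow> f x = Some y)"

definition total_recursive :: "(nat \<Rightarrow> nat) \<Rightarrow> bool" where
  "total_recursive f \<longleftrightarrow> partial_recursive (\<lambda>x. Some (f x))"

definition str_code :: "bool list \<Rightarrow> nat" where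
  "str_code \<sigma> = list_encode (map (\<lambda>b. if b then 1 else 0) \<sigma>)"

definition partial_computable_machine :: "(bool list \<Rightarrow> nat option) \<Rightarrow> bool" where
  "partial_computable_machine M \<longleftrightarrow>
     (\<exists>f. partial_recursive f \<and> (\<forall>\<sigma>. M \<sigma> = f (str_code \<sigma>)))"

definition prefix_free_machine :: "(bool list \<Rightarrow> nat option) \<Rightarrow> bool" where
  "prefix_free_machine M \<longleftrightarrow> partial_computable_machine M \<and>
     (\<forall>\<sigma> \<tau>. M \<sigma> \<noteq> None \<longrightarrow> M \<tau> \<noteq> None \<longrightarrow> prefix \<sigma> \<tau> \<longrightarrow> \<sigma> = \<tau>)"

definition universal_pf_machine :: "(bool list \<Rightarrow> nat option) \<Rightarrow> bool" where
  "universal_pf_machine U \<longleftrightarrow> prefix_free_machine U \<and>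
     (\<forall>M. prefix_free_machine M \<longrightarrow> (\<exists>\<tau>. \<forall>\<sigma>. U (\<tau> @ \<sigma>) = M \<sigma>))"

definition rat_decode :: "nat \<Rightarrow> real" where
  "rat_decode n = (case prod_decode n of (a, b) \<Rightarrow> real_of_int (int_decode a) / real (Suc b))"

text \<open>An algebraic complex number is coded by an integer polynomial (coefficient list,
  lowest degree first) together with a rational rectangle [a,b] x [c,d] that contains
  exactly one root of the (nonzero) polynomial.\<close>
definition alg_decode :: "nat \<Rightarrow> complex option" where
  "alg_decode n = (case prod_decode n of (pc, bc) \<Rightarrow>
     let p = Poly (map (\<lambda>k. complex_of_int (int_decode k)) (list_decode pc));
         bx = map rat_decode (list_decode bc);
         R = {z. poly p z = 0 \<and> length bx = 4 \<and> bx ! 0 \<le> Re z \<and> Re z \<le> bx ! 1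
                  \<and> bx ! 2 \<le> Im z \<and> Im z \<le> bx ! 3}
     in if p \<noteq> 0 \<and> card R = 1 \<and> finite R then Some (THE z. z \<in> R) else None)"

definition entries_decode :: "nat \<Rightarrow> complex list option" where
  "entries_decode n = (let cs = map alg_decode (list_decode n) in
     if None \<in> set cs then None else Some (map the cs))"

definition vec_decode :: "nat \<Rightarrow> complex vec option" where
  "vec_decode n = map_option vec_of_list (entries_decode n)"

definition vecset_decode :: "nat \<Rightarrow> complex vec set option" where
  "vecset_decode n = (let vs = map vec_decode (list_decode n) in
     if None \<in> set vs then None else Some (set (map the vs)))"

definition mat_decode :: "nat \<Rightarrow> complex mat option" where
  "mat_decode n = (let rs = map entries_decode (list_decode n) in
     if None \<in> set rs then None
     else if (\<exists>k. \<forall>r\<in>set rs. length (the r) = k)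
     then Some (mat_of_rows_list (if rs = [] then 0 else length (the (hd rs))) (map the rs))
     else None)"

definition computable_real :: "real \<Rightarrow> bool" where
  "computable_real x \<longleftrightarrow> (\<exists>f. total_recursive f \<and> (\<forall>k. \<bar>rat_decode (f k) - x\<bar> \<le> 1 / 2 ^ k))"

definition mtrace :: "complex mat \<Rightarrow> complex" where
  "mtrace A = (\<Sum>i<dim_row A. A $$ (i, i))"

definition madj :: "complex mat \<Rightarrow> complex mat" where
  "madj A = mat (dim_col A) (dim_row A) (\<lambda>(i, j). cnj (A $$ (j, i)))"

definition cinner :: "complex vec \<Rightarrow> complex vec \<Rightarrow> complex" where
  "cinner v w = (\<Sum>i<dim_vec v. cnj (v $ i) * w $ i)"

definition braket :: "complex vec \<Rightarrow> complex mat \<Rightarrow> complex vec \<Rightarrow> complex" where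
  "braket v A w = cinner v (A *\<^sub>v w)"

definition density_matrix :: "nat \<Rightarrow> complex mat \<Rightarrow> bool" where
  "density_matrix d A \<longleftrightarrow> A \<in> carrier_mat d d \<and> madj A = A \<and>
     (\<forall>v \<in> carrier_vec d. Im (braket v A v) = 0 \<and> Re (braket v A v) \<ge> 0) \<and> mtrace A = 1"

text \<open>Partial trace over the last qubit: a matrix on C^(2^(n+1)) = C^(2^n) (x) C^2 with the last
  qubit the least significant bit of the basis index.\<close>
definition ptrace_last :: "complex mat \<Rightarrow> complex mat" where
  "ptrace_last A = mat (dim_row A div 2) (dim_col A div 2)
     (\<lambda>(i, j). A $$ (2 * i, 2 * j) + A $$ (2 * i + 1, 2 * j + 1))"

definition orthonormal :: "complex vec set \<Rightarrow> bool" where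
  "orthonormal F \<longleftrightarrow> (\<forall>v\<in>F. \<forall>w\<in>F. cinner v w = (if v = w then 1 else 0))"

text \<open>For a density matrix tau on C^(2^|tau|), i.e. of dimension dim_row tau = 2^|tau|.\<close>
definition QK :: "(bool list \<Rightarrow> nat option) \<Rightarrow> real \<Rightarrow> complex mat \<Rightarrow> ereal" where
  "QK U \<epsilon> \<tau> = Inf {ereal (real (length \<sigma>) + log 2 (real (card F))) | \<sigma> F k.
       U \<sigma> = Some k \<and> vecset_decode k = Some F \<and>
       F \<subseteq> carrier_vec (dim_row \<tau>) \<and> orthonormal F \<and>
       (\<Sum>v\<in>F. Re (braket v \<tau> v)) > \<epsilon>}"

definition is_state :: "(nat \<Rightarrow> complex mat) \<Rightarrow> bool" where
  "is_state \<rho> \<longleftrightarrow> (\<forall>n. density_matrix (2 ^ n) (\<rho> n)) \<and>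
     (\<forall>n. ptrace_last (\<rho> (Suc n)) = \<rho> n)"

definition special_projection :: "nat \<Rightarrow> complex mat \<Rightarrow> bool" where
  "special_projection n S \<longleftrightarrow> S \<in> carrier_mat (2 ^ n) (2 ^ n) \<and> madj S = S \<and> S * S = S \<and>
     (\<forall>i<2 ^ n. \<forall>j<2 ^ n. algebraic (S $$ (i, j)))"

definition qdim :: "complex mat \<Rightarrow> nat" where
  "qdim S = (LEAST n. dim_row S = 2 ^ n)"

definition tauS :: "complex mat \<Rightarrow> real" where
  "tauS S = Re (mtrace S) / 2 ^ qdim S"

definition rhoS :: "(nat \<Rightarrow> complex mat) \<Rightarrow> complex mat \<Rightarrow> real" where
  "rhoS \<rho> S = Re (mtrace (\<rho> (qdim S) * S))"

definition computable_mat_seq :: "(nat \<Rightarrow> complex mat) \<Rightarrow> bool" where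
  "computable_mat_seq S \<longleftrightarrow> (\<exists>f. total_recursive f \<and> (\<forall>m. mat_decode (f m) = Some (S m)))"

definition strong_solovay_test :: "(nat \<Rightarrow> complex mat) \<Rightarrow> bool" where
  "strong_solovay_test S \<longleftrightarrow> (\<forall>m. \<exists>n. special_projection n (S m)) \<and> computable_mat_seq S \<and>
     summable (\<lambda>m. tauS (S m))"

definition s_strong_solovay_test :: "real \<Rightarrow> (nat \<Rightarrow> complex mat) \<Rightarrow> bool" where
  "s_strong_solovay_test s S \<longleftrightarrow> strong_solovay_test S \<and>
     summable (\<lambda>r. tauS (S r) powr s) \<and> computable_real (\<Sum>r. tauS (S r))"

definition fails_at :: "(nat \<Rightarrow> complex mat) \<Rightarrow> (nat \<Rightarrow> complex mat) \<Rightarrow> real \<Rightarrow> bool" where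
  "fails_at \<rho> S \<epsilon> \<longleftrightarrow> infinite {m. rhoS \<rho> (S m) > \<epsilon>}"

definition passes :: "(nat \<Rightarrow> complex mat) \<Rightarrow> (nat \<Rightarrow> complex mat) \<Rightarrow> bool" where
  "passes \<rho> S \<longleftrightarrow> (\<forall>\<epsilon>>0. \<not> fails_at \<rho> S \<epsilon>)"

end

theory Submission
  imports Defs "HOL-Computational_Algebra.Fundamental_Theorem_Algebra"
begin

text \<open>
  Suppose \<open>\<rho>\<close> fails the test at level \<open>\<epsilon>\<close>. From \<open>m\<close> one can compute a set \<open>F\<^sub>m\<close> of orthonormal vectors
  with Gaussian rational entries whose projector is entrywise so close to \<open>S\<^sup>m\<close> that \<open>F\<^sub>m\<close> captures more than
  \<open>\<epsilon> / 2\<close> of \<open>\<rho>\<close> whenever \<open>S\<^sup>m\<close> captures more than \<open>\<epsilon>\<close>. It is found by unbounded search: Householder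
  reflections in rational vectors show that it exists, and closeness to the algebraic entries of
  \<open>S\<^sup>m\<close> is certified by evaluating the defining polynomials on a fine grid.

  Group the \<open>m\<close> into levels \<open>t\<close> with \<open>\<tau>(F\<^sub>m) \<approx> 2\<^bsup>- a t\<^esup>\<close>. Since \<open>\<Sum> \<tau>(S\<^sup>m)\<^sup>s\<close> converges and \<open>s < 1\<close>, for large \<open>a\<close> level
  \<open>t\<close> has at most \<open>2\<^bsup>(a - 2) t + c\<^esup>\<close> members. Writing \<open>t\<close> in unary followed by the index of \<open>m\<close> in its level
  describes \<open>F\<^sub>m\<close> by a prefix-free code of length \<open>(a - 1) t + O(1)\<close>, while \<open>log |F\<^sub>m| \<le> n - a t\<close>. Hence
  \<open>QK(\<rho>\<^sub>n) \<le> n - t + O(1)\<close>, and \<open>t\<close> is unbounded because every level is finite.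
\<close>

section \<open>Total recursive functions\<close>

text \<open>The obstacle is that \<open>QK\<close> admits only exactly orthonormal sets that a
  machine can output, while the test supplies only codes of algebraic matrices. Diagonalising S^m
  would require arithmetic with algebraic eigenvectors. For a candidate with rational coordinates,
  orthonormality is a finite list of integer identities, and only its closeness to S^m has to be
  approximated. Entrywise closeness is enough: the entries of a density matrix have modulus at most
  1, so with D = 2^n an entrywise error of 1/(Q D^2) moves the captured mass by at most 1/Q,
  whatever the state. The search therefore depends on the test alone. The same tolerance ties the
  number r of vectors to Tr(S^m). The constants: per level, an index costs b bits and the unary part
  one more, against a bits gained in log |F|. The count of a level permits any b >= s a, and s < 1
  leaves room for a = b + 2, so one bit per level is saved. Everything else (index offset,
  delimiters, simulation of the machine by U) is constant.\<close>

definition recn :: "nat \<Rightarrow> (nat list \<Rightarrow> nat) \<Rightarrow> bool" where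
  "recn k F \<longleftrightarrow> (\<exists>r. \<forall>xs. length xs = k \<longrightarrow> (\<forall>y. reval r xs y \<longleftrightarrow> y = F xs))"

inductive_cases reval_ZeroE: "reval RZero xs y"
inductive_cases reval_SuccE: "reval RSucc xs y"
inductive_cases reval_ProjE: "reval (RProj j) xs y"
inductive_cases reval_CompE: "reval (RComp f gs) xs y"
inductive_cases reval_Prim0E: "reval (RPrim f g) (0 # xs) y"
inductive_cases reval_PrimSucE: "reval (RPrim f g) (Suc n # xs) y"
inductive_cases reval_MiniE: "reval (RMini f) xs y"

lemma recn_zero: "recn k (\<lambda>xs. 0)"
  unfolding recn_def
  by (rule exI[of _ RZero]) (auto intro: reval.intros elim: reval_ZeroE)

lemma recn_proj: "j < k \<Longrightarrow> recn k (\<lambda>xs. xs ! j)"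
  unfolding recn_def
  by (rule exI[of _ "RProj j"]) (auto intro: reval.intros elim: reval_ProjE)

lemma recn_comp:
  assumes F: "recn (length Gs) F" and G: "\<And>G. G \<in> set Gs \<Longrightarrow> recn k G"
  shows "recn k (\<lambda>xs. F (map (\<lambda>G. G xs) Gs))"
proof -
  obtain rf where rf: "\<And>xs y. length xs = length Gs \<Longrightarrow> reval rf xs y \<longleftrightarrow> y = F xs"
    using F unfolding recn_def by blast
  have "\<forall>G. \<exists>r. G \<in> set Gs \<longrightarrow> (\<forall>xs. length xs = k \<longrightarrow> (\<forall>y. reval r xs y \<longleftrightarrow> y = G xs))"
    using G unfolding recn_def by blast
  then obtain R where R: "\<And>G xs y. G \<in> set Gs \<Longrightarrow> length xs = k \<Longrightarrow> reval (R G) xs y \<longleftrightarrow> y = G xs"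
    by metis
  have args: "list_all2 (\<lambda>g y. reval g xs y) (map R Gs) ys \<longleftrightarrow> ys = map (\<lambda>G. G xs) Gs"
    if "length xs = k" for xs ys
    using R[OF _ that] by (auto simp: list_all2_conv_all_nth list_eq_iff_nth_eq)
  have "reval (RComp rf (map R Gs)) xs y \<longleftrightarrow> y = F (map (\<lambda>G. G xs) Gs)" if "length xs = k" for xs y
  proof
    assume "reval (RComp rf (map R Gs)) xs y"
    then show "y = F (map (\<lambda>G. G xs) Gs)"
      by (rule reval_CompE) (use args[OF that] rf in auto)
  next
    assume "y = F (map (\<lambda>G. G xs) Gs)"
    then show "reval (RComp rf (map R Gs)) xs y"
      by (intro reval.intros(4)[where ys = "map (\<lambda>G. G xs) Gs"]) (use args[OF that] rf in auto)
  qed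
  then show ?thesis unfolding recn_def by blast
qed

definition rec2 :: "(nat \<Rightarrow> nat \<Rightarrow> nat) \<Rightarrow> bool" where
  "rec2 f \<longleftrightarrow> recn 2 (\<lambda>xs. f (xs ! 0) (xs ! 1))"

definition rec3 :: "(nat \<Rightarrow> nat \<Rightarrow> nat \<Rightarrow> nat) \<Rightarrow> bool" where
  "rec3 f \<longleftrightarrow> recn 3 (\<lambda>xs. f (xs ! 0) (xs ! 1) (xs ! 2))"

lemma total_recursive_iff: "total_recursive f \<longleftrightarrow> recn 1 (\<lambda>xs. f (xs ! 0))"
proof -
  have "(\<forall>x y. reval r [x] y \<longleftrightarrow> f x = y) \<longleftrightarrow>
        (\<forall>xs. length xs = 1 \<longrightarrow> (\<forall>y. reval r xs y \<longleftrightarrow> y = f (xs ! 0)))" for r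
    by (auto simp: length_Suc_conv)
  then show ?thesis
    unfolding total_recursive_def partial_recursive_def recn_def by simp
qed

lemma recn_app1: "total_recursive f \<Longrightarrow> recn k A \<Longrightarrow> recn k (\<lambda>xs. f (A xs))"
  using recn_comp[of "[A]" "\<lambda>xs. f (xs ! 0)" k] by (simp add: total_recursive_iff)

lemma recn_app2: "rec2 f \<Longrightarrow> recn k A \<Longrightarrow> recn k B \<Longrightarrow> recn k (\<lambda>xs. f (A xs) (B xs))"
  using recn_comp[of "[A, B]" "\<lambda>xs. f (xs ! 0) (xs ! 1)" k]
  by (auto simp add: rec2_def numeral_2_eq_2)

lemma total_recursive_Suc: "total_recursive Suc"
  unfolding total_recursive_iff recn_def
  by (rule exI[of _ RSucc]) (auto simp: length_Suc_conv intro: reval.intros elim: reval_SuccE)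

lemma recn_Suc: "recn k A \<Longrightarrow> recn k (\<lambda>xs. Suc (A xs))"
  by (rule recn_app1[OF total_recursive_Suc])

lemma recn_const: "recn k (\<lambda>xs. c)"
  by (induction c) (auto intro: recn_zero recn_Suc)

text \<open>\<open>RPrim\<close> recurses on the head of the list and hands counter, previous value
  and parameter to \<open>g\<close> in this order. One parameter is enough, since several can be
  packed by \<open>prod_encode\<close>.\<close>

lemma rec2_rec_nat:
  assumes "total_recursive f" and "rec3 g"
  shows "rec2 (\<lambda>n x. rec_nat (f x) (\<lambda>m r. g m r x) n)"
proof -
  obtain rf where rf: "\<And>x y. reval rf [x] y \<longleftrightarrow> y = f x"
    using assms(1) unfolding total_recursive_def partial_recursive_def option.inject by metis
  obtain rg where rg: "\<And>a b c y. reval rg [a, b, c] y \<longleftrightarrow> y = g a b c"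
    using assms(2) unfolding rec3_def recn_def
    by (metis (no_types, lifting) One_nat_def length_Cons list.size(3) nth_Cons_0 nth_Cons_Suc numeral_2_eq_2 numeral_3_eq_3)
  have *: "reval (RPrim rf rg) [n, x] y \<longleftrightarrow> y = rec_nat (f x) (\<lambda>m r. g m r x) n" for n x y
  proof (induction n arbitrary: y)
    case 0
    show ?case using rf by (auto intro: reval.intros elim: reval_Prim0E)
  next
    case (Suc n)
    show ?case
    proof
      assume "reval (RPrim rf rg) [Suc n, x] y"
      then show "y = rec_nat (f x) (\<lambda>m r. g m r x) (Suc n)"
        by (rule reval_PrimSucE) (use Suc rg in auto)
    next
      assume "y = rec_nat (f x) (\<lambda>m r. g m r x) (Suc n)"
      then show "reval (RPrim rf rg) [Suc n, x] y"
        by (intro reval.intros(6)[where r = "rec_nat (f x) (\<lambda>m r. g m r x) n"]) (use Suc rg in auto)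
    qed
  qed
  then show ?thesis
    unfolding rec2_def recn_def
    by (intro exI[of _ "RPrim rf rg"]) (auto simp: numeral_2_eq_2 length_Suc_conv)
qed

lemma reval_RMini_iff:
  assumes "\<And>n x y. reval r [n, x] y \<longleftrightarrow> y = f n x"
  shows "reval (RMini r) [x] n \<longleftrightarrow> f n x = 0 \<and> (\<forall>m<n. f m x \<noteq> 0)"
proof
  assume "reval (RMini r) [x] n"
  then show "f n x = 0 \<and> (\<forall>m<n. f m x \<noteq> 0)"
    by (rule reval_MiniE) (use assms in auto)
next
  assume "f n x = 0 \<and> (\<forall>m<n. f m x \<noteq> 0)"
  then show "reval (RMini r) [x] n"
    by (intro reval.intros(7)) (use assms in auto)
qed

lemma rec2_reval: "rec2 f \<Longrightarrow> \<exists>r. \<forall>n x y. reval r [n, x] y \<longleftrightarrow> y = f n x"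
  unfolding rec2_def recn_def
  by (metis One_nat_def length_Cons list.size(3) nth_Cons_0 nth_Cons_Suc numeral_2_eq_2)

lemma total_recursive_Least:
  assumes "rec2 f" and "\<And>x. \<exists>n. f n x = 0"
  shows "total_recursive (\<lambda>x. LEAST n. f n x = 0)"
proof -
  obtain r where r: "\<And>n x y. reval r [n, x] y \<longleftrightarrow> y = f n x"
    using rec2_reval[OF assms(1)] by blast
  have "reval (RMini r) [x] n \<longleftrightarrow> (LEAST n. f n x = 0) = n" for x n
    unfolding reval_RMini_iff[OF r]
    using assms(2)[of x] by (metis (mono_tags, lifting) LeastI_ex not_less_Least linorder_neqE_nat)
  then show ?thesis
    unfolding total_recursive_def partial_recursive_def by auto
qed

lemma recn_rec_nat:
  assumes "total_recursive f" "rec3 g" "recn k A" "recn k B"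
  shows "recn k (\<lambda>xs. rec_nat (f (B xs)) (\<lambda>m r. g m r (B xs)) (A xs))"
  by (rule recn_app2[OF rec2_rec_nat[OF assms(1,2)] assms(3,4)])

lemma recn_add: assumes "recn k A" "recn k B" shows "recn k (\<lambda>xs. A xs + B xs)"
proof -
  have "rec3 (\<lambda>m r x. Suc r)" unfolding rec3_def by (intro recn_Suc recn_proj) simp
  moreover have "total_recursive (\<lambda>x. x)" unfolding total_recursive_iff by (intro recn_proj) simp
  ultimately have "recn k (\<lambda>xs. rec_nat (B xs) (\<lambda>m r. Suc r) (A xs))"
    using recn_rec_nat assms by fast
  moreover have "rec_nat b (\<lambda>m r. Suc r) a = a + b" for a b :: nat by (induction a) auto
  ultimately show ?thesis by simp
qed

lemma recn_mult: assumes "recn k A" "recn k B" shows "recn k (\<lambda>xs. A xs * B xs)"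
proof -
  have "rec3 (\<lambda>m r x. x + r)" unfolding rec3_def by (intro recn_add recn_proj) auto
  moreover have "total_recursive (\<lambda>x. 0)" unfolding total_recursive_iff by (rule recn_zero)
  ultimately have "recn k (\<lambda>xs. rec_nat 0 (\<lambda>m r. B xs + r) (A xs))"
    using recn_rec_nat assms by fast
  moreover have "rec_nat 0 (\<lambda>m r. b + r) a = a * b" for a b :: nat by (induction a) auto
  ultimately show ?thesis by simp
qed

lemma recn_diff: assumes "recn k A" "recn k B" shows "recn k (\<lambda>xs. A xs - B xs)"
proof -
  have z: "total_recursive (\<lambda>x. 0)" unfolding total_recursive_iff by (rule recn_zero)
  have "rec3 (\<lambda>m r x. m)" unfolding rec3_def by (intro recn_proj) simp
  then have "total_recursive (\<lambda>x. rec_nat 0 (\<lambda>m r. m) x)"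
    unfolding total_recursive_iff by (intro recn_rec_nat[OF z]) (auto intro: recn_proj)
  moreover have "rec_nat 0 (\<lambda>m r. m) x = x - 1" for x :: nat by (cases x) auto
  ultimately have p: "total_recursive (\<lambda>x. x - 1)" by simp
  have "rec3 (\<lambda>m r x. r - 1)"
    unfolding rec3_def by (intro recn_app1[OF p] recn_proj) simp
  moreover have "total_recursive (\<lambda>x. x)" unfolding total_recursive_iff by (intro recn_proj) simp
  ultimately have "recn k (\<lambda>xs. rec_nat (A xs) (\<lambda>m r. r - 1) (B xs))"
    using recn_rec_nat assms by fast
  moreover have "rec_nat a (\<lambda>m r. r - 1) b = a - b" for a b :: nat by (induction b) auto
  ultimately show ?thesis by simp
qed

lemma recn_triangle: assumes "recn k A" shows "recn k (\<lambda>xs. triangle (A xs))"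
proof -
  have "rec3 (\<lambda>m r x. r + Suc m)" unfolding rec3_def by (intro recn_add recn_Suc recn_proj) auto
  moreover have "total_recursive (\<lambda>x. 0)" unfolding total_recursive_iff by (rule recn_zero)
  ultimately have "recn k (\<lambda>xs. rec_nat 0 (\<lambda>m r. r + Suc m) (A xs))"
    using recn_rec_nat[of "\<lambda>x. 0" "\<lambda>m r x. r + Suc m" k A A] assms by fast
  moreover have "rec_nat 0 (\<lambda>m r. r + Suc m) a = triangle a" for a by (induction a) auto
  ultimately show ?thesis by simp
qed

lemma recn_prod_encode: "recn k A \<Longrightarrow> recn k B \<Longrightarrow> recn k (\<lambda>xs. prod_encode (A xs, B xs))"
  unfolding prod_encode_def by (auto intro!: recn_add recn_triangle)

text \<open>The diagonal \<open>a + b\<close> of a pair with code \<open>x\<close> is the least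
  \<open>n\<close> with \<open>x < triangle (Suc n)\<close>, found by minimisation; truncated
  subtraction expresses the comparison. Both components follow from it.\<close>

lemma recn_prod_decode:
  assumes "recn k A"
  shows recn_fst: "recn k (\<lambda>xs. fst (prod_decode (A xs)))"
    and recn_snd: "recn k (\<lambda>xs. snd (prod_decode (A xs)))"
proof -
  define s where "s x = (LEAST n. Suc x - triangle (Suc n) = 0)" for x
  have ex: "\<exists>n. Suc x - triangle (Suc n) = 0" for x
    by (rule exI[of _ x]) simp
  have s: "total_recursive s"
    unfolding s_def
    by (rule total_recursive_Least[OF _ ex])
       (unfold rec2_def, intro recn_diff recn_Suc recn_triangle recn_proj, auto)
  have decode: "prod_decode x = (x - triangle (s x), s x - (x - triangle (s x)))" for x
  proof -
    obtain a b where ab: "prod_decode x = (a, b)" by fastforce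
    then have x: "x = triangle (a + b) + a"
      using prod_decode_inverse[of x] by (simp add: prod_encode_def)
    have mono: "triangle i \<le> triangle j" if "i \<le> j" for i j
      using that by (rule lift_Suc_mono_le[rotated]) auto
    have "s x = a + b"
      unfolding s_def
    proof (rule Least_equality)
      fix n assume n: "Suc x - triangle (Suc n) = 0"
      show "a + b \<le> n"
      proof (rule ccontr)
        assume "\<not> a + b \<le> n"
        then have "triangle (Suc n) \<le> triangle (a + b)" by (intro mono) auto
        with n x show False by linarith
      qed
    qed (use x in simp)
    with ab x show ?thesis by simp
  qed
  have sA: "recn k (\<lambda>xs. s (A xs))" by (rule recn_app1[OF s assms])
  show "recn k (\<lambda>xs. fst (prod_decode (A xs)))" "recn k (\<lambda>xs. snd (prod_decode (A xs)))"
    unfolding decode fst_conv snd_conv by (intro recn_diff recn_triangle sA assms)+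
qed

section \<open>Computable functions on encoded types\<close>

text \<open>On \<open>nat list\<close>, \<open>int\<close> and \<open>nat \<times> nat\<close> the encoding inverts \<open>list_decode\<close>, \<open>int_decode\<close> and
  \<open>prod_decode\<close>, and on \<open>bool list\<close> it is \<open>str_code\<close>.\<close>

class enc =
  fixes enc :: "'a \<Rightarrow> nat"
  assumes inj_enc: "inj enc"

lemma enc_eq_iff [simp]: "enc x = enc y \<longleftrightarrow> x = y"
  using inj_enc by (rule inj_eq)

instantiation nat :: enc
begin
definition enc_nat_def [simp]: "enc (n::nat) = n"
instance by standard (simp add: inj_def)
end

instantiation int :: enc
begin
definition enc_int_def: "enc (i::int) = int_encode i"
instance by standard (simp add: enc_int_def inj_def int_encode_eq)
end

instantiation bool :: enc
begin
definition enc_bool_def: "enc (b::bool) = (if b then 1 else 0)"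
instance by standard (simp add: enc_bool_def inj_def)
end

instantiation prod :: (enc, enc) enc
begin
definition enc_prod_def: "enc p = prod_encode (enc (fst p), enc (snd p))"
instance by standard (auto simp: enc_prod_def inj_def)
end

instantiation list :: (enc) enc
begin
definition enc_list_def: "enc xs = list_encode (map enc xs)"
instance
proof
  show "inj (enc :: 'a list \<Rightarrow> nat)"
    by (rule injI) (simp add: enc_list_def list_encode_eq inj_map_eq_map[OF inj_enc])
qed
end

text \<open>Minimisation has to terminate on every natural number, also on one that codes nothing. A
  surjective encoding leaves no such number, so termination on the values of the type
  suffices.\<close>

class enc_surj = enc +
  assumes surj_enc: "surj enc"

instance nat :: enc_surj
  by standard (metis enc_nat_def surjI)

instance int :: enc_surj
  by standard (metis enc_int_def int_decode_inverse surjI)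

instance prod :: (enc_surj, enc_surj) enc_surj
proof
  have "\<exists>p::'a \<times> 'b. n = enc p" for n
  proof -
    obtain a b where "prod_decode n = (a, b)" by fastforce
    moreover obtain x :: 'a where "a = enc x" using surj_enc by (metis surjD)
    moreover obtain y :: 'b where "b = enc y" using surj_enc by (metis surjD)
    ultimately have "n = enc (x, y)"
      unfolding enc_prod_def fst_conv snd_conv by (metis prod_decode_inverse)
    then show ?thesis ..
  qed
  then show "surj (enc :: 'a \<times> 'b \<Rightarrow> nat)" by (auto simp: surj_def)
qed

instance list :: (enc_surj) enc_surj
proof
  show "surj (enc :: 'a list \<Rightarrow> nat)"
  proof (rule surjI)
    fix n
    show "enc (map (inv_into UNIV enc) (list_decode n) :: 'a list) = n"
      by (simp add: enc_list_def comp_def surj_f_inv_f[OF surj_enc])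
  qed
qed

definition computable :: "('a::enc \<Rightarrow> 'b::enc) \<Rightarrow> bool" where
  "computable f \<longleftrightarrow> (\<exists>g. total_recursive g \<and> (\<forall>x. g (enc x) = enc (f x)))"

named_theorems computable_intros

lemma computableI: "recn 1 (\<lambda>xs. g (xs ! 0)) \<Longrightarrow> (\<And>x. g (enc x) = enc (f x)) \<Longrightarrow> computable f"
  unfolding computable_def total_recursive_iff by blast

lemma computableE:
  assumes "computable f"
  obtains g where "total_recursive g" "\<And>x. g (enc x) = enc (f x)"
  using assms unfolding computable_def by blast

lemma computable_nat_iff: "computable (f :: nat \<Rightarrow> nat) \<longleftrightarrow> total_recursive f"
proof -
  have "computable f \<Longrightarrow> total_recursive f"
    by (erule computableE) (metis enc_nat_def ext)
  then show ?thesis unfolding computable_def by (metis enc_nat_def)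
qed

lemma computable_const [computable_intros]: "computable (\<lambda>x. c)"
  by (rule computableI[OF recn_const]) simp

lemma computable_id [computable_intros]: "computable (\<lambda>x. x)"
  by (rule computableI[of "\<lambda>x. x"]) (auto intro: recn_proj)

lemma computable_compose: "computable f \<Longrightarrow> computable g \<Longrightarrow> computable (\<lambda>x. f (g x))"
proof (elim computableE)
  fix F G assume F: "total_recursive F" "\<And>x. F (enc x) = enc (f x)"
    and G: "total_recursive G" "\<And>x. G (enc x) = enc (g x)"
  show ?thesis
  proof (rule computableI[of "\<lambda>x. F (G x)"])
    show "recn 1 (\<lambda>xs. F (G (xs ! 0)))"
      by (intro recn_app1[OF F(1)] recn_app1[OF G(1)] recn_proj) simp
  qed (simp add: F G)
qed

text \<open>Only codes matter, so functions into different types with equal codes are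
  interchangeable. In this way the decoding functions are computed by the identity on codes.\<close>

lemma computable_cast: "computable f \<Longrightarrow> (\<And>x. enc (f x) = enc (g x)) \<Longrightarrow> computable g"
  unfolding computable_def by metis

lemma computable_enc [computable_intros]: "computable f \<Longrightarrow> computable (\<lambda>x. enc (f x))"
  by (erule computable_cast) simp

lemma computable_nat2:
  assumes "\<And>k A B. recn k A \<Longrightarrow> recn k B \<Longrightarrow> recn k (\<lambda>xs. h (A xs) (B xs))"
    and "computable f" "computable g" and "\<And>x. h (enc (f x)) (enc (g x)) = enc (r x)"
  shows "computable r"
proof -
  obtain F where F: "total_recursive F" "\<And>x. F (enc x) = enc (f x)"
    using computableE[OF assms(2)] by blast
  obtain G where G: "total_recursive G" "\<And>x. G (enc x) = enc (g x)"
    using computableE[OF assms(3)] by blast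
  show ?thesis
  proof (rule computableI[of "\<lambda>x. h (F x) (G x)"])
    show "recn 1 (\<lambda>xs. h (F (xs ! 0)) (G (xs ! 0)))"
      by (intro assms(1) recn_app1[OF F(1)] recn_app1[OF G(1)] recn_proj) simp_all
  qed (simp add: F G assms(4))
qed

lemma computable_Suc [computable_intros]:
  "computable f \<Longrightarrow> computable (\<lambda>x. Suc (f x))"
  by (rule computable_nat2[of "\<lambda>a b. Suc a" f f]) (auto intro: recn_Suc)

lemma computable_add_nat [computable_intros]:
  "computable f \<Longrightarrow> computable g \<Longrightarrow> computable (\<lambda>x. f x + g x :: nat)"
  by (rule computable_nat2[of "(+)" f g]) (auto intro: recn_add)

lemma computable_mult_nat [computable_intros]:
  "computable f \<Longrightarrow> computable g \<Longrightarrow> computable (\<lambda>x. f x * g x :: nat)"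
  by (rule computable_nat2[of "(*)" f g]) (auto intro: recn_mult)

lemma computable_diff_nat [computable_intros]:
  "computable f \<Longrightarrow> computable g \<Longrightarrow> computable (\<lambda>x. f x - g x :: nat)"
  by (rule computable_nat2[of "(-)" f g]) (auto intro: recn_diff)

lemma computable_Pair [computable_intros]:
  "computable f \<Longrightarrow> computable g \<Longrightarrow> computable (\<lambda>x. (f x, g x))"
  by (rule computable_nat2[of "\<lambda>a b. prod_encode (a, b)" f g])
     (auto intro: recn_prod_encode simp: enc_prod_def)

lemma computable_fst [computable_intros]: "computable f \<Longrightarrow> computable (\<lambda>x. fst (f x))"
  by (rule computable_nat2[of "\<lambda>a b. fst (prod_decode a)" f f])
     (auto intro: recn_fst simp: enc_prod_def)

lemma computable_snd [computable_intros]: "computable f \<Longrightarrow> computable (\<lambda>x. snd (f x))"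
  by (rule computable_nat2[of "\<lambda>a b. snd (prod_decode a)" f f])
     (auto intro: recn_snd simp: enc_prod_def)

lemma computable_app2:
  assumes "computable (\<lambda>p. h (fst p) (snd p))" "computable f" "computable g"
  shows "computable (\<lambda>x. h (f x) (g x))"
  using computable_compose[OF assms(1) computable_Pair[OF assms(2,3)]] by simp

lemma computable_app3:
  assumes "computable (\<lambda>p. h (fst p) (fst (snd p)) (snd (snd p)))"
    and "computable f" "computable g" "computable k"
  shows "computable (\<lambda>x. h (f x) (g x) (k x))"
  using computable_compose[OF assms(1) computable_Pair[OF assms(2) computable_Pair[OF assms(3,4)]]]
  by simp

lemma computable_not [computable_intros]: "computable P \<Longrightarrow> computable (\<lambda>x. \<not> P x)"
  by (rule computable_nat2[of "\<lambda>a b. 1 - a" P P])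
     (auto intro!: recn_diff recn_Suc recn_zero simp: enc_bool_def)

lemma computable_conj [computable_intros]:
  "computable P \<Longrightarrow> computable Q \<Longrightarrow> computable (\<lambda>x. P x \<and> Q x)"
  by (rule computable_nat2[of "(*)" P Q]) (auto intro!: recn_mult simp: enc_bool_def)

lemma computable_disj [computable_intros]:
  "computable P \<Longrightarrow> computable Q \<Longrightarrow> computable (\<lambda>x. P x \<or> Q x)"
  using computable_not[OF computable_conj[OF computable_not computable_not]] by simp

lemma computable_imp [computable_intros]:
  "computable P \<Longrightarrow> computable Q \<Longrightarrow> computable (\<lambda>x. P x \<longrightarrow> Q x)"
  unfolding imp_conv_disj by (intro computable_intros)

lemma computable_le_nat [computable_intros]:
  "computable f \<Longrightarrow> computable g \<Longrightarrow> computable (\<lambda>x. f x \<le> (g x :: nat))"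
  by (rule computable_nat2[of "\<lambda>a b. 1 - (a - b)" f g])
     (auto intro!: recn_diff recn_Suc recn_zero simp: enc_bool_def)

lemma computable_less_nat [computable_intros]:
  "computable f \<Longrightarrow> computable g \<Longrightarrow> computable (\<lambda>x. f x < (g x :: nat))"
  unfolding not_le[symmetric] by (intro computable_intros)

lemma computable_eq [computable_intros]:
  fixes f g :: "'a::enc \<Rightarrow> 'b::enc"
  assumes "computable f" "computable g"
  shows "computable (\<lambda>x. f x = g x)"
proof -
  have "computable (\<lambda>x. enc (f x) \<le> enc (g x) \<and> enc (g x) \<le> enc (f x))"
    by (intro computable_intros assms)
  moreover have "(enc (f x) \<le> enc (g x) \<and> enc (g x) \<le> enc (f x)) = (f x = g x)" for x
    by (metis enc_eq_iff order_antisym order_refl)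
  ultimately show ?thesis by simp
qed

lemma computable_rec_nat [computable_intros]:
  assumes "computable h" "computable f"
    and "computable (\<lambda>p. g (fst p) (fst (snd p)) (snd (snd p)))"
  shows "computable (\<lambda>x. rec_nat (f x) (g x) (h x))"
proof -
  obtain H where H: "total_recursive H" "\<And>x. H (enc x) = enc (h x)"
    using computableE[OF assms(1)] by blast
  obtain F where F: "total_recursive F" "\<And>x. F (enc x) = enc (f x)"
    using computableE[OF assms(2)] by blast
  obtain G where G: "total_recursive G"
      "\<And>p. G (enc p) = enc (g (fst p) (fst (snd p)) (snd (snd p)))"
    using computableE[OF assms(3)] by blast
  have "rec3 (\<lambda>m r x. G (prod_encode (x, prod_encode (m, r))))"
    unfolding rec3_def by (intro recn_app1[OF G(1)] recn_prod_encode recn_proj) auto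
  then have "recn 1 (\<lambda>xs. rec_nat (F (xs ! 0))
      (\<lambda>m r. G (prod_encode (xs ! 0, prod_encode (m, r)))) (H (xs ! 0)))"
    by (intro recn_rec_nat[OF F(1)] recn_app1[OF H(1)] recn_proj) auto
  moreover have "rec_nat (F (enc x)) (\<lambda>m r. G (prod_encode (enc x, prod_encode (m, r)))) n
      = enc (rec_nat (f x) (g x) n)" for x n
    by (induction n) (use F(2) G(2)[of "(x, n, r)" for n r] in \<open>auto simp: enc_prod_def\<close>)
  ultimately show ?thesis
    by (intro computableI[where g = "\<lambda>x. rec_nat (F x)
      (\<lambda>m r. G (prod_encode (x, prod_encode (m, r)))) (H x)"]) (auto simp: H)
qed

lemma computable_if [computable_intros]:
  assumes "computable P" "computable f" "computable g"
  shows "computable (\<lambda>x. if P x then f x else g x)"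
proof -
  have "computable (\<lambda>x. enc (P x) * enc (f x) + (1 - enc (P x)) * enc (g x))"
    by (intro computable_intros assms)
  then show ?thesis by (rule computable_cast) (simp add: enc_bool_def)
qed

lemma computable_Least:
  assumes "computable (\<lambda>p. P (fst p) (snd p))" and "\<And>x::'a::enc_surj. \<exists>n::nat. P x n"
  shows "computable (\<lambda>x. LEAST n. P x n)"
proof -
  obtain G where G: "total_recursive G" "\<And>p. G (enc p) = enc (P (fst p) (snd p))"
    using computableE[OF assms(1)] by blast
  \<comment> \<open>Truth has code 1 but minimisation looks for 0, hence the complement.\<close>
  have G0: "1 - G (prod_encode (enc x, n)) = 0 \<longleftrightarrow> P x n" for x n
    using G(2)[of "(x, n)"] by (auto simp: enc_prod_def enc_bool_def)
  have "total_recursive (\<lambda>x. LEAST n. 1 - G (prod_encode (x, n)) = 0)"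
  proof (rule total_recursive_Least)
    show "rec2 (\<lambda>n x. 1 - G (prod_encode (x, n)))"
      unfolding rec2_def
      by (intro recn_diff recn_const recn_app1[OF G(1)] recn_prod_encode recn_proj) auto
    fix y
    obtain x :: 'a where "y = enc x" using surj_enc by (metis surjD)
    then show "\<exists>n. 1 - G (prod_encode (y, n)) = 0"
      using G0 assms(2)[of x] by auto
  qed
  then show ?thesis
    unfolding total_recursive_iff by (rule computableI) (use G0 in auto)
qed

lemma computable_inv_enc [computable_intros]:
  "computable f \<Longrightarrow> computable (\<lambda>x. inv_into UNIV enc (f x) :: 'b::enc_surj)"
  by (erule computable_cast) (simp add: surj_f_inv_f[OF surj_enc])

text \<open>Trying all codes in turn finds a witness, so a nonconstructive existence proof and a
  decidable \<open>P\<close> already give a computable selector. This turns the existence of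
  rational approximations into an algorithm.\<close>

lemma computable_choice:
  fixes P :: "'a::enc_surj \<Rightarrow> 'b::enc_surj \<Rightarrow> bool"
  assumes "computable (\<lambda>p. P (fst p) (snd p))" and "\<And>x. \<exists>y. P x y"
  shows "\<exists>h. computable h \<and> (\<forall>x. P x (h x))"
proof -
  define h where "h x = (inv_into UNIV enc (LEAST n. P x (inv_into UNIV enc n)) :: 'b)" for x
  have ex: "\<exists>n. P x (inv_into UNIV enc n)" for x
    using assms(2)[of x] by (metis inj_enc inv_f_f)
  have "computable (\<lambda>p. P (fst p) (inv_into UNIV enc (snd p :: nat)))"
    by (rule computable_compose[OF assms(1), of "\<lambda>p. (fst p, inv_into UNIV enc (snd p))", simplified])
       (intro computable_intros)
  then have "computable h"
    unfolding h_def by (intro computable_inv_enc computable_Least ex)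
  moreover have "P x (h x)" for x
    unfolding h_def by (rule LeastI_ex[OF ex])
  ultimately show ?thesis by blast
qed

section \<open>Arithmetic on naturals and integers, bounded quantifiers and sums\<close>

lemma computable_div_nat [computable_intros]:
  assumes "computable f" "computable g"
  shows "computable (\<lambda>x. f x div (g x :: nat))"
proof -
  \<comment> \<open>The disjunct \<open>snd p = 0\<close> stops the search at 0 for a vanishing
    divisor, which is the value of \<open>div\<close> there.\<close>
  have ex: "\<exists>k. snd p = 0 \<or> fst p < snd p * Suc k" for p :: "nat \<times> nat"
    by (rule exI[of _ "fst p"]) (cases "snd p", auto)
  have "computable (\<lambda>p. LEAST k. snd p = 0 \<or> fst p < snd p * Suc k)"
    by (intro computable_Least ex computable_intros)
  moreover have "(LEAST k. snd p = 0 \<or> fst p < snd p * Suc k) = fst p div snd p" for p :: "nat \<times> nat"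
  proof (cases "snd p = 0")
    case False
    show ?thesis
    proof (rule Least_equality)
      show "snd p = 0 \<or> fst p < snd p * Suc (fst p div snd p)"
        using dividend_less_times_div[of "snd p" "fst p"] False by simp
    next
      fix k assume "snd p = 0 \<or> fst p < snd p * Suc k"
      then have "fst p < Suc k * snd p" using False by (simp only: mult.commute) simp
      then have "fst p div snd p < Suc k" by (rule less_mult_imp_div_less)
      then show "fst p div snd p \<le> k" by simp
    qed
  qed simp
  ultimately have "computable (\<lambda>p. fst p div snd p :: nat)" by simp
  from computable_compose[OF this computable_Pair[OF assms]] show ?thesis by simp
qed

lemma computable_even [computable_intros]:
  "computable f \<Longrightarrow> computable (\<lambda>x. even (f x :: nat))"
proof -
  assume "computable f"
  then have "computable (\<lambda>x. f x = 2 * (f x div 2))" by (intro computable_intros)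
  moreover have "(n = 2 * (n div 2)) = even n" for n :: nat by presburger
  ultimately show ?thesis by simp
qed

lemma computable_power_nat [computable_intros]:
  assumes "computable f" "computable g"
  shows "computable (\<lambda>x. (f x :: nat) ^ g x)"
proof -
  have "computable (\<lambda>x. rec_nat 1 (\<lambda>_ r. f x * r) (g x))"
    by (intro computable_intros computable_compose[OF assms(1)] assms)
  moreover have "rec_nat 1 (\<lambda>_ r. a * r) n = a ^ n" for a n :: nat by (induction n) auto
  ultimately show ?thesis by simp
qed

text \<open>Under \<open>int_encode\<close> an integer \<open>i >= 0\<close> has code
  \<open>2 * i\<close> and a negative one has code \<open>2 * (- i - 1) + 1\<close>, so the positive
  and the negative part can be read off. Integer operations are carried out on these two
  parts.\<close>

lemma computable_nat [computable_intros]: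
  assumes "computable f" shows "computable (\<lambda>x. nat (f x))"
proof -
  have "computable (\<lambda>x. if even (enc (f x)) then enc (f x) div 2 else 0)"
    by (intro computable_intros assms)
  moreover have "(if even (enc i) then enc i div 2 else 0) = nat i" for i :: int
    by (auto simp: enc_int_def int_encode_def sum_encode_def)
  ultimately show ?thesis by simp
qed

lemma computable_nat_uminus [computable_intros]:
  assumes "computable f" shows "computable (\<lambda>x. nat (- f x))"
proof -
  have "computable (\<lambda>x. if even (enc (f x)) then 0 else Suc (enc (f x) div 2))"
    by (intro computable_intros assms)
  moreover have "(if even (enc i) then 0 else Suc (enc i div 2)) = nat (- i)" for i :: int
    by (auto simp: enc_int_def int_encode_def sum_encode_def)
  ultimately show ?thesis by simp
qed

lemma computable_int_diff:
  assumes "computable f" "computable g"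
  shows "computable (\<lambda>x. int (f x) - int (g x))"
proof -
  have "computable (\<lambda>x. if g x \<le> f x then 2 * (f x - g x) else Suc (2 * (g x - f x - 1)))"
    by (intro computable_intros assms)
  then show ?thesis
    by (rule computable_cast)
       (auto simp: enc_int_def int_encode_def sum_encode_def nat_diff_distrib)
qed

lemma computable_int [computable_intros]: "computable f \<Longrightarrow> computable (\<lambda>x. int (f x))"
  using computable_int_diff[of f "\<lambda>x. 0"] by (simp add: computable_const)

lemma computable_add_int [computable_intros]:
  assumes "computable f" "computable g" shows "computable (\<lambda>x. f x + g x :: int)"
proof -
  have "computable (\<lambda>x. int (nat (f x) + nat (g x)) - int (nat (- f x) + nat (- g x)))"
    by (intro computable_int_diff computable_intros assms)
  moreover have "int (nat a + nat b) - int (nat (- a) + nat (- b)) = a + b" for a b by simp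
  ultimately show ?thesis by simp
qed

lemma computable_uminus_int [computable_intros]:
  assumes "computable f" shows "computable (\<lambda>x. - f x :: int)"
proof -
  have "computable (\<lambda>x. int (nat (- f x)) - int (nat (f x)))"
    by (intro computable_int_diff computable_intros assms)
  moreover have "int (nat (- a)) - int (nat a) = - a" for a by simp
  ultimately show ?thesis by simp
qed

lemma computable_diff_int [computable_intros]:
  "computable f \<Longrightarrow> computable g \<Longrightarrow> computable (\<lambda>x. f x - g x :: int)"
  unfolding diff_conv_add_uminus by (intro computable_intros)

lemma computable_mult_int [computable_intros]:
  assumes "computable f" "computable g" shows "computable (\<lambda>x. f x * g x :: int)"
proof -
  have "computable (\<lambda>x. int (nat (f x) * nat (g x) + nat (- f x) * nat (- g x))
      - int (nat (f x) * nat (- g x) + nat (- f x) * nat (g x)))"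
    by (intro computable_int_diff computable_intros assms)
  moreover have "int (nat a * nat b + nat (- a) * nat (- b))
      - int (nat a * nat (- b) + nat (- a) * nat b) = a * b" for a b
    by (cases "0 \<le> a"; cases "0 \<le> b") auto
  ultimately show ?thesis by simp
qed

lemma computable_le_int [computable_intros]:
  assumes "computable f" "computable g" shows "computable (\<lambda>x. f x \<le> (g x :: int))"
proof -
  have "computable (\<lambda>x. nat (f x - g x) = 0)" by (intro computable_intros assms)
  then show ?thesis by simp
qed

lemma computable_less_int [computable_intros]:
  "computable f \<Longrightarrow> computable g \<Longrightarrow> computable (\<lambda>x. f x < (g x :: int))"
  unfolding not_le[symmetric] by (intro computable_intros)

lemma computable_abs_int [computable_intros]:
  "computable f \<Longrightarrow> computable (\<lambda>x. \<bar>f x :: int\<bar>)"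
  unfolding abs_if by (intro computable_intros)

lemma computable_All_less [computable_intros]:
  assumes "computable h" and "computable (\<lambda>p. P (fst p) (snd p))"
  shows "computable (\<lambda>x. \<forall>i<(h x :: nat). P x i)"
proof -
  have "computable (\<lambda>x. rec_nat True (\<lambda>i r. r \<and> P x i) (h x))"
    by (intro computable_intros computable_app2[OF assms(2)] assms(1))
  moreover have "rec_nat True (\<lambda>i r. r \<and> Q i) n = (\<forall>i<n. Q i)" for Q n
    by (induction n) (auto simp: less_Suc_eq)
  ultimately show ?thesis by simp
qed

lemma computable_sum_int [computable_intros]:
  assumes "computable h" and "computable (\<lambda>p. f (fst p) (snd p))"
  shows "computable (\<lambda>x. \<Sum>i<(h x :: nat). f x i :: int)"
proof -
  have "computable (\<lambda>x. rec_nat 0 (\<lambda>i r. r + f x i) (h x))"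
    by (intro computable_intros computable_app2[OF assms(2)] assms(1))
  moreover have "rec_nat 0 (\<lambda>i r. r + g i) n = (\<Sum>i<n. g i)" for g :: "nat \<Rightarrow> int" and n
    by (induction n) auto
  ultimately show ?thesis by simp
qed

lemma computable_sum_nat [computable_intros]:
  assumes "computable h" and "computable (\<lambda>p. f (fst p) (snd p))"
  shows "computable (\<lambda>x. \<Sum>i<(h x :: nat). f x i :: nat)"
proof -
  have "computable (\<lambda>x. rec_nat 0 (\<lambda>i r. r + f x i) (h x))"
    by (intro computable_intros computable_app2[OF assms(2)] assms(1))
  moreover have "rec_nat 0 (\<lambda>i r. r + g i) n = (\<Sum>i<n. g i)" for g :: "nat \<Rightarrow> nat" and n
    by (induction n) auto
  ultimately show ?thesis by simp
qed

section \<open>Computable operations on lists\<close>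

lemma enc_Nil: "enc [] = 0" by (simp add: enc_list_def)

lemma enc_Cons: "enc (x # xs) = Suc (prod_encode (enc x, enc xs))" by (simp add: enc_list_def)

lemma computable_Cons [computable_intros]:
  "computable f \<Longrightarrow> computable g \<Longrightarrow> computable (\<lambda>x. f x # g x)"
  by (rule computable_nat2[of "\<lambda>a b. Suc (prod_encode (a, b))" f g])
     (auto intro: recn_Suc recn_prod_encode simp: enc_Cons)

lemma computable_case_list [computable_intros]:
  assumes "computable l" "computable a"
    and "computable (\<lambda>p. f (fst p) (fst (snd p)) (snd (snd p)))"
  shows "computable (\<lambda>x. case l x of [] \<Rightarrow> a x | y # ys \<Rightarrow> f x y ys)"
proof -
  obtain G where G: "total_recursive G"
      "\<And>p. G (enc p) = enc (f (fst p) (fst (snd p)) (snd (snd p)))"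
    using computableE[OF assms(3)] by blast
  have "computable (\<lambda>x. if enc (l x) = 0 then enc (a x) else G (enc (enc x, enc (l x) - 1)))"
    by (intro computable_intros assms computable_compose[OF G(1)[folded computable_nat_iff]])
  then show ?thesis
  proof (rule computable_cast)
    fix x
    show "enc (if enc (l x) = 0 then enc (a x) else G (enc (enc x, enc (l x) - 1))) =
        enc (case l x of [] \<Rightarrow> a x | y # ys \<Rightarrow> f x y ys)"
      using G(2)[of "(x, hd (l x), tl (l x))"]
      by (cases "l x") (auto simp: enc_Nil enc_Cons enc_prod_def)
  qed
qed

text \<open>Makes the code of a list a bound, known in advance, on the number of rounds needed to
  consume it by primitive recursion.\<close>

lemma length_le_enc: "length xs \<le> enc xs"
  by (induction xs) (auto simp: enc_Cons intro: le_trans[OF _ le_prod_encode_2])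

lemma computable_fold [computable_intros]:
  fixes g :: "'x::enc \<Rightarrow> 'e::enc \<Rightarrow> 'b::enc \<Rightarrow> 'b"
  assumes "computable l" "computable a"
    and g: "computable (\<lambda>p. g (fst p) (fst (snd p)) (snd (snd p)))"
  shows "computable (\<lambda>x. fold (g x) (l x) (a x))"
proof -
  \<comment> \<open>An exhausted list is left unchanged, so the rounds beyond its length do no
    harm.\<close>
  define step where
    "step x p = (case fst p of [] \<Rightarrow> p | y # ys \<Rightarrow> (ys, g x y (snd p)))" for x and p :: "'e list \<times> 'b"
  have "computable (\<lambda>x. snd (rec_nat (l x, a x) (\<lambda>_. step x) (enc (l x))))"
    unfolding step_def by (intro computable_intros computable_app3[OF g] assms(1,2))
  moreover have "length xs \<le> n \<Longrightarrow> rec_nat (xs, b) (\<lambda>_. step x) n = ([], fold (g x) xs b)"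
    for x xs b n
  proof -
    have shift: "rec_nat p (\<lambda>_. h) (Suc n) = rec_nat (h p) (\<lambda>_. h) n" for p h n
      by (induction n) auto
    show "length xs \<le> n \<Longrightarrow> rec_nat (xs, b) (\<lambda>_. step x) n = ([], fold (g x) xs b)"
    proof (induction n arbitrary: xs b)
      case (Suc n)
      have "step x (xs, b) = (tl xs, case xs of [] \<Rightarrow> b | y # ys \<Rightarrow> g x y b)"
        by (cases xs) (auto simp: step_def)
      with Suc show ?case unfolding shift by (cases xs) auto
    qed simp
  qed
  from this[OF length_le_enc]
  have "snd (rec_nat (l x, a x) (\<lambda>_. step x) (enc (l x))) = fold (g x) (l x) (a x)" for x
    by simp
  ultimately show ?thesis by simp
qed

lemma computable_rev [computable_intros]: "computable l \<Longrightarrow> computable (\<lambda>x. rev (l x))"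
proof -
  assume "computable l"
  then have "computable (\<lambda>x. fold (\<lambda>y r. y # r) (l x) [])" by (intro computable_intros)
  then show ?thesis by (simp add: fold_Cons_rev)
qed

lemma computable_foldr [computable_intros]:
  assumes "computable l" "computable a"
    and "computable (\<lambda>p. g (fst p) (fst (snd p)) (snd (snd p)))"
  shows "computable (\<lambda>x. foldr (g x) (l x) (a x))"
  unfolding foldr_conv_fold by (intro computable_intros computable_app3[OF assms(3)] assms(1,2))

lemma computable_append [computable_intros]:
  assumes "computable f" "computable g"
  shows "computable (\<lambda>x. f x @ g x)"
proof -
  have "computable (\<lambda>x. foldr (\<lambda>y r. y # r) (f x) (g x))"
    by (intro computable_intros assms)
  moreover have "foldr (\<lambda>y r. y # r) xs ys = xs @ ys" for xs ys :: "'b list" by (induction xs) auto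
  ultimately show ?thesis by simp
qed

lemma computable_map [computable_intros]:
  assumes "computable l" and "computable (\<lambda>p. f (fst p) (snd p))"
  shows "computable (\<lambda>x. map (f x) (l x))"
proof -
  have "computable (\<lambda>x. foldr (\<lambda>y r. f x y # r) (l x) [])"
    by (intro computable_intros computable_app2[OF assms(2)] assms(1))
  moreover have "foldr (\<lambda>y r. h y # r) xs [] = map h xs" for h :: "'b \<Rightarrow> 'c" and xs
    by (induction xs) auto
  ultimately show ?thesis by simp
qed

lemma computable_map_upt [computable_intros]:
  assumes "computable n" and "computable (\<lambda>p. f (fst p) (snd p))"
  shows "computable (\<lambda>x. map (f x) [0..<n x])"
proof -
  have "computable (\<lambda>x. rec_nat [] (\<lambda>k r. r @ [f x k]) (n x))"
    by (intro computable_intros computable_app2[OF assms(2)] assms(1))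
  moreover have "rec_nat [] (\<lambda>k r. r @ [g k]) m = map g [0..<m]" for g :: "nat \<Rightarrow> 'b" and m
    by (induction m) auto
  ultimately show ?thesis by simp
qed

lemma computable_length [computable_intros]:
  assumes "computable l" shows "computable (\<lambda>x. length (l x))"
proof -
  have "computable (\<lambda>x. foldr (\<lambda>_ r. Suc r) (l x) 0)" by (intro computable_intros assms)
  moreover have "foldr (\<lambda>_ r. Suc r) xs 0 = length xs" for xs :: "'b list" by (induction xs) auto
  ultimately show ?thesis by simp
qed

lemma computable_Ball_set [computable_intros]:
  assumes "computable l" and "computable (\<lambda>p. P (fst p) (snd p))"
  shows "computable (\<lambda>x. \<forall>y\<in>set (l x). P x y)"
proof -
  have "computable (\<lambda>x. foldr (\<lambda>y r. P x y \<and> r) (l x) True)"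
    by (intro computable_intros computable_app2[OF assms(2)] assms(1))
  moreover have "foldr (\<lambda>y r. Q y \<and> r) xs True = (\<forall>y\<in>set xs. Q y)" for Q :: "'b \<Rightarrow> bool" and xs
    by (induction xs) auto
  ultimately show ?thesis by simp
qed

text \<open>Indexing with a default is used throughout because the value of \<open>!\<close> beyond
  the end of a list is unspecified.\<close>

lemma computable_nth_default [computable_intros]:
  assumes "computable d" "computable l" "computable n"
  shows "computable (\<lambda>x. nth_default (d x) (l x) (n x))"
proof -
  have "computable (\<lambda>x. case rec_nat (l x) (\<lambda>_ r. case r of [] \<Rightarrow> [] | y # ys \<Rightarrow> ys) (n x) of
      [] \<Rightarrow> d x | y # ys \<Rightarrow> y)"
    by (intro computable_intros assms)
  moreover have "(case rec_nat xs (\<lambda>_ r. case r of [] \<Rightarrow> [] | y # ys \<Rightarrow> ys) n of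
      [] \<Rightarrow> e | y # ys \<Rightarrow> y) = nth_default e xs n" for e :: 'b and xs n
  proof -
    have "rec_nat xs (\<lambda>_ r. case r of [] \<Rightarrow> [] | y # ys \<Rightarrow> ys) n = drop n xs"
      by (induction n) (auto simp: drop_Suc tl_drop split: list.splits, metis list.sel(3) tl_drop)
    then show ?thesis
      by (cases "n < length xs") (simp_all add: Cons_nth_drop_Suc[symmetric] nth_default_def)
  qed
  ultimately show ?thesis by simp
qed

lemma computable_list_decode [computable_intros]:
  "computable f \<Longrightarrow> computable (\<lambda>x. list_decode (f x))"
  by (erule computable_cast) (simp add: enc_list_def map_idI)

lemma computable_prod_decode [computable_intros]:
  "computable f \<Longrightarrow> computable (\<lambda>x. prod_decode (f x))"
  by (erule computable_cast) (simp add: enc_prod_def)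

lemma computable_int_decode [computable_intros]:
  "computable f \<Longrightarrow> computable (\<lambda>x. int_decode (f x))"
  by (erule computable_cast) (simp add: enc_int_def)

section \<open>Rational approximation of projections\<close>

definition fip :: "nat \<Rightarrow> (nat \<Rightarrow> complex) \<Rightarrow> (nat \<Rightarrow> complex) \<Rightarrow> complex" where
  "fip D u v = (\<Sum>k<D. cnj (u k) * v k)"

definition orthonormal_family :: "nat \<Rightarrow> nat \<Rightarrow> (nat \<Rightarrow> nat \<Rightarrow> complex) \<Rightarrow> bool" where
  "orthonormal_family D r V \<longleftrightarrow> (\<forall>i<r. \<forall>j<r. fip D (V i) (V j) = (if i = j then 1 else 0))"

definition gauss_rat :: "complex \<Rightarrow> bool" where
  "gauss_rat z \<longleftrightarrow> Re z \<in> \<rat> \<and> Im z \<in> \<rat>"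

lemma cnj_mult_self: "cnj z * z = of_real ((cmod z)\<^sup>2)"
  unfolding complex_norm_square by (rule mult.commute)

lemma fip_cnj: "cnj (fip D u v) = fip D v u"
  by (simp add: fip_def mult.commute)

lemma fip_self: "fip D u u = of_real (\<Sum>k<D. (cmod (u k))\<^sup>2)"
  unfolding fip_def of_real_sum by (intro sum.cong) (auto simp: cnj_mult_self)

lemma fip_self_eq_0_iff: "fip D u u = 0 \<longleftrightarrow> (\<forall>k<D. u k = 0)"
  unfolding fip_self of_real_eq_0_iff by (subst sum_nonneg_eq_0_iff) auto

lemma fip_cong: "(\<And>k. k < D \<Longrightarrow> u k = u' k) \<Longrightarrow> (\<And>k. k < D \<Longrightarrow> v k = v' k) \<Longrightarrow> fip D u v = fip D u' v'"
  unfolding fip_def by (intro sum.cong) auto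

lemma fip_diff_scale_right: "fip D u (\<lambda>k. v k - a * w k) = fip D u v - a * fip D u w"
  by (simp add: fip_def algebra_simps sum_subtractf sum_distrib_left)

lemma fip_scale_right: "fip D u (\<lambda>k. a * w k) = a * fip D u w"
  by (simp add: fip_def algebra_simps sum_distrib_left)

lemma fip_scale_left: "fip D (\<lambda>k. a * w k) u = cnj a * fip D w u"
  by (simp add: fip_def algebra_simps sum_distrib_left)

lemma fip_diff_scale_left: "fip D (\<lambda>k. v k - a * w k) u = fip D v u - cnj a * fip D w u"
  by (simp add: fip_def algebra_simps sum_subtractf sum_distrib_left)

lemma fip_unit_left: "i < D \<Longrightarrow> fip D (\<lambda>k. if k = i then 1 else 0) v = v i"
proof -
  assume "i < D"
  have "fip D (\<lambda>k. if k = i then 1 else 0) v = (\<Sum>k<D. if k = i then v k else 0)"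
    unfolding fip_def by (intro sum.cong) auto
  with \<open>i < D\<close> show ?thesis by simp
qed

lemma gauss_rat_arith:
  assumes "gauss_rat x" "gauss_rat y"
  shows "gauss_rat (x + y)" "gauss_rat (x - y)" "gauss_rat (x * y)" "gauss_rat (cnj x)" "gauss_rat (x / y)"
  using assms by (auto simp: gauss_rat_def Re_divide Im_divide)

lemma gauss_rat_numeral: "gauss_rat 0" "gauss_rat 1" "gauss_rat (numeral n)"
  by (auto simp: gauss_rat_def)

lemma gauss_rat_sum: "(\<And>i. i \<in> A \<Longrightarrow> gauss_rat (f i)) \<Longrightarrow> gauss_rat (sum f A)"
  by (induction A rule: infinite_finite_induct) (auto intro: gauss_rat_arith gauss_rat_numeral)

lemma gauss_rat_fip:
  "(\<And>k. k < D \<Longrightarrow> gauss_rat (u k)) \<Longrightarrow> (\<And>k. k < D \<Longrightarrow> gauss_rat (v k)) \<Longrightarrow> gauss_rat (fip D u v)"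
  unfolding fip_def by (intro gauss_rat_sum gauss_rat_arith) auto

lemma tendsto_floor_div: "(\<lambda>l. of_int \<lfloor>x * real (Suc l)\<rfloor> / real (Suc l)) \<longlonglongrightarrow> (x::real)"
proof (rule real_tendsto_sandwich)
  have "(\<lambda>l. x - 1 / real (Suc l)) \<longlonglongrightarrow> x - 0"
    by (intro tendsto_intros LIMSEQ_inverse_real_of_nat[unfolded inverse_eq_divide])
  then show "(\<lambda>l. x - 1 / real (Suc l)) \<longlonglongrightarrow> x" by simp
  show "\<forall>\<^sub>F l in sequentially. x - 1 / real (Suc l) \<le> of_int \<lfloor>x * real (Suc l)\<rfloor> / real (Suc l)"
  proof (intro always_eventually allI)
    fix l
    have "x * real (Suc l) - 1 \<le> of_int \<lfloor>x * real (Suc l)\<rfloor>" by linarith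
    then have "(x * real (Suc l) - 1) / real (Suc l) \<le> of_int \<lfloor>x * real (Suc l)\<rfloor> / real (Suc l)"
      by (rule divide_right_mono) simp
    then show "x - 1 / real (Suc l) \<le> of_int \<lfloor>x * real (Suc l)\<rfloor> / real (Suc l)"
      by (simp add: diff_divide_distrib)
  qed
  show "\<forall>\<^sub>F l in sequentially. of_int \<lfloor>x * real (Suc l)\<rfloor> / real (Suc l) \<le> x"
    by (intro always_eventually allI) (simp add: pos_divide_le_eq)
qed simp

lemma gauss_rat_dense: "\<exists>q. (\<forall>l. gauss_rat (q l)) \<and> q \<longlonglongrightarrow> z"
proof (intro exI conjI allI)
  let ?q = "\<lambda>l. Complex (of_int \<lfloor>Re z * real (Suc l)\<rfloor> / real (Suc l))
                        (of_int \<lfloor>Im z * real (Suc l)\<rfloor> / real (Suc l))"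
  show "gauss_rat (?q l)" for l by (simp add: gauss_rat_def)
  show "?q \<longlonglongrightarrow> z"
    unfolding tendsto_complex_iff by (simp add: tendsto_floor_div del: of_nat_Suc)
qed

text \<open>Each approximant is required to be exactly orthonormal. Rounding the coordinates of
  \<open>V\<close> destroys orthonormality, and restoring it by Gram-Schmidt introduces square
  roots; this is why approximability needs an argument.\<close>

definition rat_approximable :: "nat \<Rightarrow> nat \<Rightarrow> (nat \<Rightarrow> nat \<Rightarrow> complex) \<Rightarrow> bool" where
  "rat_approximable D r V \<longleftrightarrow> (\<exists>X.
     (\<forall>l. orthonormal_family D r (X l) \<and> (\<forall>i<r. \<forall>k<D. gauss_rat (X l i k))) \<and>
     (\<forall>i<r. \<forall>k<D. (\<lambda>l. X l i k) \<longlonglongrightarrow> V i k))"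

text \<open>The reflection in a Gaussian rational vector is unitary and involves no square root, so it
  maps rational orthonormal families to rational orthonormal families.\<close>

definition householder :: "nat \<Rightarrow> (nat \<Rightarrow> complex) \<Rightarrow> (nat \<Rightarrow> complex) \<Rightarrow> nat \<Rightarrow> complex" where
  "householder D x w = (\<lambda>k. w k - 2 * fip D x w / fip D x x * x k)"

lemma fip_householder:
  assumes "fip D x x \<noteq> 0"
  shows "fip D (householder D x u) (householder D x w) = fip D u w"
proof -
  have c: "cnj (fip D x x) = fip D x x" by (rule fip_cnj)
  have a: "fip D u x = cnj (fip D x u)" by (simp add: fip_cnj)
  show ?thesis
    unfolding householder_def fip_diff_scale_right fip_diff_scale_left
    using assms by (simp add: c a field_simps)
qed

lemma householder_involution:
  assumes "fip D x x \<noteq> 0"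
  shows "householder D x (householder D x w) k = w k"
proof -
  have "fip D x (householder D x w) = - fip D x w"
    unfolding householder_def fip_diff_scale_right using assms by (simp add: field_simps)
  then show ?thesis
    by (subst householder_def) (simp add: householder_def)
qed

lemma householder_scale: "householder D x (\<lambda>k. c * w k) = (\<lambda>k. c * householder D x w k)"
  by (rule ext) (simp add: householder_def fip_scale_right algebra_simps)

lemma tendsto_fip:
  assumes "\<And>k. k < D \<Longrightarrow> (\<lambda>l. u l k) \<longlonglongrightarrow> u' k" "\<And>k. k < D \<Longrightarrow> (\<lambda>l. v l k) \<longlonglongrightarrow> v' k"
  shows "(\<lambda>l. fip D (u l) (v l)) \<longlonglongrightarrow> fip D u' v'"
  unfolding fip_def by (intro tendsto_intros assms) auto

text \<open>A reflection depends continuously on its vector while that vector is nonzero, so both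
  \<open>x\<close> and the family can be replaced by rational approximants.\<close>

lemma rat_approximable_householder:
  assumes "rat_approximable D r V" and x: "fip D x x \<noteq> 0"
  shows "rat_approximable D r (\<lambda>i. householder D x (V i))"
proof -
  obtain X where X: "\<And>l. orthonormal_family D r (X l)"
      "\<And>l i k. i < r \<Longrightarrow> k < D \<Longrightarrow> gauss_rat (X l i k)"
      "\<And>i k. i < r \<Longrightarrow> k < D \<Longrightarrow> (\<lambda>l. X l i k) \<longlonglongrightarrow> V i k"
    using assms(1) unfolding rat_approximable_def by blast
  have "\<forall>k. \<exists>q. (\<forall>l. gauss_rat (q l)) \<and> q \<longlonglongrightarrow> x k" by (simp add: gauss_rat_dense)
  then obtain q where q: "\<And>k l. gauss_rat (q k l)" "\<And>k. q k \<longlonglongrightarrow> x k" by metis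
  have fq: "(\<lambda>l. fip D (\<lambda>k. q k l) (\<lambda>k. q k l)) \<longlonglongrightarrow> fip D x x"
    by (intro tendsto_fip q)
  \<comment> \<open>Early approximants of \<open>x\<close> may vanish and define no reflection; they
    are skipped by shifting the index.\<close>
  obtain N where N: "\<And>l. l \<ge> N \<Longrightarrow> fip D (\<lambda>k. q k l) (\<lambda>k. q k l) \<noteq> 0"
    using tendsto_imp_eventually_ne[OF fq x] unfolding eventually_sequentially by blast
  define Y where "Y l i = householder D (\<lambda>k. q k (l + N)) (X (l + N) i)" for l i
  have "orthonormal_family D r (Y l)" for l
    using X(1)[of "l + N"] N[of "l + N"]
    unfolding orthonormal_family_def Y_def by (simp add: fip_householder)
  moreover have "gauss_rat (Y l i k)" if "i < r" "k < D" for l i k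
    unfolding Y_def householder_def
    by (intro gauss_rat_arith gauss_rat_fip gauss_rat_numeral q X(2) that)
  moreover have "(\<lambda>l. Y l i k) \<longlonglongrightarrow> householder D x (V i) k" if "i < r" "k < D" for i k
  proof -
    have "(\<lambda>l. householder D (\<lambda>k. q k l) (X l i) k) \<longlonglongrightarrow> householder D x (V i) k"
      unfolding householder_def by (intro tendsto_intros tendsto_fip q X(3) that x)
    then show ?thesis unfolding Y_def by (rule LIMSEQ_ignore_initial_segment)
  qed
  ultimately show ?thesis unfolding rat_approximable_def by (intro exI[of _ Y]) blast
qed

text \<open>One reflection after the other moves \<open>W j\<close> to the unit vector \<open>e j\<close> and fixes the earlier ones. The
  phase makes the inner product of \<open>W j\<close> and \<open>e j\<close> real, without which no reflection exchanges them.\<close>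

lemma rat_approximable_up_to_phase:
  assumes "orthonormal_family D r W" "j \<le> r"
    and "\<And>i k. i < j \<Longrightarrow> k < D \<Longrightarrow> W i k = (if k = i then 1 else 0)"
  shows "\<exists>c. (\<forall>i<r. cmod (c i) = 1) \<and> rat_approximable D r (\<lambda>i k. c i * W i k)"
  using assms
proof (induction "r - j" arbitrary: j W)
  case 0
  then have "j = r" by simp
  then have "rat_approximable D r W"
    using 0 unfolding rat_approximable_def by (intro exI[of _ "\<lambda>l. W"]) (auto simp: gauss_rat_numeral)
  then show ?case by (intro exI[of _ "\<lambda>i. 1"]) simp
next
  case (Suc n)
  define e where "e i = (\<lambda>k::nat. if k = i then 1 else 0 :: complex)" for i :: nat
  have jr: "j < r" using Suc.hyps(2) by simp
  have We: "fip D (W i) v = v i" if "i < j" "i < D" for i v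
  proof -
    have "fip D (W i) v = fip D (e i) v"
      using Suc.prems(3) that by (intro fip_cong) (auto simp: e_def)
    then show ?thesis using that unfolding e_def by (simp add: fip_unit_left)
  qed
  have orth: "fip D (W i) (W i') = (if i = i' then 1 else 0)" if "i < r" "i' < r" for i i'
    using Suc.prems(1) that unfolding orthonormal_family_def by blast
  \<comment> \<open>The earlier members are unit vectors, so orthogonality to them says that the
    first \<open>j\<close> coordinates of \<open>W j\<close> vanish.\<close>
  have u0: "W j i = 0" if "i < j" "i < D" for i
    using orth[of i j] We[OF that, of "W j"] that jr by auto
  have jD: "j < D"
  proof (rule ccontr)
    assume "\<not> j < D"
    then have "\<forall>k<D. W j k = 0" using u0 by auto
    then have "fip D (W j) (W j) = 0" by (simp add: fip_self_eq_0_iff)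
    with orth[OF jr jr] show False by simp
  qed
  \<comment> \<open>For \<open>W j j = 0\<close> the inner product is real anyway and any phase
    would do.\<close>
  define c where "c = (if W j j = 0 then 1 else cnj (W j j) / of_real (cmod (W j j)))"
  have c1: "cmod c = 1" by (simp add: c_def norm_divide)
  then have cc: "cnj c * c = 1" by (simp add: cnj_mult_self del: of_real_power)
  have cu: "c * W j j = of_real (cmod (W j j))"
    using cnj_mult_self[of "W j j"] by (auto simp: c_def power2_eq_square)
  define W1 where "W1 = W(j := (\<lambda>k. c * W j k))"
  have W1_onf: "orthonormal_family D r W1"
    unfolding orthonormal_family_def W1_def
    using orth cc by (auto simp: fip_scale_left fip_scale_right)
  \<comment> \<open>The factor 1 is written out so that \<open>x\<close> matches
    \<open>fip_diff_scale_left\<close> and \<open>fip_diff_scale_right\<close>.\<close>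
  define x where "x = (\<lambda>k. W1 j k - 1 * e j k)"
  have W1_lt: "W1 i k = e i k" if "i < j" "k < D" for i k
    using Suc.prems(3) that by (simp add: W1_def e_def)
  have W1_0: "W1 j i = 0" if "i < j" "i < D" for i
    using u0[OF that] by (simp add: W1_def)
  have W1jj: "fip D (W1 j) (W1 j) = 1" using W1_onf jr unfolding orthonormal_family_def by simp
  define t where "t = cmod (W j j)"
  have ej: "fip D (e j) v = v j" for v
    unfolding e_def using fip_unit_left[OF jD] .
  have "fip D (e j) (W1 j) = of_real t" using ej cu by (simp add: W1_def t_def)
  moreover from this have "fip D (W1 j) (e j) = of_real t" by (metis fip_cnj complex_cnj_complex_of_real)
  moreover have "fip D (e j) (e j) = 1" by (simp add: ej) (simp add: e_def)
  \<comment> \<open>As \<open>t\<close> is real, \<open>fip D x x\<close> is twice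
    \<open>fip D x (W1 j)\<close>. The coefficient in the reflection is therefore 1, and it sends
    \<open>W1 j\<close> to \<open>W1 j - x\<close>, which is \<open>e j\<close>.\<close>
  ultimately have xw: "fip D x (W1 j) = 1 - of_real t" and xx: "fip D x x = 2 * (1 - of_real t)"
    unfolding x_def fip_diff_scale_left fip_diff_scale_right using W1jj by (auto simp: algebra_simps)
  have xe: "fip D x (W1 i) = 0" if "i < j" for i
  proof -
    have iD: "i < D" using that jD by simp
    have "fip D x (W1 i) = fip D x (e i)"
      using W1_lt that by (intro fip_cong) auto
    also have "\<dots> = cnj (fip D (e i) x)" by (simp add: fip_cnj)
    also have "fip D (e i) x = x i" unfolding e_def by (rule fip_unit_left[OF iD])
    also have "x i = 0" using W1_0[OF that iD] that by (simp add: x_def e_def)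
    finally show ?thesis by simp
  qed
  have IH: "\<exists>c'. (\<forall>i<r. cmod (c' i) = 1) \<and> rat_approximable D r (\<lambda>i k. c' i * V i k)"
    if "orthonormal_family D r V" "\<And>i k. i < Suc j \<Longrightarrow> k < D \<Longrightarrow> V i k = e i k" for V
    using Suc.hyps(1)[of "Suc j" V] Suc.hyps(2) jr that unfolding e_def by auto
  have "\<exists>c'. (\<forall>i<r. cmod (c' i) = 1) \<and> rat_approximable D r (\<lambda>i k. c' i * W1 i k)"
  proof (cases "fip D x x = 0")
    case True
    then have "W1 j k = e j k" if "k < D" for k
      using that unfolding fip_self_eq_0_iff by (simp add: x_def)
    then show ?thesis
      by (intro IH W1_onf) (use W1_lt less_Suc_eq in auto)
  next
    case False
    define V where "V i = householder D x (W1 i)" for i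
    have "orthonormal_family D r V"
      using W1_onf unfolding orthonormal_family_def V_def by (simp add: fip_householder[OF False])
    moreover have "V i k = e i k" if "i < Suc j" "k < D" for i k
    proof (cases "i = j")
      case True
      have "2 * fip D x (W1 j) / fip D x x = 1"
        using False unfolding xw xx by simp
      then show ?thesis unfolding V_def householder_def True by (simp add: x_def)
    next
      case False
      then show ?thesis using that xe W1_lt unfolding V_def householder_def by simp
    qed
    ultimately obtain c' where c': "\<forall>i<r. cmod (c' i) = 1" "rat_approximable D r (\<lambda>i k. c' i * V i k)"
      using IH by blast
    \<comment> \<open>The induction hypothesis treats the reflected family; reflecting once more
      leads back to \<open>W1\<close>, since a reflection is an involution and commutes with the
      phases.\<close>
    have "rat_approximable D r (\<lambda>i k. c' i * W1 i k)"
      using rat_approximable_householder[OF c'(2) False]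
      unfolding householder_scale V_def householder_involution[OF False] .
    with c'(1) show ?thesis by blast
  qed
  then obtain c' where c': "\<forall>i<r. cmod (c' i) = 1" "rat_approximable D r (\<lambda>i k. c' i * W1 i k)" by blast
  have "(\<lambda>i k. c' i * W1 i k) = (\<lambda>i k. c' i * (if i = j then c else 1) * W i k)"
    by (auto simp: W1_def fun_eq_iff)
  with c' c1 show ?case
    by (intro exI[of _ "\<lambda>i. c' i * (if i = j then c else 1)"]) (auto simp: norm_mult)
qed

section \<open>Projections as sums of rank-one terms\<close>

text \<open>A nonzero column of an idempotent matrix is fixed by it. Normalised to \<open>v\<close>,
  it can be split off: \<open>A\<close> minus the projector onto \<open>v\<close> is again a
  Hermitian projection, with trace smaller by 1. The induction runs over an integer bound on the
  trace and ends because diagonal entries of a Hermitian projection are sums of squared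
  moduli.\<close>

lemma projection_rank_decomposition:
  assumes "\<And>i j. i < D \<Longrightarrow> j < D \<Longrightarrow> A i j = cnj (A j i)"
    and "\<And>i j. i < D \<Longrightarrow> j < D \<Longrightarrow> (\<Sum>k<D. A i k * A k j) = A i j"
  shows "\<exists>r V. orthonormal_family D r V \<and> (\<forall>i<D. \<forall>j<D. A i j = (\<Sum>m<r. V m i * cnj (V m j)))"
proof -
  obtain n where "(\<Sum>i<D. Re (A i i)) < real n" using reals_Archimedean2 by blast
  then show ?thesis using assms
  proof (induction n arbitrary: A)
    case 0
    have "A i i = of_real (\<Sum>k<D. (cmod (A k i))\<^sup>2)" if "i < D" for i
    proof -
      have "A i i = (\<Sum>k<D. cnj (A k i) * A k i)"
        unfolding 0(3)[OF that that, symmetric]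
      proof (rule sum.cong[OF refl])
        fix k assume "k \<in> {..<D}"
        then have "A i k = cnj (A k i)" using 0(2) that by blast
        then show "A i k * A k i = cnj (A k i) * A k i" by simp
      qed
      then show ?thesis by (simp add: cnj_mult_self del: of_real_power)
    qed
    then have "(\<Sum>i<D. Re (A i i)) \<ge> 0" by (intro sum_nonneg) (simp add: sum_nonneg)
    with 0(1) show ?case by simp
  next
    case (Suc n)
    note herm = Suc.prems(2) and idem = Suc.prems(3)
    show ?case
    proof (cases "\<forall>i<D. \<forall>j<D. A i j = 0")
      case True
      then show ?thesis by (intro exI[of _ 0]) (simp add: orthonormal_family_def)
    next
      case False
      then obtain i0 j where ij: "i0 < D" "j < D" "A i0 j \<noteq> 0" by blast
      define y where "y k = A k j" for k
      have yy: "fip D y y = A j j"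
        unfolding fip_def y_def idem[OF ij(2) ij(2), symmetric]
      proof (rule sum.cong[OF refl])
        fix k assume "k \<in> {..<D}"
        then have "A j k = cnj (A k j)" using herm ij(2) by blast
        then show "cnj (A k j) * A k j = A j k * A k j" by simp
      qed
      have yn: "fip D y y \<noteq> 0" unfolding fip_self_eq_0_iff using ij by (auto simp: y_def)
      define s where "s = sqrt (\<Sum>k<D. (cmod (y k))\<^sup>2)"
      have ss: "complex_of_real s * complex_of_real s = fip D y y"
        unfolding fip_self s_def of_real_mult[symmetric] by (simp add: sum_nonneg)
      have s0: "complex_of_real s \<noteq> 0" using ss yn by auto
      define v where "v k = inverse (of_real s) * y k" for k
      have vv: "fip D v v = 1"
        unfolding v_def fip_scale_left fip_scale_right using ss s0 by (auto simp: field_simps)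
      have Av: "(\<Sum>k<D. A i k * v k) = v i" if "i < D" for i
        unfolding v_def y_def idem[OF that ij(2), symmetric] sum_distrib_left
        by (intro sum.cong) (auto simp: mult.left_commute)
      have vA: "(\<Sum>k<D. cnj (v k) * A k i) = cnj (v i)" if "i < D" for i
      proof -
        have "(\<Sum>k<D. cnj (v k) * A k i) = cnj (\<Sum>k<D. A i k * v k)"
          unfolding cnj_sum
        proof (rule sum.cong[OF refl])
          fix k assume "k \<in> {..<D}"
          then have "A k i = cnj (A i k)" using herm that by blast
          then show "cnj (v k) * A k i = cnj (A i k * v k)" by simp
        qed
        then show ?thesis using Av[OF that] by simp
      qed
      define B where "B i k = A i k - v i * cnj (v k)" for i k
      have B1: "B i k = cnj (B k i)" if "i < D" "k < D" for i k
        using herm[OF that] that by (simp add: B_def mult.commute)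
      have B2: "(\<Sum>k<D. B i k * B k l) = B i l" if "i < D" "l < D" for i l
      proof -
        have "(\<Sum>k<D. B i k * B k l) = (\<Sum>k<D. A i k * A k l) - (\<Sum>k<D. A i k * v k) * cnj (v l)
            - v i * (\<Sum>k<D. cnj (v k) * A k l) + v i * cnj (v l) * fip D v v"
          unfolding B_def fip_def
          by (simp add: algebra_simps sum_subtractf sum.distrib sum_distrib_left sum_distrib_right)
        also have "\<dots> = B i l"
          unfolding idem[OF that] Av[OF that(1)] vA[OF that(2)] vv B_def by simp
        finally show ?thesis .
      qed
      have "(\<Sum>i<D. Re (B i i)) = (\<Sum>i<D. Re (A i i)) - Re (fip D v v)"
        by (simp add: B_def fip_def sum_subtractf mult.commute)
      then have tr: "(\<Sum>i<D. Re (B i i)) < real n" using Suc.prems(1) vv by simp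
      obtain r V where V: "orthonormal_family D r V"
          "\<And>i j. i < D \<Longrightarrow> j < D \<Longrightarrow> B i j = (\<Sum>m<r. V m i * cnj (V m j))"
        using Suc.IH[OF tr B1 B2] by blast
      \<comment> \<open>From \<open>A v = v\<close> follows \<open>B v = 0\<close>. Expanding
        \<open>B\<close> in the orthonormal \<open>V\<close> and pairing \<open>B v\<close> with
        \<open>V m\<close> leaves exactly \<open>fip D (V m) v\<close>.\<close>
      have orth: "fip D (V m) v = 0" if "m < r" for m
      proof -
        have "(\<Sum>k<D. B i k * v k) = 0" if "i < D" for i
        proof -
          have "(\<Sum>k<D. B i k * v k) = (\<Sum>k<D. A i k * v k) - v i * fip D v v"
            unfolding B_def fip_def by (simp add: algebra_simps sum_subtractf sum_distrib_left)
          then show ?thesis using Av[OF that] vv by simp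
        qed
        then have "(\<Sum>i<D. cnj (V m i) * (\<Sum>k<D. B i k * v k)) = 0" by simp
        also have "(\<Sum>i<D. cnj (V m i) * (\<Sum>k<D. B i k * v k))
            = (\<Sum>i<D. \<Sum>k<D. \<Sum>m'<r. cnj (V m i) * V m' i * (cnj (V m' k) * v k))"
          unfolding sum_distrib_left
          by (intro sum.cong refl) (simp add: V(2) sum_distrib_left sum_distrib_right mult.assoc)
        also have "\<dots> = (\<Sum>i<D. \<Sum>m'<r. \<Sum>k<D. cnj (V m i) * V m' i * (cnj (V m' k) * v k))"
          by (intro sum.cong refl sum.swap)
        also have "\<dots> = (\<Sum>m'<r. \<Sum>i<D. \<Sum>k<D. cnj (V m i) * V m' i * (cnj (V m' k) * v k))"
          by (rule sum.swap)
        also have "\<dots> = (\<Sum>m'<r. fip D (V m) (V m') * fip D (V m') v)"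
          by (simp add: fip_def sum_product)
        also have "\<dots> = (\<Sum>m'<r. if m' = m then fip D (V m') v else 0)"
          using V(1) that unfolding orthonormal_family_def by (intro sum.cong) auto
        also have "\<dots> = fip D (V m) v" using that by simp
        finally show ?thesis .
      qed
      then have orth': "fip D v (V m) = 0" if "m < r" for m
        by (metis complex_cnj_zero fip_cnj that)
      have "orthonormal_family D (Suc r) (V(r := v))"
        using V(1) vv orth orth' unfolding orthonormal_family_def by (auto simp: less_Suc_eq)
      moreover have "A i k = (\<Sum>m<Suc r. (V(r := v)) m i * cnj ((V(r := v)) m k))"
        if "i < D" "k < D" for i k
      proof -
        have "A i k = B i k + v i * cnj (v k)" by (simp add: B_def)
        then show ?thesis using V(2)[OF that] by simp
      qed
      ultimately show ?thesis by blast
    qed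
  qed
qed

text \<open>With a single denominator, orthonormality of all candidate vectors becomes a system of
  integer identities. The form \<open>Suc d\<close> makes every natural number an admissible
  denominator code.\<close>

lemma common_denominator:
  assumes "finite S" "S \<subseteq> \<rat>"
  shows "\<exists>d::nat. \<forall>x\<in>S. \<exists>a::int. x = of_int a / real (Suc d)"
  using assms
proof (induction S rule: finite_induct)
  case (insert x S)
  then obtain d where d: "\<forall>x\<in>S. \<exists>a::int. x = of_int a / real (Suc d)" by auto
  obtain p q where pq: "q > 0" "x = of_int p / of_int q"
    using insert.prems by (metis insert_subset Rats_cases')
  \<comment> \<open>Subtracting 1 compensates the \<open>Suc\<close> in the denominator, which
    becomes the product of the two old ones.\<close>
  define e where "e = nat q * Suc d - 1"
  have e: "real (Suc e) = of_int q * real (Suc d)"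
    using pq(1) by (simp add: e_def of_nat_diff Suc_le_eq del: of_nat_Suc mult_Suc_right)
  show ?case
  proof (intro exI[of _ e] ballI)
    fix y assume "y \<in> insert x S"
    then consider "y = x" | a where "y = of_int a / real (Suc d)" using d by auto
    then show "\<exists>a::int. y = of_int a / real (Suc e)"
    proof cases
      case 1
      then show ?thesis using pq unfolding e
        by (intro exI[of _ "p * int (Suc d)"]) (simp del: of_nat_Suc)
    next
      case 2
      then show ?thesis using pq unfolding e
        by (intro exI[of _ "a * q"]) (simp del: of_nat_Suc)
    qed
  qed
qed auto

text \<open>The vectors of the decomposition are approximable only up to phases, but each phase
  cancels in the product of a coordinate with a conjugated coordinate, so the projector is
  unaffected.\<close>

lemma projection_rational_approximation:
  assumes "\<And>i j. i < D \<Longrightarrow> j < D \<Longrightarrow> A i j = cnj (A j i)"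
    and "\<And>i j. i < D \<Longrightarrow> j < D \<Longrightarrow> (\<Sum>k<D. A i k * A k j) = A i j"
    and "\<delta> > 0"
  shows "\<exists>r X. orthonormal_family D r X \<and> (\<forall>m<r. \<forall>k<D. gauss_rat (X m k)) \<and>
    (\<forall>i<D. \<forall>j<D. cmod ((\<Sum>m<r. X m i * cnj (X m j)) - A i j) < \<delta>)"
proof -
  obtain r V where V: "orthonormal_family D r V"
      "\<And>i j. i < D \<Longrightarrow> j < D \<Longrightarrow> A i j = (\<Sum>m<r. V m i * cnj (V m j))"
    using projection_rank_decomposition[of D A] assms(1,2) by blast
  obtain c where c: "\<And>m. m < r \<Longrightarrow> cmod (c m) = 1" "rat_approximable D r (\<lambda>i k. c i * V i k)"
    using rat_approximable_up_to_phase[OF V(1), of 0] by auto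
  obtain X where X: "\<And>l. orthonormal_family D r (X l)"
      "\<And>l i k. i < r \<Longrightarrow> k < D \<Longrightarrow> gauss_rat (X l i k)"
      "\<And>i k. i < r \<Longrightarrow> k < D \<Longrightarrow> (\<lambda>l. X l i k) \<longlonglongrightarrow> c i * V i k"
    using c(2) unfolding rat_approximable_def by blast
  have cc: "c m * cnj (c m) = 1" if "m < r" for m
    using c(1)[OF that] cnj_mult_self[of "c m"] by (simp add: mult.commute)
  have lim: "(\<lambda>l. \<Sum>m<r. X l m i * cnj (X l m j)) \<longlonglongrightarrow> A i j" if "i < D" "j < D" for i j
  proof -
    have "(\<lambda>l. \<Sum>m<r. X l m i * cnj (X l m j)) \<longlonglongrightarrow> (\<Sum>m<r. (c m * V m i) * cnj (c m * V m j))"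
      by (intro tendsto_intros X(3) that) auto
    also have "(\<Sum>m<r. (c m * V m i) * cnj (c m * V m j)) = (\<Sum>m<r. (c m * cnj (c m)) * (V m i * cnj (V m j)))"
      by (simp add: algebra_simps)
    also have "\<dots> = A i j" unfolding V(2)[OF that] by (intro sum.cong) (auto simp: cc)
    finally show ?thesis .
  qed
  have "\<forall>\<^sub>F l in sequentially. \<forall>i\<in>{..<D}. \<forall>j\<in>{..<D}. dist (\<Sum>m<r. X l m i * cnj (X l m j)) (A i j) < \<delta>"
    by (intro eventually_ball_finite ballI tendstoD[OF lim] assms(3)) auto
  then obtain l where "\<forall>i<D. \<forall>j<D. cmod ((\<Sum>m<r. X l m i * cnj (X l m j)) - A i j) < \<delta>"
    unfolding eventually_sequentially dist_norm by auto
  with X show ?thesis by blast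
qed

section \<open>Certified approximation of coded algebraic numbers\<close>

text \<open>The state is \<open>(E, x, y)\<close> with \<open>E = e ^ length cs\<close> and \<open>x + y \<i> = E * p ((a + b \<i>) / e)\<close>, which
  keeps the evaluation in the integers.\<close>

definition horner_step :: "int \<Rightarrow> int \<Rightarrow> int \<Rightarrow> int \<Rightarrow> int \<times> int \<times> int \<Rightarrow> int \<times> int \<times> int" where
  "horner_step e a b c st =
     (fst st * e, c * (fst st * e) + (a * fst (snd st) - b * snd (snd st)),
      a * snd (snd st) + b * fst (snd st))"

definition horner :: "int \<Rightarrow> int \<Rightarrow> int \<Rightarrow> int list \<Rightarrow> int \<times> int \<times> int" where
  "horner e a b cs = foldr (horner_step e a b) cs (1, 0, 0)"

text \<open>The state holds a bound for a polynomial \<open>p\<close> and a Lipschitz constant of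
  \<open>p\<close>, both on the disc of radius \<open>M\<close>. A step passes to
  \<open>c + X p\<close>, using
  \<open>z p(z) - g p(g) = z (p(z) - p(g)) + (z - g) p(g)\<close>.\<close>

definition lipschitz_step :: "int \<Rightarrow> int \<Rightarrow> int \<times> int \<Rightarrow> int \<times> int" where
  "lipschitz_step M c st = (\<bar>c\<bar> + M * fst st, fst st + M * snd st)"

definition lipschitz_bound :: "int \<Rightarrow> int list \<Rightarrow> int" where
  "lipschitz_bound M cs = snd (foldr (lipschitz_step M) cs (0, 0))"

definition int_poly :: "int list \<Rightarrow> complex poly" where
  "int_poly cs = Poly (map complex_of_int cs)"

lemma horner_correct:
  assumes "e > 0"
  shows "fst (horner e a b cs) = e ^ length cs \<and>
    Complex (of_int (fst (snd (horner e a b cs)))) (of_int (snd (snd (horner e a b cs)))) =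
      of_int e ^ length cs * poly (int_poly cs) (Complex (of_int a) (of_int b) / of_int e)"
proof (induction cs)
  case Nil
  then show ?case by (simp add: horner_def int_poly_def zero_complex.code)
next
  case (Cons c cs)
  define st where "st = horner e a b cs"
  define z where "z = Complex (of_int a) (of_int b)"
  define w where "w = Complex (of_int (fst (snd st))) (of_int (snd (snd st)))"
  have st: "horner e a b (c # cs) = horner_step e a b c st" by (simp add: horner_def st_def)
  have E: "fst st = e ^ length cs" and w: "w = of_int e ^ length cs * poly (int_poly cs) (z / of_int e)"
    using Cons.IH unfolding st_def[symmetric] z_def w_def by auto
  have "Complex (of_int (fst (snd (horner_step e a b c st)))) (of_int (snd (snd (horner_step e a b c st))))
      = of_int c * of_int e ^ Suc (length cs) + z * w"
    unfolding horner_step_def E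
    by (simp add: complex_eq_iff z_def w_def flip: of_int_power of_int_mult)
  also have "\<dots> = of_int e ^ Suc (length cs) * poly (int_poly (c # cs)) (z / of_int e)"
    unfolding w using assms by (simp add: int_poly_def field_simps)
  finally show ?case
    unfolding st by (simp add: horner_step_def E z_def)
qed

lemma lipschitz_bound_correct:
  assumes "cmod z \<le> of_int M" "cmod g \<le> of_int M"
  shows "cmod (poly (int_poly cs) z - poly (int_poly cs) g) \<le> of_int (lipschitz_bound M cs) * cmod (z - g)"
proof -
  have M: "0 \<le> real_of_int M" using assms(1) norm_ge_zero order_trans by blast
  define st where "st cs = foldr (lipschitz_step M) cs (0, 0)" for cs
  have "cmod (poly (int_poly cs) g) \<le> of_int (fst (st cs)) \<and>
        cmod (poly (int_poly cs) z - poly (int_poly cs) g) \<le> of_int (snd (st cs)) * cmod (z - g)"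
  proof (induction cs)
    case Nil
    then show ?case by (simp add: int_poly_def st_def)
  next
    case (Cons c cs)
    define p where "p = poly (int_poly cs)"
    have st: "st (c # cs) = lipschitz_step M c (st cs)" by (simp add: st_def)
    have pc: "poly (int_poly (c # cs)) x = of_int c + x * p x" for x
      by (simp add: int_poly_def p_def)
    have IH: "cmod (p g) \<le> of_int (fst (st cs))" "cmod (p z - p g) \<le> of_int (snd (st cs)) * cmod (z - g)"
      using Cons unfolding p_def by auto
    have "cmod (of_int c + g * p g) \<le> \<bar>of_int c\<bar> + cmod g * cmod (p g)"
      by (rule order_trans[OF norm_triangle_ineq]) (simp add: norm_mult)
    also have "\<dots> \<le> \<bar>of_int c\<bar> + of_int M * of_int (fst (st cs))"
      using IH(1) assms(2) M by (intro add_left_mono mult_mono) auto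
    finally have 1: "cmod (of_int c + g * p g) \<le> of_int (fst (st (c # cs)))"
      by (simp add: st lipschitz_step_def)
    have "(of_int c + z * p z) - (of_int c + g * p g) = z * (p z - p g) + (z - g) * p g"
      by (simp add: algebra_simps)
    then have "cmod ((of_int c + z * p z) - (of_int c + g * p g)) \<le> cmod z * cmod (p z - p g) + cmod (z - g) * cmod (p g)"
      by (metis norm_mult norm_triangle_ineq)
    also have "\<dots> \<le> of_int M * (of_int (snd (st cs)) * cmod (z - g)) + cmod (z - g) * of_int (fst (st cs))"
      using IH assms(1) M by (intro add_mono mult_mono mult_left_mono) auto
    also have "\<dots> = of_int (snd (st (c # cs))) * cmod (z - g)"
      by (simp add: st lipschitz_step_def algebra_simps)
    finally show ?case using 1 unfolding pc by simp
  qed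
  then show ?thesis by (simp add: lipschitz_bound_def st_def)
qed

definition rnum :: "nat \<Rightarrow> int" where "rnum n = int_decode (fst (prod_decode n))"
definition rden :: "nat \<Rightarrow> int" where "rden n = int (Suc (snd (prod_decode n)))"

lemma rat_decode_eq: "rat_decode n = of_int (rnum n) / of_int (rden n)"
  by (simp add: rat_decode_def rnum_def rden_def split: prod.splits)

lemma rden_pos: "rden n > 0" by (simp add: rden_def)

lemma abs_rat_decode_le: "\<bar>rat_decode n\<bar> \<le> of_int \<bar>rnum n\<bar>"
proof -
  have "\<bar>rat_decode n\<bar> = of_int \<bar>rnum n\<bar> / of_int (rden n)"
    using rden_pos[of n] by (simp add: rat_decode_eq)
  also have "\<dots> \<le> of_int \<bar>rnum n\<bar> / 1"
    using rden_pos[of n] by (intro divide_left_mono) auto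
  finally show ?thesis by simp
qed

definition code_coeffs :: "nat \<Rightarrow> int list" where
  "code_coeffs x = map int_decode (list_decode (fst (prod_decode x)))"

definition code_box :: "nat \<Rightarrow> nat \<Rightarrow> nat" where
  "code_box x i = nth_default 0 (list_decode (snd (prod_decode x))) i"

text \<open>Both directions serve: soundness of the certificate uses that \<open>z\<close> is a root
  in the box, completeness that it is the only one.\<close>

lemma alg_decode_SomeD:
  assumes "alg_decode x = Some z"
  shows "poly (int_poly (code_coeffs x)) w = 0 \<and>
      rat_decode (code_box x 0) \<le> Re w \<and> Re w \<le> rat_decode (code_box x 1) \<and>
      rat_decode (code_box x 2) \<le> Im w \<and> Im w \<le> rat_decode (code_box x 3) \<longleftrightarrow> w = z"
proof -
  obtain pc bc where x: "prod_decode x = (pc, bc)" by fastforce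
  define R where "R = {z. poly (int_poly (code_coeffs x)) z = 0 \<and> length (list_decode bc) = 4 \<and>
      map rat_decode (list_decode bc) ! 0 \<le> Re z \<and> Re z \<le> map rat_decode (list_decode bc) ! 1 \<and>
      map rat_decode (list_decode bc) ! 2 \<le> Im z \<and> Im z \<le> map rat_decode (list_decode bc) ! 3}"
  have p: "Poly (map (\<lambda>k. complex_of_int (int_decode k)) (list_decode pc)) = int_poly (code_coeffs x)"
    by (simp add: int_poly_def code_coeffs_def x comp_def)
  have "card R = 1" and z: "z = (THE z. z \<in> R)"
    using assms unfolding alg_decode_def x R_def by (auto simp: p Let_def split: if_splits)
  then obtain z' where R: "R = {z'}" by (auto simp: card_1_singleton_iff)
  with z have "R = {z}" by simp
  moreover from this have len: "length (list_decode bc) = 4" unfolding R_def by blast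
  moreover have "map rat_decode (list_decode bc) ! i = rat_decode (code_box x i)" if "i < 4" for i
    using that len by (simp add: code_box_def x nth_default_def)
  ultimately show ?thesis unfolding R_def by auto
qed

text \<open>Denominators are at least 1, so numerators alone bound the corners. The coordinates of
  the root are then at most this bound B, those of a rounded root at most B + 1, and both lie in the
  disc of radius 2 B + 2 on which the Lipschitz constant is taken.\<close>

definition box_bound :: "nat \<Rightarrow> int" where
  "box_bound x = (\<Sum>i<4. \<bar>rnum (code_box x i)\<bar>)"

lemma abs_rat_decode_le_box_bound: "i < 4 \<Longrightarrow> \<bar>rat_decode (code_box x i)\<bar> \<le> of_int (box_bound x)"
proof -
  assume "i < 4"
  then have "\<bar>rnum (code_box x i)\<bar> \<le> box_bound x"
    unfolding box_bound_def by (intro member_le_sum) auto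
  then show ?thesis using abs_rat_decode_le[of "code_box x i"] by linarith
qed

text \<open>The isolated root is within a mesh width of a grid point that meets the box and where, by the
  Lipschitz bound, the polynomial is small. So if all grid points pass, the root is close to
  \<open>(u + v \<i>) / N\<close>. Conversely, by compactness all points of a fine grid pass.\<close>

definition grid_point_ok :: "nat \<Rightarrow> int \<Rightarrow> int \<Rightarrow> int \<Rightarrow> int \<Rightarrow> int \<Rightarrow> int \<Rightarrow> int \<Rightarrow> bool" where
  "grid_point_ok x u v N K e a b \<longleftrightarrow>
     (rnum (code_box x 0) * e - rden (code_box x 0) \<le> a * rden (code_box x 0) \<and>
      a * rden (code_box x 1) \<le> rnum (code_box x 1) * e \<and>
      rnum (code_box x 2) * e - rden (code_box x 2) \<le> b * rden (code_box x 2) \<and>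
      b * rden (code_box x 3) \<le> rnum (code_box x 3) * e) \<longrightarrow>
     4 * (lipschitz_bound (2 * box_bound x + 2) (code_coeffs x) * fst (horner e a b (code_coeffs x)))
       * (lipschitz_bound (2 * box_bound x + 2) (code_coeffs x) * fst (horner e a b (code_coeffs x)))
     < (fst (snd (horner e a b (code_coeffs x))) * fst (snd (horner e a b (code_coeffs x)))
        + snd (snd (horner e a b (code_coeffs x))) * snd (snd (horner e a b (code_coeffs x)))) * (e * e) \<or>
     K * \<bar>a * N - u * e\<bar> \<le> e * N \<and> K * \<bar>b * N - v * e\<bar> \<le> e * N"

text \<open>Clearing positive denominators and squaring the comparison of moduli makes each test an
  integer inequality. Only the lower edges carry the slack 1/e, because grid points arise by
  rounding down. The factor 2 in the threshold comes from the distance of at most 2/e between the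
  root and its rounding.\<close>

lemma grid_point_ok_iff:
  fixes a b :: int
  assumes "e > 0" "N > 0" "K > 0"
  defines "g \<equiv> Complex (of_int a) (of_int b) / of_int e"
  shows "grid_point_ok x u v N K e a b \<longleftrightarrow>
     (rat_decode (code_box x 0) - 1 / of_int e \<le> Re g \<and> Re g \<le> rat_decode (code_box x 1) \<and>
      rat_decode (code_box x 2) - 1 / of_int e \<le> Im g \<and> Im g \<le> rat_decode (code_box x 3) \<longrightarrow>
      2 * \<bar>of_int (lipschitz_bound (2 * box_bound x + 2) (code_coeffs x))\<bar> / of_int e
        < cmod (poly (int_poly (code_coeffs x)) g) \<or>
      \<bar>Re g - of_int u / of_int N\<bar> \<le> 1 / of_int K \<and> \<bar>Im g - of_int v / of_int N\<bar> \<le> 1 / of_int K)"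
proof -
  have g: "Re g = of_int a / of_int e" "Im g = of_int b / of_int e"
    by (simp_all add: g_def)
  have lo: "n * e - d \<le> c * d \<longleftrightarrow> of_int n / of_int d - 1 / of_int e \<le> (of_int c / of_int e :: real)"
    if "d > 0" for n d c :: int
  proof -
    have "of_int n / of_int d - 1 / of_int e \<le> (of_int c / of_int e :: real) \<longleftrightarrow>
        of_int n / of_int d \<le> ((of_int c + 1) / of_int e :: real)"
      by (simp add: add_divide_distrib diff_le_eq)
    also have "\<dots> \<longleftrightarrow> (of_int (n * e - d) :: real) \<le> of_int (c * d)"
      using that assms(1) by (simp add: field_simps)
    finally have "of_int n / of_int d - 1 / of_int e \<le> (of_int c / of_int e :: real) \<longleftrightarrow>
        (of_int (n * e - d) :: real) \<le> of_int (c * d)" .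
    then show ?thesis by (simp only: of_int_le_iff)
  qed
  have hi: "c * d \<le> n * e \<longleftrightarrow> (of_int c / of_int e :: real) \<le> of_int n / of_int d"
    if "d > 0" for n d c :: int
  proof -
    have "(of_int c / of_int e :: real) \<le> of_int n / of_int d \<longleftrightarrow> (of_int (c * d) :: real) \<le> of_int (n * e)"
      using that assms(1) by (simp add: field_simps)
    then show ?thesis by (simp only: of_int_le_iff)
  qed
  have cl: "K * \<bar>c * N - w * e\<bar> \<le> e * N \<longleftrightarrow> \<bar>of_int c / of_int e - of_int w / of_int N\<bar> \<le> (1 / of_int K :: real)"
    for c w :: int
  proof -
    have "of_int c / of_int e - of_int w / of_int N = (of_int (c * N - w * e) / of_int (e * N) :: real)"
      using assms by (simp add: field_simps)
    then have "\<bar>of_int c / of_int e - of_int w / of_int N\<bar> = (of_int \<bar>c * N - w * e\<bar> / of_int (e * N) :: real)"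
      using assms by (simp add: abs_mult)
    moreover have "(of_int \<bar>c * N - w * e\<bar> / of_int (e * N) :: real) \<le> 1 / of_int K \<longleftrightarrow>
        (of_int (K * \<bar>c * N - w * e\<bar>) :: real) \<le> of_int (e * N)"
      using assms by (simp add: field_simps)
    ultimately show ?thesis by (simp only: of_int_le_iff)
  qed
  define L where "L = lipschitz_bound (2 * box_bound x + 2) (code_coeffs x)"
  define h where "h = horner e a b (code_coeffs x)"
  define P where "P = poly (int_poly (code_coeffs x)) g"
  have E: "fst h > 0" and hP: "Complex (of_int (fst (snd h))) (of_int (snd (snd h))) = of_int (fst h) * P"
    using horner_correct[OF assms(1), of a b "code_coeffs x"] assms(1)
    unfolding h_def P_def g_def by auto
  have "(of_int (fst (snd h)))\<^sup>2 + (of_int (snd (snd h)))\<^sup>2 = (cmod (of_int (fst h) * P))\<^sup>2"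
    unfolding hP[symmetric] by (simp add: cmod_power2)
  then have n: "real_of_int (fst (snd h) * fst (snd h) + snd (snd h) * snd (snd h)) = (of_int (fst h) * cmod P)\<^sup>2"
    using E by (simp add: norm_mult power2_eq_square)
  have "4 * (L * fst h) * (L * fst h) < (fst (snd h) * fst (snd h) + snd (snd h) * snd (snd h)) * (e * e) \<longleftrightarrow>
      real_of_int (4 * (L * fst h) * (L * fst h)) < real_of_int ((fst (snd h) * fst (snd h) + snd (snd h) * snd (snd h)) * (e * e))"
    by (simp only: of_int_less_iff)
  also have "\<dots> \<longleftrightarrow> (2 * \<bar>of_int L\<bar> * of_int (fst h))\<^sup>2 < (of_int (fst h) * cmod P * of_int e)\<^sup>2"
    unfolding of_int_mult[of "fst (snd h) * fst (snd h) + snd (snd h) * snd (snd h)"] n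
    by (simp add: power_mult_distrib) (simp add: power2_eq_square algebra_simps)
  also have "\<dots> \<longleftrightarrow> 2 * \<bar>of_int L\<bar> * of_int (fst h) < of_int (fst h) * cmod P * of_int e"
  proof
    assume "(2 * \<bar>of_int L\<bar> * of_int (fst h))\<^sup>2 < (of_int (fst h) * cmod P * real_of_int e)\<^sup>2"
    then show "2 * \<bar>of_int L\<bar> * of_int (fst h) < of_int (fst h) * cmod P * real_of_int e"
      by (rule power2_less_imp_less) (use E assms(1) in simp)
  next
    assume "2 * \<bar>of_int L\<bar> * of_int (fst h) < of_int (fst h) * cmod P * real_of_int e"
    then show "(2 * \<bar>of_int L\<bar> * of_int (fst h))\<^sup>2 < (of_int (fst h) * cmod P * real_of_int e)\<^sup>2"
      by (rule power_strict_mono) (use E in simp_all)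
  qed
  also have "\<dots> \<longleftrightarrow> 2 * \<bar>of_int L\<bar> / of_int e < cmod P"
    using E assms(1) by (simp add: field_simps)
  finally have big: "4 * (L * fst h) * (L * fst h) < (fst (snd h) * fst (snd h) + snd (snd h) * snd (snd h)) * (e * e)
      \<longleftrightarrow> 2 * \<bar>of_int L\<bar> / of_int e < cmod P" .
  show ?thesis
    unfolding grid_point_ok_def L_def[symmetric] h_def[symmetric] P_def[symmetric] big cl
      lo[OF rden_pos] hi[OF rden_pos] g rat_decode_eq ..
qed

text \<open>Bounded quantifiers range over naturals, so integer coordinates are enumerated by their
  codes. Coordinates of modulus at most e (B + 1), with B the box bound, have codes at most 2 e (B +
  1) + 1, so the rounded root is among the points tested.\<close>

definition root_near :: "nat \<Rightarrow> int \<Rightarrow> int \<Rightarrow> int \<Rightarrow> int \<Rightarrow> nat \<Rightarrow> bool" where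
  "root_near x u v N K e \<longleftrightarrow>
     (\<forall>i<nat (2 * (int e * (box_bound x + 1)) + 2). \<forall>j<nat (2 * (int e * (box_bound x + 1)) + 2).
        grid_point_ok x u v N K (int e) (int_decode i) (int_decode j))"

lemma int_encode_le: "int (int_encode i) \<le> 2 * \<bar>i\<bar> + 1"
  by (simp add: int_encode_def sum_encode_def)

lemma root_near_sound:
  assumes z: "alg_decode x = Some z" and ok: "root_near x u v N K e"
    and pos: "e > 0" "N > 0" "K > 0"
  shows "\<bar>Re z - of_int u / of_int N\<bar> \<le> 1 / of_int K + 1 / real e"
    and "\<bar>Im z - of_int v / of_int N\<bar> \<le> 1 / of_int K + 1 / real e"
proof -
  have box: "poly (int_poly (code_coeffs x)) z = 0"
      "rat_decode (code_box x 0) \<le> Re z" "Re z \<le> rat_decode (code_box x 1)"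
      "rat_decode (code_box x 2) \<le> Im z" "Im z \<le> rat_decode (code_box x 3)"
    using alg_decode_SomeD[OF z, of z] by auto
  define a b where "a = \<lfloor>Re z * real e\<rfloor>" and "b = \<lfloor>Im z * real e\<rfloor>"
  define g where "g = Complex (of_int a) (of_int b) / of_int (int e)"
  have re: "Re g \<le> Re z" "Re z \<le> Re g + 1 / real e" and im: "Im g \<le> Im z" "Im z \<le> Im g + 1 / real e"
  proof -
    have "of_int a \<le> Re z * real e" "Re z * real e \<le> of_int a + 1"
      "of_int b \<le> Im z * real e" "Im z * real e \<le> of_int b + 1"
      unfolding a_def b_def by linarith+
    then show "Re g \<le> Re z" "Re z \<le> Re g + 1 / real e" "Im g \<le> Im z" "Im z \<le> Im g + 1 / real e"
      using pos(1) by (simp_all add: g_def field_simps)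
  qed
  define B where "B = box_bound x"
  have B0: "0 \<le> B" unfolding B_def box_bound_def by (intro sum_nonneg) auto
  have zB: "\<bar>Re z\<bar> \<le> of_int B" "\<bar>Im z\<bar> \<le> of_int B"
    using box abs_rat_decode_le_box_bound[of 0 x] abs_rat_decode_le_box_bound[of 1 x]
      abs_rat_decode_le_box_bound[of 2 x] abs_rat_decode_le_box_bound[of 3 x] unfolding B_def by auto
  have e1: "1 / real e \<le> 1" using pos(1) by simp
  have gB: "\<bar>Re g\<bar> \<le> of_int B + 1" "\<bar>Im g\<bar> \<le> of_int B + 1" using zB re im e1 by auto
  have M: "cmod z \<le> of_int (2 * B + 2)" "cmod g \<le> of_int (2 * B + 2)"
    using cmod_le[of z] cmod_le[of g] zB gB by auto
  have ab: "\<bar>a\<bar> \<le> int e * (B + 1)" "\<bar>b\<bar> \<le> int e * (B + 1)"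
  proof -
    have "of_int a = Re g * real e" "of_int b = Im g * real e" using pos(1) by (simp_all add: g_def)
    then have "\<bar>of_int a\<bar> \<le> (of_int B + 1) * real e" "\<bar>of_int b\<bar> \<le> (of_int B + 1) * real e"
      using gB by (simp_all add: abs_mult mult_right_mono)
    then have "real_of_int \<bar>a\<bar> \<le> of_int (int e * (B + 1))" "real_of_int \<bar>b\<bar> \<le> of_int (int e * (B + 1))"
      by (simp_all add: mult.commute)
    then show "\<bar>a\<bar> \<le> int e * (B + 1)" "\<bar>b\<bar> \<le> int e * (B + 1)" by (simp_all only: of_int_le_iff)
  qed
  have "int_encode a < nat (2 * (int e * (B + 1)) + 2)" "int_encode b < nat (2 * (int e * (B + 1)) + 2)"
    using ab int_encode_le[of a] int_encode_le[of b] by linarith+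
  then have "grid_point_ok x u v N K (int e) (int_decode (int_encode a)) (int_decode (int_encode b))"
    using ok unfolding root_near_def B_def by blast
  then have gok: "grid_point_ok x u v N K (int e) a b" by simp
  have "cmod (z - g) \<le> \<bar>Re (z - g)\<bar> + \<bar>Im (z - g)\<bar>" by (rule cmod_le)
  also have "\<dots> \<le> 2 / real e" using re im by simp
  finally have zg: "cmod (z - g) \<le> 2 / real e" .
  define L where "L = lipschitz_bound (2 * B + 2) (code_coeffs x)"
  have "cmod (poly (int_poly (code_coeffs x)) z - poly (int_poly (code_coeffs x)) g) \<le> of_int L * cmod (z - g)"
    unfolding L_def by (rule lipschitz_bound_correct[OF M])
  also have "\<dots> \<le> \<bar>of_int L\<bar> * (2 / real e)"
    using zg by (intro mult_mono) auto
  finally have small: "cmod (poly (int_poly (code_coeffs x)) g) \<le> 2 * \<bar>of_int L\<bar> / of_int (int e)"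
    using box(1) by (simp add: mult.commute)
  \<comment> \<open>The rounded root \<open>g\<close> meets the box conditions, and
    \<open>small\<close> excludes the first alternative of the test; closeness is what
    remains.\<close>
  have "\<bar>Re g - of_int u / of_int N\<bar> \<le> 1 / of_int K \<and> \<bar>Im g - of_int v / of_int N\<bar> \<le> 1 / of_int K"
    using gok small box re im pos(1)
    unfolding grid_point_ok_iff[OF _ pos(2,3), of "int e", unfolded of_nat_0_less_iff, OF pos(1)] g_def[symmetric]
      B_def[symmetric] L_def[symmetric] by auto
  then show "\<bar>Re z - of_int u / of_int N\<bar> \<le> 1 / of_int K + 1 / real e"
    "\<bar>Im z - of_int v / of_int N\<bar> \<le> 1 / of_int K + 1 / real e"
    using re im by linarith+
qed

text \<open>Failing points on ever finer grids would accumulate at some \<open>w\<close>. The slack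
  1/e and the threshold vanish in the limit, so \<open>w\<close> is a root in the box, hence
  \<open>z\<close>. The strict inequalities \<open>near\<close> then hold for grid points close to
  \<open>z\<close> as well, which contradicts their failure.\<close>

lemma root_near_complete:
  assumes z: "alg_decode x = Some z" and pos: "N > 0" "K > 0"
    and near: "\<bar>Re z - of_int u / of_int N\<bar> < 1 / of_int K" "\<bar>Im z - of_int v / of_int N\<bar> < 1 / of_int K"
  shows "\<forall>\<^sub>F e in sequentially. root_near x u v N K e"
proof (rule ccontr)
  assume "\<not> ?thesis"
  then have "\<forall>n. \<exists>e\<ge>Suc n. \<not> root_near x u v N K e"
    unfolding eventually_sequentially by blast
  then have "\<forall>n. \<exists>e a b. e \<ge> Suc n \<and> \<not> grid_point_ok x u v N K (int e) a b"
    unfolding root_near_def by metis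
  then obtain e a b where e: "\<And>n. e n \<ge> Suc n" and bad: "\<And>n. \<not> grid_point_ok x u v N K (int (e n)) (a n) (b n)"
    by metis
  define g where "g n = Complex (of_int (a n)) (of_int (b n)) / of_int (int (e n))" for n
  define L where "L = \<bar>real_of_int (lipschitz_bound (2 * box_bound x + 2) (code_coeffs x))\<bar>"
  define p where "p = poly (int_poly (code_coeffs x))"
  have e0: "e n > 0" for n using e[of n] by simp
  have g: "rat_decode (code_box x 0) - 1 / real (e n) \<le> Re (g n)" "Re (g n) \<le> rat_decode (code_box x 1)"
      "rat_decode (code_box x 2) - 1 / real (e n) \<le> Im (g n)" "Im (g n) \<le> rat_decode (code_box x 3)"
      "cmod (p (g n)) \<le> 2 * L / real (e n)"
      "\<bar>Re (g n) - of_int u / of_int N\<bar> > 1 / of_int K \<or> \<bar>Im (g n) - of_int v / of_int N\<bar> > 1 / of_int K" for n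
    using bad[of n] e0[of n]
    unfolding grid_point_ok_iff[OF _ pos, of "int (e n)", unfolded of_nat_0_less_iff, OF e0] g_def[symmetric]
      L_def[symmetric] p_def[symmetric] by (auto simp: not_le not_less)
  have e1: "1 / real (e n) \<le> 1" for n using e0[of n] by simp
  have "cmod (g n) \<le> 2 * of_int (box_bound x) + 2" for n
    using cmod_le[of "g n"] g(1-4)[of n] e1[of n] abs_rat_decode_le_box_bound[of 0 x] abs_rat_decode_le_box_bound[of 1 x]
      abs_rat_decode_le_box_bound[of 2 x] abs_rat_decode_le_box_bound[of 3 x] by auto
  then obtain f w where f: "strict_mono (f :: nat \<Rightarrow> nat)" and w: "\<forall>\<epsilon>>0. \<exists>N. \<forall>n\<ge>N. cmod (g (f n) - w) < \<epsilon>"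
    using Bolzano_Weierstrass_complex_disc[of g] by blast
  have lim: "(\<lambda>n. g (f n)) \<longlonglongrightarrow> w" unfolding LIMSEQ_iff using w by blast
  have inv: "(\<lambda>n. 1 / real (e (f n))) \<longlonglongrightarrow> 0"
  proof (rule real_tendsto_sandwich)
    show "\<forall>\<^sub>F n in sequentially. 0 \<le> 1 / real (e (f n))" by simp
    show "\<forall>\<^sub>F n in sequentially. 1 / real (e (f n)) \<le> 1 / real (Suc n)"
    proof (intro always_eventually allI)
      fix n
      have "Suc n \<le> e (f n)" using e[of "f n"] seq_suble[OF f, of n] by linarith
      then show "1 / real (e (f n)) \<le> 1 / real (Suc n)" by (intro divide_left_mono) auto
    qed
    show "(\<lambda>n. 1 / real (Suc n)) \<longlonglongrightarrow> 0" by (rule LIMSEQ_inverse_real_of_nat[unfolded inverse_eq_divide])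
  qed simp
  have lo: "(\<lambda>n. c - 1 / real (e (f n))) \<longlonglongrightarrow> c" for c :: real
    using tendsto_diff[OF tendsto_const inv] by simp
  have "rat_decode (code_box x 0) \<le> Re w"
    by (rule LIMSEQ_le[OF lo tendsto_Re[OF lim]]) (use g(1) in blast)
  moreover have "Re w \<le> rat_decode (code_box x 1)"
    by (rule LIMSEQ_le_const2[OF tendsto_Re[OF lim]]) (use g(2) in blast)
  moreover have "rat_decode (code_box x 2) \<le> Im w"
    by (rule LIMSEQ_le[OF lo tendsto_Im[OF lim]]) (use g(3) in blast)
  moreover have "Im w \<le> rat_decode (code_box x 3)"
    by (rule LIMSEQ_le_const2[OF tendsto_Im[OF lim]]) (use g(4) in blast)
  moreover have "p w = 0"
  proof -
    have "(\<lambda>n. p (g (f n))) \<longlonglongrightarrow> p w"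
      unfolding p_def by (rule isCont_tendsto_compose[OF poly_isCont lim])
    then have "(\<lambda>n. cmod (p (g (f n)))) \<longlonglongrightarrow> cmod (p w)" by (rule tendsto_norm)
    moreover have "(\<lambda>n. 2 * L * (1 / real (e (f n)))) \<longlonglongrightarrow> 2 * L * 0" by (intro tendsto_intros inv)
    ultimately have "cmod (p w) \<le> 2 * L * 0"
      by (rule LIMSEQ_le) (use g(5) in auto)
    then show ?thesis by simp
  qed
  ultimately have "w = z" using alg_decode_SomeD[OF z, of w] unfolding p_def by blast
  then have "(\<lambda>n. \<bar>Re (g (f n)) - of_int u / of_int N\<bar>) \<longlonglongrightarrow> \<bar>Re z - of_int u / of_int N\<bar>"
    "(\<lambda>n. \<bar>Im (g (f n)) - of_int v / of_int N\<bar>) \<longlonglongrightarrow> \<bar>Im z - of_int v / of_int N\<bar>"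
    using lim by (intro tendsto_intros; simp)+
  from order_tendstoD(2)[OF this(1) near(1)] order_tendstoD(2)[OF this(2) near(2)]
  have "\<forall>\<^sub>F n in sequentially. False"
  proof eventually_elim
    case (elim n)
    then show ?case using g(6)[of "f n"] by linarith
  qed
  then show False by simp
qed

lemma computable_grid_point_ok [computable_intros]:
  assumes "computable x" "computable u" "computable v" "computable N" "computable K" "computable e"
    "computable a" "computable b"
  shows "computable (\<lambda>s. grid_point_ok (x s) (u s) (v s) (N s) (K s) (e s) (a s) (b s))"
proof -
  have box: "computable (\<lambda>s. code_box (f s) (i s))" if "computable f" "computable i" for f and i :: "'z::enc \<Rightarrow> nat"
    unfolding code_box_def by (intro computable_intros that)
  have num: "computable (\<lambda>s. rnum (f s))" if "computable f" for f :: "'z::enc \<Rightarrow> nat"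
    unfolding rnum_def by (intro computable_intros that)
  have den: "computable (\<lambda>s. rden (f s))" if "computable f" for f :: "'z::enc \<Rightarrow> nat"
    unfolding rden_def by (intro computable_intros that)
  have bound: "computable (\<lambda>s. box_bound (f s))" if "computable f" for f :: "'z::enc \<Rightarrow> nat"
    unfolding box_bound_def by (intro computable_intros num box computable_compose[OF that])
  have coeffs: "computable (\<lambda>s. code_coeffs (f s))" if "computable f" for f :: "'z::enc \<Rightarrow> nat"
    unfolding code_coeffs_def by (intro computable_intros that)
  have lip: "computable (\<lambda>s. lipschitz_bound (f s) (l s))" if "computable f" "computable l" for f and l :: "'z::enc \<Rightarrow> int list"
    unfolding lipschitz_bound_def lipschitz_step_def by (intro computable_intros that(2) computable_compose[OF that(1)])
  have horn: "computable (\<lambda>s. horner (f s) (g s) (h s) (l s))"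
    if "computable f" "computable g" "computable h" "computable l" for f g h and l :: "'z::enc \<Rightarrow> int list"
    unfolding horner_def horner_step_def
    by (intro computable_intros that(4) computable_compose[OF that(1)] computable_compose[OF that(2)] computable_compose[OF that(3)])
  show ?thesis
    unfolding grid_point_ok_def
    by (intro computable_imp computable_conj computable_disj computable_le_int computable_less_int
        computable_add_int computable_diff_int computable_mult_int computable_abs_int
        computable_fst computable_snd lip horn coeffs bound num den box computable_const assms)
qed

lemma computable_root_near [computable_intros]:
  assumes "computable x" "computable u" "computable v" "computable N" "computable K" "computable e"
  shows "computable (\<lambda>s. root_near (x s) (u s) (v s) (N s) (K s) (e s))"
proof -
  have num: "computable (\<lambda>s. box_bound (f s))" if "computable f" for f :: "'z::enc \<Rightarrow> nat"
    unfolding box_bound_def rnum_def code_box_def by (intro computable_intros computable_compose[OF that])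
  show ?thesis
    unfolding root_near_def
    by (intro computable_intros num computable_compose[OF assms(1)] computable_compose[OF assms(2)]
        computable_compose[OF assms(3)] computable_compose[OF assms(4)] computable_compose[OF assms(5)]
        computable_compose[OF assms(6)] assms)
qed

section \<open>Searching for a rational orthonormal set\<close>

text \<open>The isolating rectangle degenerates to the point itself.\<close>

definition gauss_code :: "nat \<Rightarrow> int \<times> int \<Rightarrow> nat" where
  "gauss_code d p = enc (
     [fst p * fst p + snd p * snd p, - (2 * fst p * int (Suc d)), int (Suc d) * int (Suc d)],
     [(fst p, d), (fst p, d), (snd p, d), (snd p, d)])"

definition gauss_value :: "nat \<Rightarrow> int \<times> int \<Rightarrow> complex" where
  "gauss_value d p = Complex (of_int (fst p) / real (Suc d)) (of_int (snd p) / real (Suc d))"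

lemma alg_decode_gauss_code: "alg_decode (gauss_code d p) = Some (gauss_value d p)"
proof -
  obtain a b where p: "p = (a, b)" by fastforce
  define N where "N = int (Suc d)"
  define z where "z = gauss_value d p"
  have N: "complex_of_int N \<noteq> 0" by (simp add: N_def del: of_nat_Suc)
  have z: "of_int N * z = Complex (of_int a) (of_int b)"
    by (simp add: complex_eq_iff z_def gauss_value_def p N_def del: of_nat_Suc)
  \<comment> \<open>This is (N X - a)^2 + b^2, with the roots (a + b i)/N and (a - b i)/N; the
    degenerate box selects the first.\<close>
  define P where "P = [:complex_of_int (a * a + b * b), of_int (- (2 * a * N)), of_int (N * N):]"
  have "poly P z = of_int (a * a + b * b) - 2 * of_int a * (of_int N * z) + (of_int N * z) * (of_int N * z)"
    by (simp add: P_def algebra_simps)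
  also have "\<dots> = 0" unfolding z by (simp add: complex_eq_iff algebra_simps)
  finally have root: "poly P z = 0" .
  have dec: "prod_decode (gauss_code d p) =
      (list_encode (map int_encode [a * a + b * b, - (2 * a * N), N * N]),
       list_encode (map (\<lambda>q. prod_encode (int_encode (fst q), snd q)) [(a, d), (a, d), (b, d), (b, d)]))"
    by (simp add: gauss_code_def enc_prod_def enc_list_def enc_int_def p N_def)
  have rat: "rat_decode (prod_encode (int_encode c, d)) = of_int c / real (Suc d)" for c
    by (simp add: rat_decode_def)
  have P0: "P \<noteq> 0" using N by (simp add: P_def)
  have "{w. poly P w = 0 \<and> of_int a / real (Suc d) \<le> Re w \<and> Re w \<le> of_int a / real (Suc d) \<and>
      of_int b / real (Suc d) \<le> Im w \<and> Im w \<le> of_int b / real (Suc d)} = {z}"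
    using root by (auto simp: z_def gauss_value_def p complex_eq_iff)
  then show ?thesis
    using P0 unfolding alg_decode_def dec z_def[symmetric]
    by (simp add: rat P_def[symmetric] Let_def del: of_nat_Suc of_int_mult of_int_add of_int_minus)
qed

definition set_code :: "nat \<Rightarrow> (int \<times> int) list list \<Rightarrow> nat" where
  "set_code d vs = enc (map (map (gauss_code d)) vs)"

lemma computable_set_code [computable_intros]:
  assumes "computable d" "computable vs"
  shows "computable (\<lambda>x. set_code (d x) (vs x))"
  unfolding set_code_def gauss_code_def
  by (intro computable_intros assms(2) computable_compose[OF assms(1)])

lemma vecset_decode_set_code:
  "vecset_decode (set_code d vs) = Some (set (map (\<lambda>v. vec_of_list (map (gauss_value d) v)) vs))"
proof -
  have "list_decode (set_code d vs) = map (\<lambda>v. list_encode (map (gauss_code d) v)) vs"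
    by (simp add: set_code_def enc_list_def comp_def)
  moreover have "vec_decode (list_encode (map (gauss_code d) v)) = Some (vec_of_list (map (gauss_value d) v))" for v
    by (auto simp: vec_decode_def entries_decode_def alg_decode_gauss_code comp_def)
  ultimately show ?thesis
    by (auto simp: vecset_decode_def comp_def)
qed

definition code_entry :: "nat \<Rightarrow> nat \<Rightarrow> nat \<Rightarrow> nat" where
  "code_entry x i j = nth_default 0 (list_decode (nth_default 0 (list_decode x) i)) j"

lemma mat_decode_entry:
  assumes "mat_decode x = Some S" "0 < dim_row S"
  shows "length (list_decode x) = dim_row S"
    and "i < dim_row S \<Longrightarrow> j < dim_col S \<Longrightarrow> alg_decode (code_entry x i j) = Some (S $$ (i, j))"
proof -
  define rs where "rs = map entries_decode (list_decode x)"
  have none: "None \<notin> set rs" and len: "\<exists>k. \<forall>r\<in>set rs. length (the r) = k"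
    and S: "S = mat_of_rows_list (if rs = [] then 0 else length (the (hd rs))) (map the rs)"
    using assms(1) unfolding mat_decode_def rs_def[symmetric] Let_def by (auto split: if_splits)
  have row: "dim_row S = length rs" unfolding S by (simp add: mat_of_rows_list_def)
  then have rs: "rs \<noteq> []" using assms(2) by auto
  have col: "dim_col S = length (the (hd rs))" unfolding S using rs by (simp add: mat_of_rows_list_def)
  show l: "length (list_decode x) = dim_row S" unfolding row by (simp add: rs_def)
  assume i: "i < dim_row S" and j: "j < dim_col S"
  have irs: "rs ! i \<in> set rs" using i row by simp
  then obtain r where r: "rs ! i = Some r" using none by (metis option.exhaust)
  have lr: "length r = dim_col S"
    using len irs r rs unfolding col by (metis hd_in_set option.sel)
  have "S $$ (i, j) = r ! j"
    using i j row col r rs unfolding S by (simp add: mat_of_rows_list_def)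
  moreover have "entries_decode (list_decode x ! i) = Some r"
    using r i l by (simp add: rs_def)
  then have none': "None \<notin> set (map alg_decode (list_decode (list_decode x ! i)))"
    and rr: "r = map the (map alg_decode (list_decode (list_decode x ! i)))"
    by (auto simp: entries_decode_def Let_def split: if_splits)
  have jl: "j < length (list_decode (list_decode x ! i))" using rr lr j by simp
  then have "alg_decode (list_decode (list_decode x ! i) ! j) = Some (r ! j)"
    using none' unfolding rr by (metis length_map nth_map nth_mem option.exhaust_sel)
  moreover have "code_entry x i j = list_decode (list_decode x ! i) ! j"
    using jl i l by (simp add: code_entry_def nth_default_def)
  ultimately show "alg_decode (code_entry x i j) = Some (S $$ (i, j))" by simp
qed

definition grid_vec :: "(int \<times> int) list list \<Rightarrow> nat \<Rightarrow> nat \<Rightarrow> int \<times> int" where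
  "grid_vec vs m k = nth_default (0, 0) (nth_default [] vs m) k"

text \<open>This is K = 4 Q D^2 with D the dimension. Real and imaginary parts of an entry are each
  certified up to 1/K + 1/e, at most 2/K for e >= K. The entry is then off by at most 4/K, and D^2
  entries together by 1/Q.\<close>

definition approx_precision :: "nat \<Rightarrow> nat \<Rightarrow> nat" where
  "approx_precision Q x = 4 * Q * (length (list_decode x) * length (list_decode x))"

text \<open>A witness is \<open>(d, vs, e)\<close>: the vectors \<open>vs\<close> are taken over the common denominator \<open>Suc d\<close>, and
  \<open>e\<close> is the fineness of the grid that certifies the entries of the projector.\<close>

definition good_approx :: "nat \<Rightarrow> nat \<Rightarrow> nat \<times> (int \<times> int) list list \<times> nat \<Rightarrow> bool" where
  "good_approx Q x w \<longleftrightarrow>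
    (\<forall>v\<in>set (fst (snd w)). length v = length (list_decode x)) \<and>
    (\<forall>m<length (fst (snd w)). \<forall>m'<length (fst (snd w)).
      (\<Sum>k<length (list_decode x).
         fst (grid_vec (fst (snd w)) m k) * fst (grid_vec (fst (snd w)) m' k) +
         snd (grid_vec (fst (snd w)) m k) * snd (grid_vec (fst (snd w)) m' k))
       = (if m = m' then int (Suc (fst w)) * int (Suc (fst w)) else 0) \<and>
      (\<Sum>k<length (list_decode x).
         fst (grid_vec (fst (snd w)) m k) * snd (grid_vec (fst (snd w)) m' k) -
         snd (grid_vec (fst (snd w)) m k) * fst (grid_vec (fst (snd w)) m' k)) = 0) \<and>
    approx_precision Q x \<le> snd (snd w) \<and>
    (\<forall>i<length (list_decode x). \<forall>j<length (list_decode x).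
      root_near (code_entry x i j)
        (\<Sum>m<length (fst (snd w)).
           fst (grid_vec (fst (snd w)) m i) * fst (grid_vec (fst (snd w)) m j) +
           snd (grid_vec (fst (snd w)) m i) * snd (grid_vec (fst (snd w)) m j))
        (\<Sum>m<length (fst (snd w)).
           snd (grid_vec (fst (snd w)) m i) * fst (grid_vec (fst (snd w)) m j) -
           fst (grid_vec (fst (snd w)) m i) * snd (grid_vec (fst (snd w)) m j))
        (int (Suc (fst w)) * int (Suc (fst w))) (int (approx_precision Q x)) (snd (snd w)))"

lemma computable_good_approx:
  assumes "computable f"
  shows "computable (\<lambda>p. good_approx Q (f (fst p)) (snd p))"
  unfolding good_approx_def approx_precision_def code_entry_def grid_vec_def
  by (intro computable_intros computable_compose[OF assms])

lemma fip_gauss_value: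
  "fip D (\<lambda>k. gauss_value d (u k)) (\<lambda>k. gauss_value d (v k)) =
     Complex (of_int (\<Sum>k<D. fst (u k) * fst (v k) + snd (u k) * snd (v k)))
             (of_int (\<Sum>k<D. fst (u k) * snd (v k) - snd (u k) * fst (v k)))
       / of_int (int (Suc d) * int (Suc d))"
proof -
  define N where "N = complex_of_int (int (Suc d))"
  have gv: "gauss_value d p = Complex (of_int (fst p)) (of_int (snd p)) / N" for p
    by (simp add: gauss_value_def complex_eq_iff N_def del: of_nat_Suc)
  have N: "cnj N = N" by (simp add: N_def)
  have "cnj (gauss_value d p) * gauss_value d q =
      Complex (of_int (fst p * fst q + snd p * snd q)) (of_int (fst p * snd q - snd p * fst q)) / (N * N)" for p q
  proof -
    have "cnj (Complex (of_int (fst p)) (of_int (snd p))) * Complex (of_int (fst q)) (of_int (snd q)) =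
        Complex (of_int (fst p * fst q + snd p * snd q)) (of_int (fst p * snd q - snd p * fst q))"
      by (simp add: complex_eq_iff)
    then show ?thesis unfolding gv complex_cnj_divide N by simp
  qed
  moreover have "(\<Sum>k<D. Complex (f k) (g k) / c) = Complex (\<Sum>k<D. f k) (\<Sum>k<D. g k) / c"
    for f g :: "nat \<Rightarrow> real" and c
    unfolding sum_divide_distrib[symmetric] by (rule arg_cong[of _ _ "\<lambda>z. z / c"]) (simp add: complex_eq_iff)
  ultimately show ?thesis unfolding fip_def of_int_sum of_int_mult[of "int (Suc d)"] N_def[symmetric] by simp
qed

lemma outer_gauss_value:
  fixes r :: nat
  shows "(\<Sum>m<r. gauss_value d (u m) * cnj (gauss_value d (v m))) =
     Complex (of_int (\<Sum>m<r. fst (u m) * fst (v m) + snd (u m) * snd (v m)))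
             (of_int (\<Sum>m<r. snd (u m) * fst (v m) - fst (u m) * snd (v m)))
       / of_int (int (Suc d) * int (Suc d))"
proof -
  have "(\<Sum>m<r. gauss_value d (u m) * cnj (gauss_value d (v m))) =
      fip r (\<lambda>m. gauss_value d (v m)) (\<lambda>m. gauss_value d (u m))"
    by (simp add: fip_def mult.commute)
  then show ?thesis unfolding fip_gauss_value by (simp add: mult.commute add.commute)
qed

text \<open>Rational approximants over a common denominator satisfy the integer identities, and each
  entry is certified by all sufficiently fine grids. Only finitely many entries occur, so one
  \<open>e\<close> serves them all.\<close>

lemma good_approx_exists:
  assumes S: "mat_decode x = Some S" and proj: "special_projection n S" and Q: "Q > 0"
  shows "\<exists>w. good_approx Q x w"
proof -
  define D where "D = (2::nat) ^ n"
  have SD: "S \<in> carrier_mat D D" "madj S = S" "S * S = S"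
    using proj unfolding special_projection_def D_def by auto
  have D0: "0 < D" by (simp add: D_def)
  have dims: "dim_row S = D" "dim_col S = D" using SD by auto
  have len: "length (list_decode x) = D"
    using mat_decode_entry(1)[OF S] dims D0 by simp
  have ent: "alg_decode (code_entry x i j) = Some (S $$ (i, j))" if "i < D" "j < D" for i j
    using mat_decode_entry(2)[OF S] dims D0 that by simp
  define K where "K = approx_precision Q x"
  have K0: "K > 0" using Q D0 by (simp add: K_def approx_precision_def len)
  have herm: "S $$ (i, j) = cnj (S $$ (j, i))" if "i < D" "j < D" for i j
    using arg_cong[OF SD(2), of "\<lambda>A. A $$ (i, j)"] that dims by (simp add: madj_def)
  have idem: "(\<Sum>k<D. S $$ (i, k) * S $$ (k, j)) = S $$ (i, j)" if "i < D" "j < D" for i j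
    using arg_cong[OF SD(3), of "\<lambda>A. A $$ (i, j)"] that dims
    by (simp add: scalar_prod_def atLeast0LessThan)
  obtain r X where X: "orthonormal_family D r X" "\<And>m k. m < r \<Longrightarrow> k < D \<Longrightarrow> gauss_rat (X m k)"
      "\<And>i j. i < D \<Longrightarrow> j < D \<Longrightarrow> cmod ((\<Sum>m<r. X m i * cnj (X m j)) - S $$ (i, j)) < 1 / real K"
  proof -
    have "0 < 1 / real K" using K0 by simp
    from projection_rational_approximation[of D "\<lambda>i j. S $$ (i, j)", OF herm idem this] that
    show ?thesis by blast
  qed
  define R where "R = (\<lambda>p. Re (X (fst p) (snd p))) ` ({..<r} \<times> {..<D}) \<union> (\<lambda>p. Im (X (fst p) (snd p))) ` ({..<r} \<times> {..<D})"
  have "finite R" "R \<subseteq> \<rat>" using X(2) by (auto simp: R_def gauss_rat_def)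
  then obtain d :: nat where d: "\<forall>y\<in>R. \<exists>a::int. y = of_int a / real (Suc d)"
    using common_denominator by blast
  have "\<exists>p. X m k = gauss_value d p" if "m < r" "k < D" for m k
  proof -
    have "Re (X m k) \<in> R" "Im (X m k) \<in> R"
      unfolding R_def using that by (force intro: image_eqI[of _ _ "(m, k)"])+
    then obtain a b :: int where "Re (X m k) = of_int a / real (Suc d)" "Im (X m k) = of_int b / real (Suc d)"
      using d by meson
    then have "X m k = gauss_value d (a, b)" by (simp add: gauss_value_def complex_eq_iff)
    then show ?thesis ..
  qed
  then obtain A where A: "\<And>m k. m < r \<Longrightarrow> k < D \<Longrightarrow> X m k = gauss_value d (A m k)" by metis
  define vs where "vs = map (\<lambda>m. map (A m) [0..<D]) [0..<r]"
  have vs: "grid_vec vs m k = A m k" if "m < r" "k < D" for m k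
    using that by (simp add: vs_def grid_vec_def nth_default_def)
  have lvs: "length vs = r" by (simp add: vs_def)
  define N where "N = int (Suc d) * int (Suc d)"
  have N: "N > 0" by (simp add: N_def)
  define G1 where "G1 m m' = (\<Sum>k<D. fst (grid_vec vs m k) * fst (grid_vec vs m' k) + snd (grid_vec vs m k) * snd (grid_vec vs m' k))" for m m'
  define G2 where "G2 m m' = (\<Sum>k<D. fst (grid_vec vs m k) * snd (grid_vec vs m' k) - snd (grid_vec vs m k) * fst (grid_vec vs m' k))" for m m'
  have gram: "G1 m m' = (if m = m' then N else 0) \<and> G2 m m' = 0" if "m < r" "m' < r" for m m'
  proof -
    have "Complex (of_int (G1 m m')) (of_int (G2 m m')) / of_int N
        = fip D (\<lambda>k. gauss_value d (grid_vec vs m k)) (\<lambda>k. gauss_value d (grid_vec vs m' k))"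
      unfolding fip_gauss_value G1_def G2_def N_def ..
    also have "\<dots> = fip D (X m) (X m')"
      using that by (intro fip_cong) (auto simp: vs A)
    also have "\<dots> = (if m = m' then 1 else 0)"
      using X(1) that unfolding orthonormal_family_def by blast
    finally have "Complex (of_int (G1 m m')) (of_int (G2 m m')) = (if m = m' then of_int N else 0)"
      using N by (auto simp: divide_eq_eq split: if_splits)
    then have "real_of_int (G1 m m') = (if m = m' then of_int N else 0) \<and> real_of_int (G2 m m') = 0"
      by (auto simp: complex_eq_iff split: if_splits)
    then show ?thesis by (auto split: if_splits)
  qed
  define P1 where "P1 i j = (\<Sum>m<r. fst (grid_vec vs m i) * fst (grid_vec vs m j) + snd (grid_vec vs m i) * snd (grid_vec vs m j))" for i j
  define P2 where "P2 i j = (\<Sum>m<r. snd (grid_vec vs m i) * fst (grid_vec vs m j) - fst (grid_vec vs m i) * snd (grid_vec vs m j))" for i j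
  have ev: "\<forall>\<^sub>F e in sequentially. root_near (code_entry x i j) (P1 i j) (P2 i j) N (int K) e"
    if "i < D" "j < D" for i j
  proof -
    have "Complex (of_int (P1 i j)) (of_int (P2 i j)) / of_int N
        = (\<Sum>m<r. gauss_value d (grid_vec vs m i) * cnj (gauss_value d (grid_vec vs m j)))"
      unfolding outer_gauss_value P1_def P2_def N_def ..
    also have "\<dots> = (\<Sum>m<r. X m i * cnj (X m j))"
      using that by (intro sum.cong) (auto simp: vs A)
    finally have eq: "(\<Sum>m<r. X m i * cnj (X m j)) = Complex (of_int (P1 i j) / of_int N) (of_int (P2 i j) / of_int N)"
      by (simp add: complex_eq_iff)
    have "\<bar>Re ((\<Sum>m<r. X m i * cnj (X m j)) - S $$ (i, j))\<bar> < 1 / real K"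
      "\<bar>Im ((\<Sum>m<r. X m i * cnj (X m j)) - S $$ (i, j))\<bar> < 1 / real K"
      using X(3)[OF that] abs_Re_le_cmod abs_Im_le_cmod order.strict_trans1 by blast+
    then show ?thesis
      by (intro root_near_complete[OF ent[OF that] N]) (use K0 in \<open>auto simp: eq abs_minus_commute\<close>)
  qed
  have "\<forall>\<^sub>F e in sequentially. \<forall>i\<in>{..<D}. \<forall>j\<in>{..<D}. root_near (code_entry x i j) (P1 i j) (P2 i j) N (int K) e"
    by (intro eventually_ball_finite ballI ev) auto
  then have "\<forall>\<^sub>F e in sequentially. (\<forall>i\<in>{..<D}. \<forall>j\<in>{..<D}. root_near (code_entry x i j) (P1 i j) (P2 i j) N (int K) e) \<and> K \<le> e"
    using eventually_ge_at_top[of K] by (rule eventually_conj)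
  then obtain e where e: "\<And>i j. i < D \<Longrightarrow> j < D \<Longrightarrow> root_near (code_entry x i j) (P1 i j) (P2 i j) N (int K) e" "K \<le> e"
    unfolding eventually_sequentially by auto
  have "good_approx Q x (d, vs, e)"
    unfolding good_approx_def fst_conv snd_conv len lvs K_def[symmetric] N_def[symmetric]
      G1_def[symmetric] G2_def[symmetric] P1_def[symmetric] P2_def[symmetric]
    using gram e by (auto simp: vs_def)
  then show ?thesis ..
qed

section \<open>From certified entries to traces\<close>

text \<open>Positivity is tested on the vector with entry 1 at \<open>i\<close> and \<open>c\<close>
  at \<open>j\<close>, the phase \<open>c\<close> turning the cross terms into
  \<open>- 2 * cmod (A $$ (i, j))\<close>. So twice the modulus is at most the sum of two diagonal
  entries, hence at most the trace.\<close>

lemma density_entry_le_1: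
  assumes A: "density_matrix d A" and ij: "i < d" "j < d"
  shows "cmod (A $$ (i, j)) \<le> 1"
proof -
  have car: "A \<in> carrier_mat d d" and tr: "mtrace A = 1"
    and psd: "\<And>v. v \<in> carrier_vec d \<Longrightarrow> Im (braket v A v) = 0 \<and> Re (braket v A v) \<ge> 0"
    using A unfolding density_matrix_def by auto
  have br: "braket v A v = (\<Sum>k<d. \<Sum>l<d. cnj (v $ k) * A $$ (k, l) * v $ l)" if "v \<in> carrier_vec d" for v
    using that car
    by (auto simp: braket_def cinner_def scalar_prod_def atLeast0LessThan sum_distrib_left mult.assoc intro!: sum.cong)
  have herm: "A $$ (k, l) = cnj (A $$ (l, k))" if "k < d" "l < d" for k l
  proof -
    have "madj A = A" using A unfolding density_matrix_def by blast
    from arg_cong[OF this, of "\<lambda>B. B $$ (k, l)"] show ?thesis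
      using that car by (simp add: madj_def)
  qed
  have two: "braket v A v = cnj a * A $$ (k, k) * a + cnj a * A $$ (k, l) * b + cnj b * A $$ (l, k) * a + cnj b * A $$ (l, l) * b"
    if kl: "k < d" "l < d" "k \<noteq> l" and v: "v = vec d (\<lambda>m. if m = k then a else if m = l then b else 0)" for v a b k l
  proof -
    have sub: "{k, l} \<subseteq> {..<d}" using kl by auto
    have "braket v A v = (\<Sum>k<d. \<Sum>l<d. cnj (v $ k) * A $$ (k, l) * v $ l)"
      by (rule br) (simp add: v)
    also have "\<dots> = (\<Sum>m\<in>{k, l}. \<Sum>m'\<in>{k, l}. cnj (v $ m) * A $$ (m, m') * v $ m')"
    proof -
      have "(\<Sum>m'<d. cnj (v $ m) * A $$ (m, m') * v $ m') = (\<Sum>m'\<in>{k, l}. cnj (v $ m) * A $$ (m, m') * v $ m')" for m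
        by (rule sum.mono_neutral_right) (use sub v in auto)
      then have "(\<Sum>k<d. \<Sum>l<d. cnj (v $ k) * A $$ (k, l) * v $ l) = (\<Sum>m<d. \<Sum>m'\<in>{k, l}. cnj (v $ m) * A $$ (m, m') * v $ m')" by simp
      also have "\<dots> = (\<Sum>m\<in>{k, l}. \<Sum>m'\<in>{k, l}. cnj (v $ m) * A $$ (m, m') * v $ m')"
        by (rule sum.mono_neutral_right) (use sub v in auto)
      finally show ?thesis .
    qed
    also have "\<dots> = cnj a * A $$ (k, k) * a + cnj a * A $$ (k, l) * b + cnj b * A $$ (l, k) * a + cnj b * A $$ (l, l) * b"
      using kl by (simp add: v)
    finally show ?thesis .
  qed
  have diag: "Im (A $$ (k, k)) = 0 \<and> 0 \<le> Re (A $$ (k, k))" if "k < d" for k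
  proof -
    define v :: "complex vec" where "v = vec d (\<lambda>m. if m = k then 1 else 0)"
    have v: "v \<in> carrier_vec d" by (simp add: v_def)
    have "braket v A v = (\<Sum>m<d. \<Sum>l<d. if m = k \<and> l = k then A $$ (k, k) else 0)"
      unfolding br[OF v] by (intro sum.cong refl) (auto simp: v_def)
    also have "\<dots> = (\<Sum>m<d. if m = k then A $$ (k, k) else 0)"
      using that by (intro sum.cong refl) auto
    also have "\<dots> = A $$ (k, k)" using that by simp
    finally show ?thesis using psd[OF v] by simp
  qed
  have tr1: "(\<Sum>k<d. Re (A $$ (k, k))) = 1"
    using arg_cong[OF tr, of Re] car by (simp add: mtrace_def)
  show ?thesis
  proof (cases "i = j")
    case True
    have "Re (A $$ (i, i)) \<le> (\<Sum>k<d. Re (A $$ (k, k)))"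
      using ij diag by (intro member_le_sum) auto
    then show ?thesis using True diag[OF ij(1)] tr1 by (simp add: cmod_def)
  next
    case False
    define c where "c = (if A $$ (i, j) = 0 then 0 else - (cnj (A $$ (i, j)) / of_real (cmod (A $$ (i, j)))))"
    have cA: "c * A $$ (i, j) = - of_real (cmod (A $$ (i, j)))"
      using cnj_mult_self[of "A $$ (i, j)"] by (auto simp: c_def power2_eq_square)
    define v where "v = vec d (\<lambda>m. if m = i then 1 else if m = j then c else 0)"
    have v: "v \<in> carrier_vec d" by (simp add: v_def)
    have cc: "cnj c * c = of_real ((cmod c)\<^sup>2)" by (rule cnj_mult_self)
    have "braket v A v = A $$ (i, i) + c * A $$ (i, j) + cnj (c * A $$ (i, j)) + cnj c * c * A $$ (j, j)"
      using two[OF ij False v_def] herm[OF ij(2,1)] by (simp add: mult.commute mult.left_commute)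
    then have "Re (braket v A v) = Re (A $$ (i, i)) - 2 * cmod (A $$ (i, j)) + (cmod c)\<^sup>2 * Re (A $$ (j, j))"
      unfolding cA cc by simp
    then have "2 * cmod (A $$ (i, j)) \<le> Re (A $$ (i, i)) + (cmod c)\<^sup>2 * Re (A $$ (j, j))"
      using psd[OF v] by linarith
    moreover have "(cmod c)\<^sup>2 \<le> 1" by (simp add: c_def norm_divide)
    then have "(cmod c)\<^sup>2 * Re (A $$ (j, j)) \<le> 1 * Re (A $$ (j, j))"
      using diag[OF ij(2)] by (intro mult_right_mono) auto
    moreover have "(\<Sum>k\<in>{i, j}. Re (A $$ (k, k))) \<le> (\<Sum>k<d. Re (A $$ (k, k)))"
      using ij diag by (intro sum_mono2) auto
    then have "Re (A $$ (i, i)) + Re (A $$ (j, j)) \<le> 1" using False tr1 by simp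
    ultimately show ?thesis by linarith
  qed
qed

text \<open>With \<open>P\<close> the projector onto the found vectors, the two captured masses
  differ by the sum of \<open>A $$ (i, j) * (P j i - S $$ (j, i))\<close>: D^2 terms of modulus at
  most 4/K, by \<open>density_entry_le_1\<close>. The diagonal of \<open>P\<close> likewise compares
  the number of vectors with the trace of \<open>S\<close>.\<close>

lemma good_approx_sound:
  assumes S: "mat_decode x = Some S" and proj: "special_projection n S" and Q: "Q > 0"
    and w: "good_approx Q x (d, vs, e)"
  obtains F where "vecset_decode (set_code d vs) = Some F" "F \<subseteq> carrier_vec (2 ^ n)"
    "orthonormal F" "card F = length vs"
    "\<And>A. density_matrix (2 ^ n) A \<Longrightarrow> \<bar>(\<Sum>v\<in>F. Re (braket v A v)) - Re (mtrace (A * S))\<bar> \<le> 1 / real Q"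
    "\<bar>real (length vs) - Re (mtrace S)\<bar> \<le> 1 / real Q"
proof -
  define D where "D = (2::nat) ^ n"
  have SD: "S \<in> carrier_mat D D" "madj S = S" "S * S = S"
    using proj unfolding special_projection_def D_def by auto
  have D0: "0 < D" by (simp add: D_def)
  have dims: "dim_row S = D" "dim_col S = D" using SD by auto
  have len: "length (list_decode x) = D"
    using mat_decode_entry(1)[OF S] dims D0 by simp
  have ent: "alg_decode (code_entry x i j) = Some (S $$ (i, j))" if "i < D" "j < D" for i j
    using mat_decode_entry(2)[OF S] dims D0 that by simp
  define K where "K = approx_precision Q x"
  have K0: "K > 0" using Q D0 by (simp add: K_def approx_precision_def len)
  define r where "r = length vs"
  define N where "N = int (Suc d) * int (Suc d)"
  have N: "N > 0" by (simp add: N_def)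
  define G1 where "G1 m m' = (\<Sum>k<D. fst (grid_vec vs m k) * fst (grid_vec vs m' k) + snd (grid_vec vs m k) * snd (grid_vec vs m' k))" for m m'
  define G2 where "G2 m m' = (\<Sum>k<D. fst (grid_vec vs m k) * snd (grid_vec vs m' k) - snd (grid_vec vs m k) * fst (grid_vec vs m' k))" for m m'
  define P1 where "P1 i j = (\<Sum>m<r. fst (grid_vec vs m i) * fst (grid_vec vs m j) + snd (grid_vec vs m i) * snd (grid_vec vs m j))" for i j
  define P2 where "P2 i j = (\<Sum>m<r. snd (grid_vec vs m i) * fst (grid_vec vs m j) - fst (grid_vec vs m i) * snd (grid_vec vs m j))" for i j
  have lenv: "\<And>v. v \<in> set vs \<Longrightarrow> length v = D"
    and gram: "\<And>m m'. m < r \<Longrightarrow> m' < r \<Longrightarrow> G1 m m' = (if m = m' then N else 0) \<and> G2 m m' = 0"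
    and Ke: "K \<le> e"
    and near: "\<And>i j. i < D \<Longrightarrow> j < D \<Longrightarrow> root_near (code_entry x i j) (P1 i j) (P2 i j) N (int K) e"
    using w unfolding good_approx_def fst_conv snd_conv len K_def[symmetric] N_def[symmetric] r_def[symmetric]
      G1_def[symmetric] G2_def[symmetric] P1_def[symmetric] P2_def[symmetric] by auto
  define X where "X m k = gauss_value d (grid_vec vs m k)" for m k
  define P where "P i j = (\<Sum>m<r. X m i * cnj (X m j))" for i j
  have ortho: "fip D (X m) (X m') = (if m = m' then 1 else 0)" if "m < r" "m' < r" for m m'
  proof -
    have "fip D (X m) (X m') = Complex (of_int (G1 m m')) (of_int (G2 m m')) / of_int N"
      unfolding X_def fip_gauss_value G1_def G2_def N_def ..
    then show ?thesis using gram[OF that] N by (auto simp: complex_eq_iff)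
  qed
  have close: "cmod (P i j - S $$ (i, j)) \<le> 4 / real K" if "i < D" "j < D" for i j
  proof -
    have "P i j = Complex (of_int (P1 i j)) (of_int (P2 i j)) / of_int N"
      unfolding P_def X_def outer_gauss_value P1_def P2_def N_def ..
    then have P: "Re (P i j) = of_int (P1 i j) / of_int N" "Im (P i j) = of_int (P2 i j) / of_int N" by simp_all
    have "0 < e" "0 < int K" using K0 Ke by auto
    note sound = root_near_sound[OF ent[OF that] near[OF that] this(1) N this(2)]
    have "1 / real e \<le> 1 / real K" using K0 Ke by (intro divide_left_mono) auto
    then have "\<bar>Re (P i j - S $$ (i, j))\<bar> \<le> 2 / real K" "\<bar>Im (P i j - S $$ (i, j))\<bar> \<le> 2 / real K"
      using sound by (simp_all add: P abs_minus_commute)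
    then show ?thesis using cmod_le[of "P i j - S $$ (i, j)"] by linarith
  qed
  define V where "V m = vec_of_list (map (gauss_value d) (vs ! m))" for m
  define F where "F = set (map (\<lambda>v. vec_of_list (map (gauss_value d) v)) vs)"
  have F: "F = V ` {..<r}"
  proof -
    have "set vs = (!) vs ` {..<length vs}" by (auto simp: set_conv_nth)
    then show ?thesis unfolding F_def V_def r_def set_map by (simp only: image_image)
  qed
  have V: "V m \<in> carrier_vec D" "\<And>k. k < D \<Longrightarrow> V m $ k = X m k" if "m < r" for m
  proof -
    have l: "length (vs ! m) = D" using that lenv by (simp add: r_def)
    then show "V m \<in> carrier_vec D" unfolding V_def by (metis carrier_vec_dim_vec dim_vec_of_list length_map)
    show "V m $ k = X m k" if "k < D" for k
      using l that \<open>m < r\<close> by (simp add: V_def X_def grid_vec_def nth_default_def r_def vec_of_list_index)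
  qed
  have inner: "cinner (V m) (V m') = (if m = m' then 1 else 0)" if "m < r" "m' < r" for m m'
  proof -
    have "cinner (V m) (V m') = fip D (X m) (X m')"
      unfolding cinner_def fip_def using V that by (intro sum.cong) auto
    then show ?thesis using ortho[OF that] by simp
  qed
  \<comment> \<open>Orthonormality forces vectors with different indices to differ, so passing from
    the list to the set loses none.\<close>
  have inj: "inj_on V {..<r}"
    by (intro inj_onI) (metis inner lessThan_iff zero_neq_one)
  have on: "orthonormal F"
    unfolding orthonormal_def F using inner inj by (auto dest: inj_onD)
  have trace_bound: "\<bar>(\<Sum>v\<in>F. Re (braket v A v)) - Re (mtrace (A * S))\<bar> \<le> 1 / real Q"
    if A: "density_matrix D A" for A
  proof -
    have car: "A \<in> carrier_mat D D" using A unfolding density_matrix_def by blast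
    have "(\<Sum>v\<in>F. braket v A v) = (\<Sum>m<r. braket (V m) A (V m))"
      unfolding F by (rule sum.reindex_cong[OF inj]) auto
    also have "\<dots> = (\<Sum>m<r. \<Sum>i<D. \<Sum>j<D. A $$ (i, j) * (X m j * cnj (X m i)))"
    proof (rule sum.cong[OF refl])
      fix m assume "m \<in> {..<r}"
      then have m: "m < r" by simp
      show "braket (V m) A (V m) = (\<Sum>i<D. \<Sum>j<D. A $$ (i, j) * (X m j * cnj (X m i)))"
        using V[OF m] car
        by (auto simp: braket_def cinner_def scalar_prod_def atLeast0LessThan sum_distrib_left mult_ac intro!: sum.cong)
    qed
    also have "\<dots> = (\<Sum>i<D. \<Sum>m<r. \<Sum>j<D. A $$ (i, j) * (X m j * cnj (X m i)))"
      by (rule sum.swap)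
    also have "\<dots> = (\<Sum>i<D. \<Sum>j<D. \<Sum>m<r. A $$ (i, j) * (X m j * cnj (X m i)))"
      by (intro sum.cong refl sum.swap)
    also have "\<dots> = (\<Sum>i<D. \<Sum>j<D. A $$ (i, j) * P j i)"
      by (simp add: P_def sum_distrib_left)
    finally have 1: "(\<Sum>v\<in>F. braket v A v) = (\<Sum>i<D. \<Sum>j<D. A $$ (i, j) * P j i)" .
    have 2: "mtrace (A * S) = (\<Sum>i<D. \<Sum>j<D. A $$ (i, j) * S $$ (j, i))"
      using car SD by (auto simp: mtrace_def scalar_prod_def atLeast0LessThan intro!: sum.cong)
    have "(\<Sum>v\<in>F. braket v A v) - mtrace (A * S) = (\<Sum>i<D. \<Sum>j<D. A $$ (i, j) * (P j i - S $$ (j, i)))"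
      unfolding 1 2 by (simp add: sum_subtractf algebra_simps)
    also have "cmod \<dots> \<le> (\<Sum>i<D. \<Sum>j<D. 1 * (4 / real K))"
      by (intro sum_norm_le) (unfold norm_mult lessThan_iff,
          intro mult_mono density_entry_le_1[OF A] close norm_ge_zero, simp_all)
    also have "\<dots> = 1 / real Q"
      using D0 Q by (simp add: K_def approx_precision_def len)
    finally have "cmod ((\<Sum>v\<in>F. braket v A v) - mtrace (A * S)) \<le> 1 / real Q" .
    then have "\<bar>Re ((\<Sum>v\<in>F. braket v A v) - mtrace (A * S))\<bar> \<le> 1 / real Q"
      using abs_Re_le_cmod order_trans by blast
    then show ?thesis by simp
  qed
  have "(\<Sum>i<D. P i i) = (\<Sum>m<r. \<Sum>i<D. X m i * cnj (X m i))"
    unfolding P_def by (rule sum.swap)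
  also have "\<dots> = (\<Sum>m<r. fip D (X m) (X m))" by (simp add: fip_def mult.commute)
  also have "\<dots> = of_nat r" using ortho by simp
  finally have "of_nat r - mtrace S = (\<Sum>i<D. P i i - S $$ (i, i))"
    using dims by (simp add: mtrace_def sum_subtractf)
  also have "cmod \<dots> \<le> (\<Sum>i<D. 4 / real K)"
    by (intro sum_norm_le) (auto intro: close)
  \<comment> \<open>Only D terms occur here; enlarging to D^2 terms reuses the same
    precision.\<close>
  also have "\<dots> \<le> (\<Sum>i<D. \<Sum>j<D. 4 / real K)"
    using D0 by (intro sum_mono) (simp add: divide_right_mono)
  also have "\<dots> = 1 / real Q"
    using D0 Q by (simp add: K_def approx_precision_def len)
  finally have "cmod (of_nat r - mtrace S) \<le> 1 / real Q" .
  then have "\<bar>Re (of_nat r - mtrace S)\<bar> \<le> 1 / real Q"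
    using abs_Re_le_cmod order_trans by blast
  then have tr: "\<bar>real r - Re (mtrace S)\<bar> \<le> 1 / real Q" by simp
  show ?thesis
  proof (rule that)
    show "vecset_decode (set_code d vs) = Some F" unfolding F_def by (rule vecset_decode_set_code)
    show "F \<subseteq> carrier_vec (2 ^ n)" unfolding F D_def[symmetric] using V(1) by auto
    show "card F = length vs" unfolding F using card_image[OF inj] by (simp add: r_def)
  qed (use on trace_bound tr in \<open>auto simp: D_def r_def\<close>)
qed

section \<open>A prefix-free code by levels\<close>

lemma str_code_eq_enc: "str_code \<sigma> = enc \<sigma>"
proof -
  have "(\<lambda>b. if b then 1 else 0) = (enc :: bool \<Rightarrow> nat)" by (rule ext) (simp add: enc_bool_def)
  then show ?thesis by (simp add: str_code_def enc_list_def)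
qed

text \<open>The machine searches for the least \<open>m\<close> whose codeword is the input and
  diverges if there is none, so its domain is the range of \<open>cw\<close>. Uniqueness is asked
  only of the \<open>m\<close> in question, because indices without a proper description may share a
  word.\<close>

lemma machine_of_codewords:
  fixes cw :: "nat \<Rightarrow> bool list" and g :: "nat \<Rightarrow> nat"
  assumes cw: "computable cw" and g: "computable g"
    and pf: "\<And>m m'. prefix (cw m) (cw m') \<Longrightarrow> cw m = cw m'"
  shows "\<exists>M. prefix_free_machine M \<and>
    (\<forall>m. (\<forall>m'. cw m' = cw m \<longrightarrow> m' = m) \<longrightarrow> M (cw m) = Some (g m))"
proof -
  have h: "total_recursive (\<lambda>m. enc (cw m))"
    unfolding computable_nat_iff[symmetric] by (rule computable_enc[OF cw])
  \<comment> \<open>Truncated subtraction in both directions gives the distance, whose zeros express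
    equality for the minimisation.\<close>
  define q where "q m x = (enc (cw m) - x) + (x - enc (cw m))" for m x
  have q0: "q m x = 0 \<longleftrightarrow> enc (cw m) = x" for m x by (auto simp: q_def)
  have "rec2 q"
    unfolding rec2_def q_def by (intro recn_add recn_diff recn_app1[OF h] recn_proj) auto
  then obtain r where r: "\<And>n x y. reval r [n, x] y \<longleftrightarrow> y = q n x" using rec2_reval by blast
  obtain rg where rg: "\<And>x y. reval rg [x] y \<longleftrightarrow> y = g x"
    using g unfolding computable_nat_iff total_recursive_def partial_recursive_def option.inject by metis
  define f where "f x = (if \<exists>m. enc (cw m) = x then Some (g (LEAST m. enc (cw m) = x)) else None)" for x
  have mini: "reval (RMini r) [x] n \<longleftrightarrow> (\<exists>m. enc (cw m) = x) \<and> n = (LEAST m. enc (cw m) = x)" for x n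
    unfolding reval_RMini_iff[OF r] q0
  proof
    assume n: "enc (cw n) = x \<and> (\<forall>m<n. enc (cw m) \<noteq> x)"
    then have "(LEAST m. enc (cw m) = x) = n" by (intro Least_equality) (auto simp: not_less[symmetric])
    with n show "(\<exists>m. enc (cw m) = x) \<and> n = (LEAST m. enc (cw m) = x)" by auto
  next
    assume least: "(\<exists>m. enc (cw m) = x) \<and> n = (LEAST m. enc (cw m) = x)"
    note ex = conjunct1[OF least] and n = conjunct2[OF least]
    have "enc (cw n) = x" unfolding n by (rule LeastI_ex[OF ex])
    moreover have "enc (cw m) \<noteq> x" if "m < n" for m
      using not_less_Least[of m "\<lambda>m. enc (cw m) = x"] that unfolding n by blast
    ultimately show "enc (cw n) = x \<and> (\<forall>m<n. enc (cw m) \<noteq> x)" by blast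
  qed
  have comp: "reval (RComp rg [RMini r]) [x] y \<longleftrightarrow> (\<exists>n. reval (RMini r) [x] n \<and> y = g n)" for x y
  proof
    assume "reval (RComp rg [RMini r]) [x] y"
    then show "\<exists>n. reval (RMini r) [x] n \<and> y = g n"
      by (rule reval_CompE) (auto simp: list_all2_Cons1 rg)
  next
    assume "\<exists>n. reval (RMini r) [x] n \<and> y = g n"
    then obtain n where "reval (RMini r) [x] n" "y = g n" by blast
    then show "reval (RComp rg [RMini r]) [x] y"
      by (intro reval.intros(4)[where ys = "[n]"]) (auto simp: rg)
  qed
  have "partial_recursive f"
    unfolding partial_recursive_def
    by (rule exI[of _ "RComp rg [RMini r]"]) (auto simp: comp mini f_def)
  define M where "M \<sigma> = f (str_code \<sigma>)" for \<sigma>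
  have M: "M \<sigma> = (if \<exists>m. cw m = \<sigma> then Some (g (LEAST m. cw m = \<sigma>)) else None)" for \<sigma>
    by (simp add: M_def f_def str_code_eq_enc)
  have "prefix_free_machine M"
    unfolding prefix_free_machine_def partial_computable_machine_def
    using \<open>partial_recursive f\<close> pf by (auto simp: M_def[symmetric]) (auto simp: M split: if_splits)
  moreover have "M (cw m) = Some (g m)" if "\<forall>m'. cw m' = cw m \<longrightarrow> m' = m" for m
  proof -
    have "(LEAST m'. cw m' = cw m) = m" using that by (intro Least_equality) auto
    then show ?thesis by (auto simp: M)
  qed
  ultimately show ?thesis by blast
qed

text \<open>For positive \<open>r <= D\<close> this is the integer part of
  \<open>log 2 (D / r) / a\<close>, hence the scale of the normalised trace in steps of
  \<open>a\<close> bits. The disjunct \<open>r = 0\<close> makes the search total and gives level 0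
  there.\<close>

definition level :: "nat \<Rightarrow> nat \<Rightarrow> nat \<Rightarrow> nat" where
  "level a r D = (LEAST t. r = 0 \<or> D < r * 2 ^ (a * Suc t))"

lemma level_exists:
  fixes a r D :: nat
  assumes "0 < a"
  shows "\<exists>t. r = 0 \<or> D < r * 2 ^ (a * Suc t)"
proof -
  have "D < 2 ^ D" by simp
  also have "(2::nat) ^ D \<le> 2 ^ (a * Suc D)"
    using assms by (intro power_increasing) (cases a, auto)
  also have "(2::nat) ^ (a * Suc D) \<le> r * 2 ^ (a * Suc D)" if "r \<noteq> 0" using that by simp
  finally have "r = 0 \<or> D < r * 2 ^ (a * Suc D)" by blast
  then show ?thesis by (rule exI)
qed

lemma level_upper: "0 < a \<Longrightarrow> 0 < r \<Longrightarrow> D < r * 2 ^ (a * Suc (level a r D))"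
  unfolding level_def using LeastI_ex[OF level_exists[of a r D]] by auto

lemma level_lower:
  assumes "0 < level a r D"
  shows "r * 2 ^ (a * level a r D) \<le> D"
proof -
  obtain t where t: "level a r D = Suc t" using assms by (cases "level a r D") auto
  then have "\<not> (r = 0 \<or> D < r * 2 ^ (a * Suc t))"
    using not_less_Least[of t "\<lambda>t. r = 0 \<or> D < r * 2 ^ (a * Suc t)"] unfolding level_def by simp
  then show ?thesis unfolding t by simp
qed

lemma computable_level [computable_intros]:
  assumes "0 < a" "computable f" "computable g"
  shows "computable (\<lambda>x. level a (f x) (g x))"
proof -
  have "computable (\<lambda>p. level a (fst p) (snd p))"
    unfolding level_def by (intro computable_Least level_exists[OF assms(1)] computable_intros)
  from computable_app2[OF this assms(2,3)] show ?thesis .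
qed

definition low_bits :: "nat \<Rightarrow> nat \<Rightarrow> bool list" where
  "low_bits w i = map (\<lambda>k. odd (i div 2 ^ k)) [0..<w]"

lemma low_bits_inj:
  assumes "low_bits w i = low_bits w j" "i < 2 ^ w" "j < 2 ^ w"
  shows "i = j"
proof (rule bit_eqI)
  fix n
  show "bit i n = bit j n"
  proof (cases "n < w")
    case True
    then show ?thesis
      using assms(1) by (auto simp: low_bits_def bit_iff_odd list_eq_iff_nth_eq)
  next
    case False
    then have "(2::nat) ^ w \<le> 2 ^ n" by simp
    then have "i < 2 ^ n" "j < 2 ^ n" using assms(2,3) by (meson less_le_trans)+
    then show ?thesis by (simp add: bit_iff_odd)
  qed
qed

text \<open>The leading \<open>False\<close> keeps all codewords apart from the word
  \<open>[True]\<close>. The unary part ends at the next \<open>False\<close> and fixes the width of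
  the index, so no further delimiter is needed. It is written as a map over \<open>[0..<t]\<close>
  to fit \<open>computable_map_upt\<close>.\<close>

definition codeword :: "nat \<Rightarrow> nat \<Rightarrow> nat \<Rightarrow> nat \<Rightarrow> bool list" where
  "codeword b c t i = False # map (\<lambda>_. True) [0..<t] @ False # low_bits (b * t + c) i"

lemma length_codeword: "length (codeword b c t i) = Suc b * t + c + 2"
  by (simp add: codeword_def low_bits_def)

text \<open>Comparing the unary parts gives \<open>t = t'\<close>; then both words have the same
  length, and a prefix of equal length is the whole word.\<close>

lemma prefix_codeword:
  assumes "prefix (codeword b c t i) (codeword b c t' i')"
  shows "t = t' \<and> codeword b c t i = codeword b c t' i'"
proof -
  have unary: "t = t'" if "prefix (replicate t True @ False # xs) (replicate t' True @ False # ys)" for t t' xs ys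
    using that
  proof (induction t arbitrary: t')
    case 0
    then show ?case by (cases t') auto
  next
    case (Suc t)
    then show ?case by (cases t') auto
  qed
  have tt: "t = t'"
    by (rule unary) (use assms in \<open>auto simp: codeword_def map_replicate_const\<close>)
  moreover have "codeword b c t i = codeword b c t' i'"
  proof -
    obtain ys where ys: "codeword b c t' i' = codeword b c t i @ ys"
      using assms unfolding prefix_def by blast
    then have "length (codeword b c t' i') = length (codeword b c t i @ ys)" by (rule arg_cong)
    then have "length ys = 0" unfolding length_append length_codeword tt by simp
    with ys show ?thesis by simp
  qed
  ultimately show ?thesis by blast
qed

text \<open>Members of a level are numbered in order of appearance, so the number of
  \<open>m\<close> depends only on the indices up to \<open>m\<close> and is computable although the
  size of the level is not known.\<close>

definition level_index :: "nat \<Rightarrow> (nat \<Rightarrow> nat) \<Rightarrow> (nat \<Rightarrow> nat) \<Rightarrow> nat \<Rightarrow> nat" where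
  "level_index a r D m = (\<Sum>i<m. if r i \<noteq> 0 \<and> level a (r i) (D i) = level a (r m) (D m) then 1 else 0)"

lemma level_index_eq_card:
  "level_index a r D m = card {i. i < m \<and> r i \<noteq> 0 \<and> level a (r i) (D i) = level a (r m) (D m)}"
proof -
  have "level_index a r D m =
      (\<Sum>i\<in>{i \<in> {..<m}. r i \<noteq> 0 \<and> level a (r i) (D i) = level a (r m) (D m)}. 1)"
    unfolding level_index_def by (rule sum.inter_filter[symmetric]) simp
  then show ?thesis by simp
qed

lemma level_index_less:
  assumes "m < m'" "r m \<noteq> 0" "level a (r m) (D m) = level a (r m') (D m')"
  shows "level_index a r D m < level_index a r D m'"
  unfolding level_index_eq_card by (rule psubset_card_mono) (use assms in auto)

lemma level_machine:
  fixes r D g :: "nat \<Rightarrow> nat"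
  assumes "computable r" "computable D" "computable g" "0 < a"
    and idx: "\<And>m. r m \<noteq> 0 \<Longrightarrow> level_index a r D m < 2 ^ (b * level a (r m) (D m) + c)"
  shows "\<exists>M cw. prefix_free_machine M \<and> (\<forall>m. r m \<noteq> 0 \<longrightarrow>
    M (cw m) = Some (g m) \<and> length (cw m) = Suc b * level a (r m) (D m) + c + 2)"
proof -
  \<comment> \<open>Indices with \<open>r m = 0\<close> carry no vectors to describe. As
    \<open>cw\<close> has to be total, they share a dummy word that is incomparable with every
    codeword.\<close>
  define cw where "cw m = (if r m = 0 then [True] else codeword b c (level a (r m) (D m)) (level_index a r D m))" for m
  have "computable cw"
    unfolding cw_def codeword_def low_bits_def level_index_def
    by (intro computable_intros assms(4) computable_compose[OF assms(1)] computable_compose[OF assms(2)])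
  moreover have "cw m = cw m'" if "prefix (cw m) (cw m')" for m m'
  proof (cases "r m = 0 \<or> r m' = 0")
    case True
    then show ?thesis using that by (auto simp: cw_def codeword_def split: if_splits)
  next
    case False
    then show ?thesis using that prefix_codeword by (auto simp: cw_def)
  qed
  ultimately obtain M where M: "prefix_free_machine M"
      "\<And>m. (\<forall>m'. cw m' = cw m \<longrightarrow> m' = m) \<Longrightarrow> M (cw m) = Some (g m)"
    using machine_of_codewords[of cw g] assms(3) by blast
  have "M (cw m) = Some (g m)" if "r m \<noteq> 0" for m
  proof (rule M(2), intro allI impI)
    fix m' assume eq: "cw m' = cw m"
    then have r': "r m' \<noteq> 0" using that by (auto simp: cw_def codeword_def split: if_splits)
    have eq': "codeword b c (level a (r m') (D m')) (level_index a r D m') =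
        codeword b c (level a (r m) (D m)) (level_index a r D m)"
      using eq that r' by (simp add: cw_def)
    then have lev: "level a (r m') (D m') = level a (r m) (D m)"
      using prefix_codeword by (metis prefix_order.refl)
    have "low_bits (b * level a (r m) (D m) + c) (level_index a r D m') =
        low_bits (b * level a (r m) (D m) + c) (level_index a r D m)"
      using eq' unfolding codeword_def lev by simp
    then have "level_index a r D m' = level_index a r D m"
      by (rule low_bits_inj) (use idx[OF that] idx[OF r'] lev in auto)
    then have li: "\<not> level_index a r D m' < level_index a r D m" "\<not> level_index a r D m < level_index a r D m'"
      by simp_all
    show "m' = m"
    proof (rule linorder_cases[of m' m])
      assume "m' < m"
      from level_index_less[of m' m r a D, OF this r' lev] li(1) show ?thesis by (rule notE[rotated])
    next
      assume "m < m'"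
      from level_index_less[of m m' r a D, OF this that lev[symmetric]] li(2) show ?thesis by (rule notE[rotated])
    qed
  qed
  moreover have "length (cw m) = Suc b * level a (r m) (D m) + c + 2" if "r m \<noteq> 0" for m
    using that by (simp only: cw_def if_False length_codeword)
  ultimately show ?thesis using M(1) by blast
qed

text \<open>Counting each level against the convergent series bounds it by a multiple of
  \<open>2 ^ ((a - 2) * t)\<close>, so that an index within the level costs a bit less per level than
  the factor \<open>2 ^ a\<close> gained in the trace.\<close>

lemma level_card_bound:
  fixes \<tau> :: "nat \<Rightarrow> real"
  assumes s: "0 < s" "s < 1" and sm: "summable (\<lambda>m. \<tau> m powr s)" and a: "0 < a" "s * real a \<le> real b"
    and r: "\<And>m. r m \<noteq> 0 \<Longrightarrow> real (r m) \<le> 2 * (\<tau> m * real (D m))" and D: "\<And>m. D m > 0"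
    and fin: "finite I" and I: "\<And>m. m \<in> I \<Longrightarrow> r m \<noteq> 0 \<and> level a (r m) (D m) = t"
  shows "real (card I) \<le> (\<Sum>m. \<tau> m powr s) * 2 ^ (b + 1) * 2 ^ (b * t)"
proof -
  have "2 powr (- real (b * Suc t + 1)) \<le> \<tau> m powr s" if "m \<in> I" for m
  proof -
    have rm: "r m \<noteq> 0" "level a (r m) (D m) = t" using I that by auto
    have "D m < r m * 2 ^ (a * Suc t)" using level_upper[OF a(1), of "r m" "D m"] rm by simp
    then have "real (D m) < real (r m) * 2 ^ (a * Suc t)"
      by (metis of_nat_less_iff of_nat_mult of_nat_numeral of_nat_power)
    also have "\<dots> \<le> 2 * (\<tau> m * real (D m)) * 2 ^ (a * Suc t)"
      using r[OF rm(1)] by (intro mult_right_mono) auto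
    also have "\<dots> = real (D m) * (\<tau> m * 2 ^ (a * Suc t + 1))" by simp
    finally have "1 < \<tau> m * 2 ^ (a * Suc t + 1)" using D[of m] by simp
    then have "1 < \<tau> m * 2 powr real (a * Suc t + 1)" by (simp only: powr_realpow)
    then have lt: "2 powr (- real (a * Suc t + 1)) < \<tau> m"
      unfolding powr_minus by (simp add: field_simps)
    \<comment> \<open>Raising the lower bound \<open>lt\<close> to the power \<open>s\<close> turns
      its exponent into at most \<open>b * Suc t + 1\<close> bits, because \<open>s * a <= b\<close>
      and \<open>s < 1\<close>.\<close>
    have "- real (b * Suc t + 1) \<le> - real (a * Suc t + 1) * s"
    proof -
      have "s * real a * real (Suc t) \<le> real b * real (Suc t)" using a(2) by (intro mult_right_mono) auto
      then show ?thesis using s by (simp add: algebra_simps)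
    qed
    then have "2 powr (- real (b * Suc t + 1)) \<le> 2 powr (- real (a * Suc t + 1) * s)"
      by (intro powr_mono) auto
    also have "\<dots> = (2 powr (- real (a * Suc t + 1))) powr s" by (simp add: powr_powr)
    also have "\<dots> \<le> \<tau> m powr s" using lt s by (intro powr_mono2) auto
    finally show ?thesis .
  qed
  then have "(\<Sum>m\<in>I. 2 powr (- real (b * Suc t + 1))) \<le> (\<Sum>m\<in>I. \<tau> m powr s)"
    by (rule sum_mono)
  also have "\<dots> \<le> (\<Sum>m. \<tau> m powr s)" by (intro sum_le_suminf sm fin) auto
  finally have "real (card I) * 2 powr (- real (b * Suc t + 1)) \<le> (\<Sum>m. \<tau> m powr s)" by simp
  then have "real (card I) \<le> (\<Sum>m. \<tau> m powr s) * 2 powr real (b * Suc t + 1)"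
    unfolding powr_minus by (simp add: field_simps)
  also have "2 powr real (b * Suc t + 1) = (2::real) ^ (b + 1) * 2 ^ (b * t)"
    by (simp only: powr_realpow power_add[symmetric]) (simp add: algebra_simps)
  finally show ?thesis by (simp add: mult.assoc)
qed

section \<open>Bounding the levels at which a test can be failed\<close>

lemma qdim_eq: "dim_row S = 2 ^ n \<Longrightarrow> qdim S = n"
  unfolding qdim_def by (rule Least_equality) auto

theorem mainTheorem12:
  fixes U :: "bool list \<Rightarrow> nat option" and \<rho> :: "nat \<Rightarrow> complex mat"
  assumes "universal_pf_machine U"
    and "is_state \<rho>"
    and "\<forall>\<epsilon>>0. \<exists>c::real. \<forall>n. QK U \<epsilon> (\<rho> n) > ereal (real n - c)"
  shows "\<forall>s \<in> \<rat>. 0 < s \<longrightarrow> s < 1 \<longrightarrow>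
           (\<forall>S. s_strong_solovay_test s S \<longrightarrow> passes \<rho> S)"
proof (intro ballI impI allI)
  fix s :: real and S
  assume s: "0 < s" "s < 1" and test: "s_strong_solovay_test s S"
  have sst: "strong_solovay_test S" and sm: "summable (\<lambda>m. tauS (S m) powr s)"
    using test unfolding s_strong_solovay_test_def by auto
  have "\<forall>m. \<exists>n. special_projection n (S m)" using sst unfolding strong_solovay_test_def by blast
  then obtain n where proj: "\<And>m. special_projection (n m) (S m)" by metis
  obtain f where f: "total_recursive f" "\<And>m. mat_decode (f m) = Some (S m)"
    using sst unfolding strong_solovay_test_def computable_mat_seq_def by blast
  have row: "dim_row (S m) = 2 ^ n m" for m
    using proj[of m] unfolding special_projection_def by auto
  have qd: "qdim (S m) = n m" for m by (rule qdim_eq[OF row])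
  have dens: "density_matrix (2 ^ k) (\<rho> k)" for k
    using assms(2) unfolding is_state_def by blast
  then have row\<rho>: "dim_row (\<rho> k) = 2 ^ k" for k unfolding density_matrix_def by auto
  show "passes \<rho> S"
    unfolding passes_def
  proof (intro allI impI notI)
    fix \<epsilon> :: real assume \<epsilon>: "\<epsilon> > 0" and fails: "fails_at \<rho> S \<epsilon>"
    \<comment> \<open>The bound by \<open>\<epsilon> / 2\<close> preserves half of the captured
      mass; the bound by 1/2 is for \<open>r\<tau>\<close>.\<close>
    obtain Q :: nat where Q: "Q > 0" "1 / real Q \<le> \<epsilon> / 2" "1 / real Q \<le> 1 / 2"
    proof -
      obtain q :: nat where "q > 0" "inverse (real q) < min (\<epsilon> / 2) (1 / 2)"
        using ex_inverse_of_nat_less[of "min (\<epsilon> / 2) (1 / 2)"] \<epsilon> by auto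
      then show ?thesis by (intro that[of q]) (auto simp: inverse_eq_divide)
    qed
    have cf: "computable f" using f(1) by (simp add: computable_nat_iff)
    have "\<exists>w. good_approx Q (f m) w" for m
      by (rule good_approx_exists[OF f(2) proj Q(1)])
    then obtain h where h: "computable h" "\<And>m. good_approx Q (f m) (h m)"
      using computable_choice[OF computable_good_approx[OF cf, of Q]] by blast
    define d vs where "d m = fst (h m)" and "vs m = fst (snd (h m))" for m
    define r where "r m = length (vs m)" for m
    define D where "D m = length (list_decode (f m))" for m
    define g where "g m = set_code (d m) (vs m)" for m
    have comp: "computable r" "computable D" "computable g"
      unfolding r_def D_def g_def d_def vs_def
      by (intro computable_intros h(1) cf computable_compose[OF h(1)] computable_compose[OF cf])+
    have D: "D m = 2 ^ n m" for m
      unfolding D_def using mat_decode_entry(1)[OF f(2)[of m]] row[of m] by simp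
    define F where "F m = the (vecset_decode (g m))" for m
    have F_all: "vecset_decode (g m) = Some (F m) \<and> F m \<subseteq> carrier_vec (2 ^ n m) \<and> orthonormal (F m) \<and>
        card (F m) = r m \<and> \<bar>(\<Sum>v\<in>F m. Re (braket v (\<rho> (n m)) v)) - Re (mtrace (\<rho> (n m) * S m))\<bar> \<le> 1 / real Q \<and>
        \<bar>real (r m) - Re (mtrace (S m))\<bar> \<le> 1 / real Q" for m
    proof -
      have "good_approx Q (f m) (d m, vs m, snd (snd (h m)))"
        using h(2)[of m] by (simp add: d_def vs_def)
      then show ?thesis
      proof (rule good_approx_sound[OF f(2)[of m] proj[of m] Q(1)])
        fix G
        assume G: "vecset_decode (set_code (d m) (vs m)) = Some G" "G \<subseteq> carrier_vec (2 ^ n m)"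
          "orthonormal G" "card G = length (vs m)"
          "\<And>A. density_matrix (2 ^ n m) A \<Longrightarrow> \<bar>(\<Sum>v\<in>G. Re (braket v A v)) - Re (mtrace (A * S m))\<bar> \<le> 1 / real Q"
          "\<bar>real (length (vs m)) - Re (mtrace (S m))\<bar> \<le> 1 / real Q"
        have "F m = G" using G(1) by (simp add: F_def g_def)
        then show ?thesis
          using G(1-4,6) G(5)[OF dens[of "n m"]] by (simp add: g_def r_def)
      qed
    qed
    have F: "\<And>m. vecset_decode (g m) = Some (F m)" "\<And>m. F m \<subseteq> carrier_vec (2 ^ n m)"
        "\<And>m. orthonormal (F m)" "\<And>m. card (F m) = r m"
        "\<And>m. \<bar>(\<Sum>v\<in>F m. Re (braket v (\<rho> (n m)) v)) - Re (mtrace (\<rho> (n m) * S m))\<bar> \<le> 1 / real Q"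
        "\<And>m. \<bar>real (r m) - Re (mtrace (S m))\<bar> \<le> 1 / real Q"
      using F_all by blast+
    \<comment> \<open>A nonzero \<open>r m\<close> is at least 1, so the trace is at least
      \<open>r m - 1/2\<close>, hence at least half of \<open>r m\<close>.\<close>
    have r\<tau>: "real (r m) \<le> 2 * (tauS (S m) * real (D m))" if "r m \<noteq> 0" for m
    proof -
      have "Re (mtrace (S m)) = tauS (S m) * real (D m)" by (simp add: tauS_def qd D)
      moreover have "real (r m) \<ge> 1" using that by simp
      ultimately show ?thesis using F(6)[of m] Q(3) by linarith
    qed
    \<comment> \<open>From \<open>k * (1 - s) >= 2\<close> follows \<open>s * (k + 2) <= k\<close>,
      as \<open>2 * s < 2\<close>. The gap 2 between \<open>a\<close> and \<open>b\<close> pays the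
      unary part and still saves one bit per level.\<close>
    obtain a b where ab: "0 < a" "s * real a \<le> real b" "a = b + 2"
    proof -
      obtain k :: nat where k: "2 / (1 - s) \<le> real k" using real_arch_simple by blast
      then have "2 \<le> real k * (1 - s)" using s by (simp add: pos_divide_le_eq)
      then show ?thesis using s by (intro that[of "k + 2" k]) (auto simp: algebra_simps)
    qed
    define C where "C = (\<Sum>m. tauS (S m) powr s)"
    have card: "real (card I) \<le> C * 2 ^ (b + 1) * 2 ^ (b * t)"
      if "finite I" "\<And>m. m \<in> I \<Longrightarrow> r m \<noteq> 0 \<and> level a (r m) (D m) = t" for I t
      unfolding C_def by (rule level_card_bound[OF s sm ab(1,2) r\<tau> _ that]) (auto simp: D)
    \<comment> \<open>The constant factor in the size of a level is absorbed by \<open>c\<close>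
      extra index bits.\<close>
    obtain c where c: "C * 2 ^ (b + 1) < 2 ^ c" using real_arch_pow[of 2 "C * 2 ^ (b + 1)"] by auto
    have idx: "level_index a r D m < 2 ^ (b * level a (r m) (D m) + c)" for m
    proof -
      have "real (level_index a r D m) \<le> C * 2 ^ (b + 1) * 2 ^ (b * level a (r m) (D m))"
        unfolding level_index_eq_card by (rule card) auto
      also have "\<dots> < 2 ^ c * 2 ^ (b * level a (r m) (D m))" using c by (intro mult_strict_right_mono) auto
      also have "\<dots> = real (2 ^ (b * level a (r m) (D m) + c))" by (simp add: power_add)
      finally show ?thesis by (simp only: of_nat_less_iff)
    qed
    obtain M cw where M: "prefix_free_machine M" "\<And>m. r m \<noteq> 0 \<Longrightarrow> M (cw m) = Some (g m)"
        "\<And>m. r m \<noteq> 0 \<Longrightarrow> length (cw m) = Suc b * level a (r m) (D m) + c + 2"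
      using level_machine[OF comp ab(1) idx] by blast
    \<comment> \<open>The prefix by which \<open>U\<close> simulates \<open>M\<close> lengthens all
      descriptions by the same amount.\<close>
    obtain \<eta> where \<eta>: "\<And>\<sigma>. U (\<eta> @ \<sigma>) = M \<sigma>"
      using assms(1) M(1) unfolding universal_pf_machine_def by blast
    obtain c0 where c0: "\<And>k. QK U (\<epsilon> / 2) (\<rho> k) > ereal (real k - c0)"
      using assms(3) \<epsilon> by (metis half_gt_zero)
    \<comment> \<open>Obtained by solving
      \<open>n - c0 < length \<eta> + (b + 1) t + c + 2 + (n - a t)\<close> for \<open>t\<close>
      with \<open>a = b + 2\<close>.\<close>
    define T where "T = nat \<lceil>real (length \<eta>) + real c + 2 + c0\<rceil>"
    have bound: "r m \<noteq> 0 \<and> level a (r m) (D m) \<le> T" if m: "rhoS \<rho> (S m) > \<epsilon>" for m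
    proof -
      define t where "t = level a (r m) (D m)"
      have big: "(\<Sum>v\<in>F m. Re (braket v (\<rho> (n m)) v)) > \<epsilon> / 2"
        using F(5)[of m] m Q(2) unfolding rhoS_def qd by linarith
      \<comment> \<open>Positive captured mass rules out the empty set, so \<open>m\<close> has a
        level and a proper codeword.\<close>
      then have "F m \<noteq> {}" using \<epsilon> by auto
      moreover have "finite (F m)"
        using F(1)[of m] unfolding vecset_decode_def Let_def
        by (metis List.finite_set option.distinct(1) option.inject)
      ultimately have r0: "r m \<noteq> 0" unfolding F(4)[symmetric] by simp
      have "t \<le> T"
      \<comment> \<open>\<open>level_lower\<close> speaks only of positive levels; level 0 meets the
        bound trivially.\<close>
      proof (cases "t = 0")
        case False
        have "QK U (\<epsilon> / 2) (\<rho> (n m)) \<le> ereal (real (length (\<eta> @ cw m)) + log 2 (real (card (F m))))"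
          unfolding QK_def
          by (rule Inf_lower)
            (use \<eta> M(2)[OF r0] F(1-3)[of m] big row\<rho> in \<open>auto intro!: exI[of _ "\<eta> @ cw m"] exI[of _ "F m"] exI[of _ "g m"]\<close>)
        with c0[of "n m"] have "ereal (real (n m) - c0) < ereal (real (length (\<eta> @ cw m)) + log 2 (real (card (F m))))"
          by (rule less_le_trans)
        then have 1: "real (n m) - c0 < real (length \<eta>) + real (Suc b * t + c + 2) + log 2 (real (r m))"
          using M(3)[OF r0] by (simp add: t_def F(4))
        have "r m * 2 ^ (a * t) \<le> 2 ^ n m"
          using level_lower[of a "r m" "D m"] False unfolding D t_def by simp
        then have "real (r m * 2 ^ (a * t)) \<le> real (2 ^ n m)" by (simp only: of_nat_le_iff)
        then have "real (r m) * 2 ^ (a * t) \<le> 2 ^ n m" by simp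
        then have "log 2 (real (r m) * 2 ^ (a * t)) \<le> log 2 (2 ^ n m)"
          using r0 by (subst log_le_cancel_iff) auto
        then have "log 2 (real (r m)) + real (a * t) \<le> real (n m)"
          using r0 by (simp add: log_mult log_nat_power)
        with 1 have "real t < real (length \<eta>) + real c + 2 + c0"
          unfolding ab(3) by (simp add: algebra_simps)
        then show ?thesis unfolding T_def by linarith
      qed simp
      with r0 show ?thesis by (simp add: t_def)
    qed
    \<comment> \<open>An infinite level would contain finite subsets of every size, against the
      uniform bound \<open>card\<close>.\<close>
    have "finite {m. r m \<noteq> 0 \<and> level a (r m) (D m) = t}" for t
    proof (rule ccontr)
      assume inf: "infinite {m. r m \<noteq> 0 \<and> level a (r m) (D m) = t}"
      obtain k :: nat where k: "C * 2 ^ (b + 1) * 2 ^ (b * t) < real k" using reals_Archimedean2 by blast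
      obtain I where "I \<subseteq> {m. r m \<noteq> 0 \<and> level a (r m) (D m) = t}" "finite I" "card I = k"
        using infinite_arbitrarily_large[OF inf, of k] by blast
      with card[of I t] k show False by auto
    qed
    then have "finite (\<Union>t\<le>T. {m. r m \<noteq> 0 \<and> level a (r m) (D m) = t})" by blast
    moreover have "{m. rhoS \<rho> (S m) > \<epsilon>} \<subseteq> (\<Union>t\<le>T. {m. r m \<noteq> 0 \<and> level a (r m) (D m) = t})"
      using bound by auto
    ultimately show False using fails unfolding fails_at_def by (meson finite_subset)
  qed
qed

end
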